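(* Let $X$ be a Banach space with a Schauder basis. Then either $X$ is ergodic, or there exist $K\ge 1$ and a sequence $(\tilde{x}_n)_{n\in\mathbb{N}}$ of successive finite block-sequences such that all block-sequences passing through infinitely many of the $\tilde{x}_n$'s span mutually $K$-isomorphic subspaces.
   Context: $X$ is an infinite-dimensional Banach space with a Schauder basis $\{e_i\}$; $\mathrm{supp}(x)$ is the support of $x$ with respect to $\{e_i\}$. A (finite or infinite) block-sequence is a sequence of norm-one finitely supported vectors $(y_i)$ with $\max\mathrm{supp}(y_i)<\min\mathrm{supp}(y_{i+1})$; "all block-sequences" refers to infinite ones, and such a sequence spans its closed linear span. Finite block-sequences are nonempty; they are successive, $\tilde{x}<\tilde{y}$, if all supports of terms of $\tilde{x}$ lie before all supports of terms of $\tilde{y}$, and $(\tilde{x}_n)$ is successive if $\tilde{x}_n<\tilde{x}_{n+1}$ for all $n$. A block-sequence $(y_i)$ passes through the finite block-sequence $\tilde{x}=(x_1,\ldots,x_n)$ if there is an integer $m$ such that $y_{m+i}=x_i$ for all $1\le i\le n$. Two spaces are $K$-isomorphic if there is an isomorphism $T$ between them with $\|T\|\,\|T^{-1}\|\le K$. $\mathcal{B}_X$ is the set of closed linear subspaces of $X$ with its Effros-Borel structure (the $\sigma$-algebra generated by the sets $\{F : F\cap U\neq\emptyset\}$, $U\subset X$ open). $E_0$ is the relation on $2^\omega$ of eventual agreement of binary sequences. $X$ is ergodic if there is a Borel map $f:2^\omega\to\mathcal{B}_X$ such that $\alpha E_0\beta$ if and only if $f(\alpha)$ and $f(\beta)$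 are isomorphic. *)

theory Defs
  imports "HOL-Analysis.Analysis"
begin

text \<open>A Schauder basis is a sequence indexed by the naturals. Uniqueness of the expansions makes it
  linearly independent, so a space with such a basis is infinite-dimensional.\<close>

definition schauder_basis :: "(nat \<Rightarrow> 'a::banach) \<Rightarrow> bool" where
  "schauder_basis e \<longleftrightarrow> (\<forall>x. \<exists>!a::nat \<Rightarrow> real. (\<lambda>n. a n *\<^sub>R e n) sums x)"

definition coords :: "(nat \<Rightarrow> 'a::banach) \<Rightarrow> 'a \<Rightarrow> nat \<Rightarrow> real" where
  "coords e x = (THE a. (\<lambda>n. a n *\<^sub>R e n) sums x)"

definition supp :: "(nat \<Rightarrow> 'a::banach) \<Rightarrow> 'a \<Rightarrow> nat set" where
  "supp e x = {n. coords e x n \<noteq> 0}"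

text \<open>The terms of block-sequences have norm one, so their supports are nonempty and
  \<^const>\<open>Max\<close> and \<^const>\<open>Min\<close> below are meaningful.\<close>

definition block_seq :: "(nat \<Rightarrow> 'a::banach) \<Rightarrow> (nat \<Rightarrow> 'a) \<Rightarrow> bool" where
  "block_seq e y \<longleftrightarrow>
     (\<forall>i. norm (y i) = 1 \<and> finite (supp e (y i))) \<and>
     (\<forall>i. Max (supp e (y i)) < Min (supp e (y (Suc i))))"

definition finite_block_seq :: "(nat \<Rightarrow> 'a::banach) \<Rightarrow> 'a list \<Rightarrow> bool" where
  "finite_block_seq e xs \<longleftrightarrow>
     xs \<noteq> [] \<and>
     (\<forall>x\<in>set xs. norm x = 1 \<and> finite (supp e x)) \<and>
     (\<forall>i. Suc i < length xs \<longrightarrow> Max (supp e (xs ! i)) < Min (supp e (xs ! Suc i)))"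

definition successive :: "(nat \<Rightarrow> 'a::banach) \<Rightarrow> 'a list \<Rightarrow> 'a list \<Rightarrow> bool" where
  "successive e xs ys \<longleftrightarrow> (\<forall>x\<in>set xs. \<forall>y\<in>set ys. Max (supp e x) < Min (supp e y))"

definition passes_through :: "(nat \<Rightarrow> 'a) \<Rightarrow> 'a list \<Rightarrow> bool" where
  "passes_through y xs \<longleftrightarrow> (\<exists>m. \<forall>i<length xs. y (m + i) = xs ! i)"

definition closed_span :: "'a::real_normed_vector set \<Rightarrow> 'a set" where
  "closed_span S = closure (span S)"

definition bounded_linear_on :: "'a::real_normed_vector set \<Rightarrow> ('a \<Rightarrow> 'b::real_normed_vector) \<Rightarrow> bool" where
  "bounded_linear_on V T \<longleftrightarrow>
     (\<forall>x\<in>V. \<forall>y\<in>V. T (x + y) = T x + T y) \<and>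
     (\<forall>c. \<forall>x\<in>V. T (c *\<^sub>R x) = c *\<^sub>R T x) \<and>
     (\<exists>B. \<forall>x\<in>V. norm (T x) \<le> B * norm x)"

text \<open>The analogue of \<^const>\<open>onorm\<close> for a map restricted to a subspace; the supremum is
  only meaningful for maps that are bounded on \<open>V\<close>.\<close>

definition onorm_on :: "'a::real_normed_vector set \<Rightarrow> ('a \<Rightarrow> 'b::real_normed_vector) \<Rightarrow> real" where
  "onorm_on V T = (SUP x\<in>V. norm (T x) / norm x)"

definition isomorphism_on ::
  "'a::real_normed_vector set \<Rightarrow> 'b::real_normed_vector set \<Rightarrow> ('a \<Rightarrow> 'b) \<Rightarrow> bool" where
  "isomorphism_on V W T \<longleftrightarrow>
     bij_betw T V W \<and> bounded_linear_on V T \<and> bounded_linear_on W (inv_into V T)"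

definition isomorphic_subspaces ::
  "'a::real_normed_vector set \<Rightarrow> 'b::real_normed_vector set \<Rightarrow> bool" where
  "isomorphic_subspaces V W \<longleftrightarrow> (\<exists>T. isomorphism_on V W T)"

definition K_isomorphic ::
  "real \<Rightarrow> 'a::real_normed_vector set \<Rightarrow> 'b::real_normed_vector set \<Rightarrow> bool" where
  "K_isomorphic K V W \<longleftrightarrow>
     (\<exists>T. isomorphism_on V W T \<and> onorm_on V T * onorm_on W (inv_into V T) \<le> K)"

definition closed_subspaces :: "'a::real_normed_vector set set" where
  "closed_subspaces = {F. subspace F \<and> closed F}"

definition effros_borel :: "'a::real_normed_vector set measure" where
  "effros_borel = sigma closed_subspaces {{F \<in> closed_subspaces. F \<inter> U \<noteq> {}} | U. open U}"

definition E0 :: "(nat \<Rightarrow> bool) \<Rightarrow> (nat \<Rightarrow> bool) \<Rightarrow> bool" where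
  "E0 \<alpha> \<beta> \<longleftrightarrow> (\<exists>n. \<forall>m\<ge>n. \<alpha> m = \<beta> m)"

text \<open>Ergodicity is a property of the whole space, here the type \<open>'a\<close>. The Borel structure on
  \<open>nat \<Rightarrow> bool\<close> is that of the product topology, with \<open>bool\<close> discrete.\<close>

definition ergodic :: "'a::banach itself \<Rightarrow> bool" where
  "ergodic X \<longleftrightarrow>
     (\<exists>f \<in> borel \<rightarrow>\<^sub>M (effros_borel :: 'a set measure).
        \<forall>\<alpha> \<beta>. E0 \<alpha> \<beta> \<longleftrightarrow> isomorphic_subspaces (f \<alpha>) (f \<beta>))"

end

theory Submission
  imports Defs
begin

text \<open>The theorem is a zero-one phenomenon for the isomorphism relation between the spans of block-sequences.
Replace the unit sphere by a countable set of unit vectors, the net vectors, so fine that moving every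
term of a block-sequence to the net changes its span only up to an isomorphism with a fixed constant
(\<open>to_net_block_seq\<close>). The block-sequences of net vectors are the branches of a countable tree, and Baire
category makes sense for them and for pairs of them. Let \<open>iso_pairs\<close> be the set of those pairs of branches
whose spans are isomorphic. The two cases of the theorem are: this set is meager, or it is not.

If it is meager, finite blocks \<open>s n False\<close> and \<open>s n True\<close> of equal length are chosen inductively such that,
whatever initial segments were built before, continuing one by \<open>s n False\<close> and another one by \<open>s n True\<close>
forces the pair out of the first \<open>n\<close> nowhere dense sets covering \<open>iso_pairs\<close>. The
concatenation of the blocks selected by a binary sequence gives the reduction: binary sequences that differ
infinitely often have non-isomorphic spans, and sequences that eventually agree
give block-sequences that differ in finitely many terms, hence isomorphic spans
(\<open>ergodic_if_meager\<close>).

If it is not meager, then for some fixed constant the set of pairs that are isomorphic with this constant is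
not meager. Up to doubling the constant, that set is the projection of a closed relation, because an
isomorphism can be described, after a small perturbation, by countably many rational coefficients
(\<open>iso_code_closed\<close>). A non-meager set of this kind is comeager in some box of the base
(\<open>analytic_comeager_somewhere\<close>). Only finitely many net vectors lie below a given index, so one finite
block can handle all initial segments below it at once: successive finite blocks and one branch \<open>z\<close> are built
such that every branch starting in the box and passing through infinitely many of the blocks spans a space
isomorphic to that of \<open>z\<close> with the fixed constant (\<open>iso_code_if_passing\<close>). It remains to remove the condition
on the beginning of the branch. Its first terms are exchanged for the prescribed ones,
and the number of dimensions lost or gained is bounded in terms of the box; \<open>lin_iso_of_replaced\<close> shows that
this costs a constant independent of the branch.

The perturbations and the finite changes need that coefficients of block-sequences are uniformly bounded by the
norm, which is the uniform boundedness of the basis projections (\<open>bounded_projections\<close>).\<close>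

section \<open>Uniform boundedness of the basis projections\<close>

locale schauder =
  fixes e :: "nat \<Rightarrow> 'a::banach"
  assumes basis: "schauder_basis e"
begin

lemma coords_sums: "(\<lambda>n. coords e x n *\<^sub>R e n) sums x"
proof -
  have "\<exists>!a. (\<lambda>n. a n *\<^sub>R e n) sums x"
    using basis unfolding schauder_basis_def by blast
  then show ?thesis unfolding coords_def by (rule theI')
qed

lemma coords_unique: "(\<lambda>n. a n *\<^sub>R e n) sums x \<Longrightarrow> coords e x = a"
  using basis coords_sums[of x] unfolding schauder_basis_def by blast

lemma coords_add: "coords e (x + y) n = coords e x n + coords e y n"
  using coords_unique[of "\<lambda>n. coords e x n + coords e y n" "x + y"]
    sums_add[OF coords_sums[of x] coords_sums[of y]] by (simp add: scaleR_add_left)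

lemma coords_scaleR: "coords e (c *\<^sub>R x) n = c * coords e x n"
  using coords_unique[of "\<lambda>n. c * coords e x n" "c *\<^sub>R x"]
    bounded_linear.sums[OF bounded_linear_scaleR_right coords_sums[of x], of c] by simp

definition proj :: "nat \<Rightarrow> 'a \<Rightarrow> 'a" where
  "proj N x = (\<Sum>i<N. coords e x i *\<^sub>R e i)"

lemma linear_proj: "linear (proj N)"
  by (intro linearI)
    (simp_all add: proj_def coords_add coords_scaleR scaleR_add_left sum.distrib scaleR_sum_right)

lemma proj_tendsto: "(\<lambda>N. proj N x) \<longlonglongrightarrow> x"
  using coords_sums[of x] unfolding proj_def sums_def .

lemma proj_Suc: "proj (Suc i) x - proj i x = coords e x i *\<^sub>R e i"
  by (simp add: proj_def)

text \<open>The sets of vectors all of whose partial sums have norm at most \<open>k\<close> cover the space, so by Baire's theorem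
the closure of one of them contains a ball. Symmetry and convexity move the ball to the origin, and scaling
gives approximation at every norm.\<close>

lemma approx_with_bounded_proj:
  obtains c where "c > 0"
    "\<And>x \<epsilon>. \<epsilon> > 0 \<Longrightarrow> \<exists>a. norm (x - a) < \<epsilon> \<and> (\<forall>N. norm (proj N a) \<le> c * norm x)"
proof -
  define A where "A k = {x. \<forall>N. norm (proj N x) \<le> real k}" for k
  have cover: "\<exists>k. x \<in> A k" for x
  proof -
    have "Bseq (\<lambda>N. proj N x)"
      using proj_tendsto convergent_imp_Bseq convergent_def by blast
    then obtain B where B: "\<And>N. norm (proj N x) \<le> B"
      by (meson BseqE)
    obtain k where "B \<le> real k"
      using real_arch_simple by blast
    then have "norm (proj N x) \<le> real k" for N
      using B[of N] by linarith
    then show ?thesis unfolding A_def by blast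
  qed
  have "\<exists>k. interior (closure (A k)) \<noteq> {}"
  proof (rule ccontr)
    assume "\<not> ?thesis"
    then have "euclidean interior_of \<Union> (range (\<lambda>k. closure (A k))) = {}"
      by (intro Baire_category_alt) (auto intro: completely_metrizable_space_euclidean)
    moreover have "\<Union> (range (\<lambda>k. closure (A k))) = UNIV"
      using cover closure_subset by blast
    ultimately show False by simp
  qed
  then obtain k x0 where "x0 \<in> interior (closure (A k))" by blast
  then obtain r where r: "r > 0" "ball x0 r \<subseteq> closure (A k)"
    by (meson mem_interior)
  have near0: "\<exists>a. norm (x - a) < \<epsilon> \<and> a \<in> A k" if "norm x < r" "\<epsilon> > 0" for x \<epsilon>
  proof -
    have "x0 + x \<in> closure (A k)" "x0 - x \<in> closure (A k)"
      using r(2) that(1) by (auto simp: dist_norm subset_iff)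
    then obtain a b where ab: "a \<in> A k" "dist a (x0 + x) < \<epsilon>" "b \<in> A k" "dist b (x0 - x) < \<epsilon>"
      using \<open>\<epsilon> > 0\<close> unfolding closure_approachable by blast
    \<comment> \<open>\<open>x\<close> is half the difference of \<open>x0 + x\<close> and \<open>x0 - x\<close>.\<close>
    define m where "m = (1/2) *\<^sub>R (a - b)"
    have "x - m = (1/2) *\<^sub>R (((x0 + x) - a) - ((x0 - x) - b))"
      unfolding m_def by (simp add: algebra_simps flip: scaleR_add_left)
    then have "norm (x - m) \<le> (1/2) * (norm ((x0 + x) - a) + norm ((x0 - x) - b))"
      using norm_triangle_ineq4[of "(x0 + x) - a" "(x0 - x) - b"] by simp
    then have "norm (x - m) < \<epsilon>"
      using ab(2,4) by (simp add: dist_norm norm_minus_commute)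
    moreover have "norm (proj N m) \<le> real k" for N
    proof -
      have "proj N m = (1/2) *\<^sub>R (proj N a - proj N b)"
        unfolding m_def by (simp add: linear_diff[OF linear_proj] linear_cmul[OF linear_proj])
      then have "norm (proj N m) \<le> (1/2) * (norm (proj N a) + norm (proj N b))"
        using norm_triangle_ineq4[of "proj N a" "proj N b"] by simp
      moreover have "norm (proj N a) \<le> k" "norm (proj N b) \<le> k"
        using ab(1,3) unfolding A_def by auto
      ultimately show ?thesis by (simp add: field_simps)
    qed
    ultimately show ?thesis unfolding A_def by blast
  qed
  define c where "c = (real k + 1) * 2 / r"
  have "c > 0" using r by (simp add: c_def)
  moreover have "\<exists>a. norm (x - a) < \<epsilon> \<and> (\<forall>N. norm (proj N a) \<le> c * norm x)" if \<epsilon>: "\<epsilon> > 0" for x \<epsilon>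
  proof (cases "x = 0")
    case True
    then show ?thesis using \<epsilon> linear_0[OF linear_proj] by (intro exI[of _ 0]) simp
  next
    case False
    define t where "t = r / (2 * norm x)"
    have t: "t > 0" using False r by (simp add: t_def)
    have "norm (t *\<^sub>R x) < r" using False r by (simp add: t_def)
    from near0[OF this, of "t * \<epsilon>"] obtain a where a: "norm (t *\<^sub>R x - a) < t * \<epsilon>" "a \<in> A k"
      using t \<epsilon> by auto
    have "norm (x - (1/t) *\<^sub>R a) = (1/t) * norm (t *\<^sub>R x - a)"
    proof -
      have "x - (1/t) *\<^sub>R a = (1/t) *\<^sub>R (t *\<^sub>R x - a)"
        using t by (simp add: scaleR_diff_right)
      then show ?thesis using t by simp
    qed
    also have "\<dots> < \<epsilon>" using a(1) t by (simp add: field_simps)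
    finally have "norm (x - (1/t) *\<^sub>R a) < \<epsilon>" .
    moreover have "norm (proj N ((1/t) *\<^sub>R a)) \<le> c * norm x" for N
    proof -
      have "norm (proj N ((1/t) *\<^sub>R a)) = (1/t) * norm (proj N a)"
        using t by (simp add: linear_cmul[OF linear_proj])
      also have "\<dots> \<le> (1/t) * (real k + 1)"
      proof (rule mult_left_mono)
        have "norm (proj N a) \<le> k" using a(2) unfolding A_def by blast
        then show "norm (proj N a) \<le> real k + 1" by simp
      qed (use t in simp)
      also have "\<dots> = c * norm x" using r False by (simp add: t_def c_def)
      finally show ?thesis .
    qed
    ultimately show ?thesis by blast
  qed
  ultimately show thesis using that by blast
qed

lemma e_nonzero: "e n \<noteq> 0"
proof
  assume "e n = 0"
  then have "(\<lambda>i. (if i = n then 1 else 0) *\<^sub>R e i) = (\<lambda>i. 0)" by auto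
  then have "coords e 0 = (\<lambda>i. if i = n then 1 else (0::real))"
    by (intro coords_unique) simp
  moreover have "coords e 0 = (\<lambda>i. 0)"
    by (intro coords_unique) simp
  ultimately have "(if n = n then 1 else (0::real)) = 0"
    by (metis (mono_tags))
  then show False by simp
qed

text \<open>The approximation is iterated as in the open mapping theorem: \<open>x\<close> becomes a series of vectors with
geometrically decreasing partial sums. Adding up the coordinates of these vectors gives an expansion
of \<open>x\<close> whose partial sums are controlled, and by uniqueness it is the expansion of \<open>x\<close>.\<close>

theorem bounded_projections:
  obtains C where "C \<ge> 1" "\<And>N x. norm (proj N x) \<le> C * norm x"
proof -
  obtain c where c: "c > 0"
    and approx: "\<And>x \<epsilon>. \<epsilon> > 0 \<Longrightarrow> \<exists>a. norm (x - a) < \<epsilon> \<and> (\<forall>N. norm (proj N a) \<le> c * norm x)"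
    using approx_with_bounded_proj by blast
  have main: "norm (proj N x) \<le> 2 * c * norm x" for N x
  proof (cases "x = 0")
    case True
    then show ?thesis by (simp add: linear_0[OF linear_proj])
  next
    case False
    define d where "d = norm x"
    have d: "d > 0" using False by (simp add: d_def)
    define step where
      "step n y = (SOME a. norm (y - a) < d / 2 ^ Suc n \<and> (\<forall>N. norm (proj N a) \<le> c * norm y))" for n y
    have step: "norm (y - step n y) < d / 2 ^ Suc n" "norm (proj N (step n y)) \<le> c * norm y" for n y N
      using someI_ex[OF approx[of "d / 2 ^ Suc n" y]] d unfolding step_def by auto
    define r where "r = rec_nat x (\<lambda>n y. y - step n y)"
    have r0: "r 0 = x" and rS: "r (Suc n) = r n - step n (r n)" for n
      by (simp_all add: r_def)
    define a where "a n = step n (r n)" for n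
    have rb: "norm (r n) \<le> d / 2 ^ n" for n
    proof (cases n)
      case 0
      then show ?thesis by (simp add: r0 d_def)
    next
      case (Suc m)
      then show ?thesis using step(1)[of "r m" m] by (simp add: rS)
    qed
    have ab: "norm (proj N (a n)) \<le> c * d / 2 ^ n" for N n
    proof -
      have "norm (proj N (a n)) \<le> c * norm (r n)" unfolding a_def by (rule step(2))
      also have "\<dots> \<le> c * (d / 2 ^ n)" using rb c by (intro mult_left_mono) auto
      finally show ?thesis by simp
    qed
    have xsum: "x = (\<Sum>n<m. a n) + r m" for m
      by (induction m) (simp_all add: r0 rS a_def)
    have geo: "(\<lambda>n. c * d / 2 ^ n) sums (c * d * 2)"
      using sums_mult[OF geometric_sums[of "1/2::real"], of "c * d"]
      by (simp add: power_one_over field_simps)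
    have psum: "summable (\<lambda>n. norm (proj N (a n)))" for N
      by (rule summable_comparison_test'[OF sums_summable[OF geo]]) (simp add: ab)
    define s where "s N = (\<Sum>n. proj N (a n))" for N
    have sb: "norm (s N) \<le> c * d * 2" for N
    proof -
      have "norm (s N) \<le> (\<Sum>n. norm (proj N (a n)))"
        unfolding s_def by (rule summable_norm[OF psum])
      also have "\<dots> \<le> (\<Sum>n. c * d / 2 ^ n)"
        by (rule suminf_le[OF _ psum sums_summable[OF geo]]) (simp add: ab)
      finally show ?thesis using sums_unique[OF geo] by simp
    qed
    have csum: "summable (\<lambda>n. coords e (a n) i)" for i
    proof (rule summable_norm_cancel)
      have bd: "norm (coords e (a n) i) \<le> (2 * (c * d / 2 ^ n)) / norm (e i)" for n
      proof -
        have "norm (coords e (a n) i) * norm (e i) = norm (proj (Suc i) (a n) - proj i (a n))"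
          by (simp add: proj_Suc)
        also have "\<dots> \<le> 2 * (c * d / 2 ^ n)"
          using norm_triangle_ineq4[of "proj (Suc i) (a n)" "proj i (a n)"] ab[of i n] ab[of "Suc i" n]
          by linarith
        finally show ?thesis by (simp add: e_nonzero field_simps)
      qed
      have su: "summable (\<lambda>n. (2 * (c * d / 2 ^ n)) / norm (e i))"
        using sums_summable[OF geo] by (intro summable_divide summable_mult)
      show "summable (\<lambda>n. norm (coords e (a n) i))"
        by (rule summable_comparison_test'[OF su, of 0]) (use bd in simp)
    qed
    define b where "b i = (\<Sum>n. coords e (a n) i)" for i
    have s_eq: "s N = (\<Sum>i<N. b i *\<^sub>R e i)" for N
    proof -
      have "(\<lambda>n. \<Sum>i<N. coords e (a n) i *\<^sub>R e i) sums (\<Sum>i<N. b i *\<^sub>R e i)"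
        unfolding b_def
        by (intro sums_sum bounded_linear.sums[OF bounded_linear_scaleR_left] summable_sums csum)
      then show ?thesis unfolding s_def proj_def by (simp add: sums_iff)
    qed
    have "s \<longlonglongrightarrow> x"
    proof (rule LIMSEQ_I)
      fix \<epsilon> :: real assume \<epsilon>: "\<epsilon> > 0"
      have "(\<lambda>m. (2 * c * d + d) * (1/2) ^ m) \<longlonglongrightarrow> (2 * c * d + d) * 0"
        by (intro tendsto_mult tendsto_const LIMSEQ_power_zero) simp
      then have "(\<lambda>m. (2 * c * d + d) / 2 ^ m) \<longlonglongrightarrow> 0"
        by (simp add: power_one_over del: tendsto_mult_left_iff tendsto_mult_right_iff)
      then have "\<forall>\<^sub>F m in sequentially. (2 * c * d + d) / 2 ^ m < \<epsilon>/2"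
        by (rule order_tendstoD(2)) (use \<epsilon> in simp)
      \<comment> \<open>The tail of the series beyond \<open>m\<close> is small uniformly in \<open>N\<close>; the first \<open>m\<close> terms converge separately.\<close>
      then obtain m where m: "(2 * c * d + d) / 2 ^ m < \<epsilon>/2"
        using eventually_happens'[OF sequentially_bot] by blast
      have "(\<lambda>N. \<Sum>n<m. proj N (a n)) \<longlonglongrightarrow> (\<Sum>n<m. a n)"
        by (intro tendsto_sum proj_tendsto)
      from LIMSEQ_D[OF this, of "\<epsilon>/2"] \<epsilon> obtain N0
        where N0: "\<And>N. N \<ge> N0 \<Longrightarrow> norm ((\<Sum>n<m. proj N (a n)) - (\<Sum>n<m. a n)) < \<epsilon>/2" by auto
      have "norm (s N - x) < \<epsilon>" if "N \<ge> N0" for N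
      proof -
        define t where "t = (\<Sum>n. proj N (a (n + m)))"
        have split: "s N = t + (\<Sum>n<m. proj N (a n))"
          unfolding s_def t_def by (rule suminf_split_initial_segment[OF summable_norm_cancel[OF psum]])
        have geo': "(\<lambda>n. c * d / 2 ^ (n + m)) sums (c * d * 2 / 2 ^ m)"
          using sums_divide[OF geo, of "2 ^ m"] by (simp add: power_add)
        have ps': "summable (\<lambda>n. norm (proj N (a (n + m))))"
          using psum by (subst summable_iff_shift)
        have "norm t \<le> (\<Sum>n. norm (proj N (a (n + m))))"
          unfolding t_def by (rule summable_norm[OF ps'])
        also have "\<dots> \<le> (\<Sum>n. c * d / 2 ^ (n + m))"
          by (rule suminf_le[OF _ ps' sums_summable[OF geo']]) (simp add: ab)
        finally have t: "norm t \<le> c * d * 2 / 2 ^ m" using sums_unique[OF geo'] by simp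
        have "s N - x = t + ((\<Sum>n<m. proj N (a n)) - (\<Sum>n<m. a n)) - r m"
          using split by (subst xsum[of m]) (simp add: algebra_simps)
        then have "norm (s N - x) \<le> norm t + norm ((\<Sum>n<m. proj N (a n)) - (\<Sum>n<m. a n)) + norm (r m)"
          using norm_triangle_ineq4[of "t + ((\<Sum>n<m. proj N (a n)) - (\<Sum>n<m. a n))" "r m"]
            norm_triangle_ineq[of t "(\<Sum>n<m. proj N (a n)) - (\<Sum>n<m. a n)"] by simp
        also have "\<dots> < c * d * 2 / 2 ^ m + \<epsilon>/2 + d / 2 ^ m"
          using t N0[OF that] rb[of m] by linarith
        also have "\<dots> = (2 * c * d + d) / 2 ^ m + \<epsilon>/2" by (simp add: add_divide_distrib)
        also have "\<dots> < \<epsilon>" using m by linarith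
        finally show ?thesis .
      qed
      then show "\<exists>N0. \<forall>N\<ge>N0. norm (s N - x) < \<epsilon>" by blast
    qed
    then have "coords e x = b"
      by (intro coords_unique) (simp add: sums_def flip: s_eq)
    then have "proj N x = s N" by (simp add: proj_def s_eq)
    then show ?thesis using sb[of N] by (simp add: d_def mult_ac)
  qed
  show thesis
  proof (rule that[of "max 1 (2 * c)"])
    show "norm (proj N x) \<le> max 1 (2 * c) * norm x" for N x
      by (rule order_trans[OF main mult_right_mono]) auto
  qed simp
qed

end

section \<open>Isomorphisms between closed subspaces\<close>

text \<open>The isomorphism is represented by its graph. This makes the notion symmetric, makes composition a relational
product, and lets an isomorphism between dense subspaces be extended by taking the closure of the graph.\<close>

definition lin_iso :: "real \<Rightarrow> 'a::real_normed_vector set \<Rightarrow> 'b::real_normed_vector set \<Rightarrow> bool" where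
  "lin_iso C V W \<longleftrightarrow> (\<exists>G. subspace G \<and> fst ` G = V \<and> snd ` G = W \<and>
     (\<forall>x y. (x, y) \<in> G \<longrightarrow> norm x \<le> C * norm y \<and> norm y \<le> C * norm x))"

lemma lin_isoI:
  assumes "subspace G" "fst ` G = V" "snd ` G = W"
    "\<And>x y. (x, y) \<in> G \<Longrightarrow> norm x \<le> C * norm y" "\<And>x y. (x, y) \<in> G \<Longrightarrow> norm y \<le> C * norm x"
  shows "lin_iso C V W"
  using assms unfolding lin_iso_def by blast

lemma lin_isoE:
  assumes "lin_iso C V W"
  obtains G where "subspace G" "fst ` G = V" "snd ` G = W"
    "\<And>x y. (x, y) \<in> G \<Longrightarrow> norm x \<le> C * norm y" "\<And>x y. (x, y) \<in> G \<Longrightarrow> norm y \<le> C * norm x"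
  using assms unfolding lin_iso_def by blast

lemma lin_iso_sym:
  assumes "lin_iso C V W"
  shows "lin_iso C W V"
proof -
  obtain G where G: "subspace G" "fst ` G = V" "snd ` G = W"
    "\<And>x y. (x, y) \<in> G \<Longrightarrow> norm x \<le> C * norm y" "\<And>x y. (x, y) \<in> G \<Longrightarrow> norm y \<le> C * norm x"
    using assms lin_isoE by blast
  have lin: "linear prod.swap"
    by (intro linearI) auto
  show ?thesis
  proof (rule lin_isoI)
    show "subspace (prod.swap ` G)" by (rule linear_subspace_image[OF lin G(1)])
    show "fst ` prod.swap ` G = W" "snd ` prod.swap ` G = V"
      using G(2,3) by (force simp: image_image)+
  qed (use G(4,5) in auto)
qed

lemma lin_iso_trans:
  assumes "lin_iso C U V" "lin_iso D V W" "C \<ge> 0" "D \<ge> 0"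
  shows "lin_iso (C * D) U W"
proof -
  obtain G where G: "subspace G" "fst ` G = U" "snd ` G = V"
    "\<And>x y. (x, y) \<in> G \<Longrightarrow> norm x \<le> C * norm y" "\<And>x y. (x, y) \<in> G \<Longrightarrow> norm y \<le> C * norm x"
    using assms(1) lin_isoE by blast
  obtain H where H: "subspace H" "fst ` H = V" "snd ` H = W"
    "\<And>x y. (x, y) \<in> H \<Longrightarrow> norm x \<le> D * norm y" "\<And>x y. (x, y) \<in> H \<Longrightarrow> norm y \<le> D * norm x"
    using assms(2) lin_isoE by blast
  show ?thesis
  proof (rule lin_isoI)
    show "subspace (G O H)"
    proof (rule subspaceI)
      show "0 \<in> G O H"
        using subspace_0[OF G(1)] subspace_0[OF H(1)] by (auto simp: zero_prod_def)
      show "p + q \<in> G O H" if p: "p \<in> G O H" and q: "q \<in> G O H" for p q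
      proof -
        obtain x y z x' y' z' where 1: "p = (x, z)" "(x, y) \<in> G" "(y, z) \<in> H"
          "q = (x', z')" "(x', y') \<in> G" "(y', z') \<in> H"
          using p q by (elim relcompE) blast
        then show ?thesis
          using subspace_add[OF G(1) 1(2) 1(5)] subspace_add[OF H(1) 1(3) 1(6)] by auto
      qed
      show "c *\<^sub>R p \<in> G O H" if p: "p \<in> G O H" for c p
      proof -
        obtain x y z where 1: "p = (x, z)" "(x, y) \<in> G" "(y, z) \<in> H"
          using p by (elim relcompE) blast
        then show ?thesis
          using subspace_scale[OF G(1) 1(2), of c] subspace_scale[OF H(1) 1(3), of c] by auto
      qed
    qed
    show "fst ` (G O H) = U"
    proof -
      have "\<exists>z. (x, z) \<in> G O H" if "(x, y) \<in> G" for x y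
      proof -
        have "y \<in> fst ` H" using that G(3) H(2) by force
        then obtain z where "(y, z) \<in> H" by force
        then show ?thesis using that by blast
      qed
      then have "U \<subseteq> fst ` (G O H)" unfolding G(2)[symmetric] by (metis fst_conv image_eqI image_subsetI prod.collapse)
      moreover have "fst ` (G O H) \<subseteq> U"
        unfolding G(2)[symmetric] by (auto simp: image_iff Bex_def)
      ultimately show ?thesis by blast
    qed
    show "snd ` (G O H) = W"
    proof -
      have "\<exists>x. (x, z) \<in> G O H" if "(y, z) \<in> H" for y z
      proof -
        have "y \<in> snd ` G" using that G(3) H(2) by force
        then obtain x where "(x, y) \<in> G" by force
        then show ?thesis using that by blast
      qed
      then have "W \<subseteq> snd ` (G O H)" unfolding H(3)[symmetric] by (metis snd_conv image_eqI image_subsetI prod.collapse)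
      moreover have "snd ` (G O H) \<subseteq> W"
        unfolding H(3)[symmetric] by (auto simp: image_iff Bex_def)
      ultimately show ?thesis by blast
    qed
    show "norm x \<le> C * D * norm z" if xz: "(x, z) \<in> G O H" for x z
    proof -
      obtain y where y: "(x, y) \<in> G" "(y, z) \<in> H" using xz by blast
      have "C * norm y \<le> C * (D * norm z)" by (rule mult_left_mono[OF H(4)[OF y(2)] \<open>C \<ge> 0\<close>])
      then show ?thesis using G(4)[OF y(1)] by simp
    qed
    show "norm z \<le> C * D * norm x" if xz: "(x, z) \<in> G O H" for x z
    proof -
      obtain y where y: "(x, y) \<in> G" "(y, z) \<in> H" using xz by blast
      have "D * norm y \<le> D * (C * norm x)" by (rule mult_left_mono[OF G(5)[OF y(1)] \<open>D \<ge> 0\<close>])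
      then show ?thesis using H(5)[OF y(2)] by (simp add: mult_ac)
    qed
  qed
qed

text \<open>The first projection is bounded below on the graph of a bounded operator, so it preserves completeness.\<close>

lemma closed_fst_image:
  fixes G :: "('a::banach \<times> 'b::banach) set"
  assumes "subspace G" "closed G" "C \<ge> 0" "\<And>x y. (x, y) \<in> G \<Longrightarrow> norm y \<le> C * norm x"
  shows "closed (fst ` G)"
proof -
  have "complete (fst ` G)"
  proof (rule complete_isometric_image[OF _ assms(1) bounded_linear_fst])
    show "1 / (1 + C) > 0" using \<open>C \<ge> 0\<close> by simp
    show "\<forall>p\<in>G. norm (fst p) \<ge> 1 / (1 + C) * norm p"
    proof
      fix p assume "p \<in> G"
      then have "norm (snd p) \<le> C * norm (fst p)" using assms(4)[of "fst p" "snd p"] by simp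
      moreover have "norm p \<le> norm (fst p) + norm (snd p)"
        using norm_Pair_le[of "fst p" "snd p"] by simp
      ultimately have "norm p \<le> (1 + C) * norm (fst p)" by (simp add: algebra_simps)
      then show "norm (fst p) \<ge> 1 / (1 + C) * norm p" using \<open>C \<ge> 0\<close> by (simp add: field_simps)
    qed
    show "complete G" using assms(2) complete_eq_closed by blast
  qed
  then show ?thesis using complete_eq_closed by blast
qed

lemma subspace_closure:
  fixes S :: "'a::real_normed_vector set"
  assumes "subspace S"
  shows "subspace (closure S)"
proof (rule subspaceI)
  show "0 \<in> closure S" using subspace_0[OF assms] closure_subset by blast
  show "x + y \<in> closure S" if xy: "x \<in> closure S" "y \<in> closure S" for x y
  proof -
    obtain f g where "\<And>n. f n \<in> S" "f \<longlonglongrightarrow> x" "\<And>n. g n \<in> S" "g \<longlonglongrightarrow> y"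
      using xy unfolding closure_sequential by blast
    then have "\<And>n. f n + g n \<in> S" "(\<lambda>n. f n + g n) \<longlonglongrightarrow> x + y"
      using subspace_add[OF assms] tendsto_add by blast+
    then show ?thesis
      unfolding closure_sequential by (intro exI[of _ "\<lambda>n. f n + g n"]) simp
  qed
  show "c *\<^sub>R x \<in> closure S" if x: "x \<in> closure S" for c x
  proof -
    obtain f where f: "\<And>n. f n \<in> S" "f \<longlonglongrightarrow> x"
      using x unfolding closure_sequential by blast
    have "(\<lambda>n. c *\<^sub>R f n) \<longlonglongrightarrow> c *\<^sub>R x" by (intro tendsto_intros f(2))
    then show ?thesis
      unfolding closure_sequential using f(1) subspace_scale[OF assms]
      by (intro exI[of _ "\<lambda>n. c *\<^sub>R f n"]) simp
  qed
qed

lemma lin_iso_closure: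
  fixes V :: "'a::banach set" and W :: "'b::banach set"
  assumes "lin_iso C V W" "C \<ge> 0"
  shows "lin_iso C (closure V) (closure W)"
proof -
  obtain G where G: "subspace G" "fst ` G = V" "snd ` G = W"
    "\<And>x y. (x, y) \<in> G \<Longrightarrow> norm x \<le> C * norm y" "\<And>x y. (x, y) \<in> G \<Longrightarrow> norm y \<le> C * norm x"
    using assms(1) lin_isoE by blast
  have sub: "subspace (closure G)" by (rule subspace_closure[OF G(1)])
  have le1: "norm x \<le> C * norm y" if "(x, y) \<in> closure G" for x y
  proof -
    have "closed {p :: 'a \<times> 'b. norm (fst p) \<le> C * norm (snd p)}"
      by (intro closed_Collect_le continuous_intros)
    then have "closure G \<subseteq> {p. norm (fst p) \<le> C * norm (snd p)}"
      by (rule closure_minimal[rotated]) (use G(4) in force)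
    then show ?thesis using that by auto
  qed
  have le2: "norm y \<le> C * norm x" if "(x, y) \<in> closure G" for x y
  proof -
    have "closed {p :: 'a \<times> 'b. norm (snd p) \<le> C * norm (fst p)}"
      by (intro closed_Collect_le continuous_intros)
    then have "closure G \<subseteq> {p. norm (snd p) \<le> C * norm (fst p)}"
      by (rule closure_minimal[rotated]) (use G(5) in force)
    then show ?thesis using that by auto
  qed
  have cl1: "closed (fst ` closure G)"
    by (rule closed_fst_image[OF sub closed_closure \<open>C \<ge> 0\<close> le2])
  have swap: "snd ` closure G = fst ` (prod.swap ` closure G)"
    by (force simp: image_image)
  have "closed (prod.swap ` closure G)"
  proof -
    have eq: "prod.swap ` closure G = prod.swap -` closure G"
      by (force simp: image_iff)
    have "continuous_on UNIV (prod.swap :: 'b \<times> 'a \<Rightarrow> 'a \<times> 'b)"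
      by (rule continuous_on_swap)
    then show ?thesis unfolding eq by (intro closed_vimage) auto
  qed
  moreover have "subspace (prod.swap ` closure G)"
    by (rule linear_subspace_image[OF _ sub]) (intro linearI, auto)
  ultimately have cl2: "closed (snd ` closure G)"
    unfolding swap by (intro closed_fst_image[of _ C]) (use \<open>C \<ge> 0\<close> le1 in auto)
  have "V \<subseteq> fst ` closure G" using G(2) closure_subset by blast
  then have "closure V \<subseteq> fst ` closure G" using cl1 by (rule closure_minimal)
  moreover have "fst ` closure G \<subseteq> closure V"
    using closure_bounded_linear_image_subset[OF bounded_linear_fst, of G] G(2) by simp
  ultimately have 1: "fst ` closure G = closure V" by blast
  have "W \<subseteq> snd ` closure G" using G(3) closure_subset by blast
  then have "closure W \<subseteq> snd ` closure G" using cl2 by (rule closure_minimal)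
  moreover have "snd ` closure G \<subseteq> closure W"
    using closure_bounded_linear_image_subset[OF bounded_linear_snd, of G] G(3) by simp
  ultimately have 2: "snd ` closure G = closure W" by blast
  show ?thesis by (rule lin_isoI[OF sub 1 2 le1 le2])
qed

lemma onorm_on_le:
  assumes "0 \<in> V" "C \<ge> 0" "\<And>x. x \<in> V \<Longrightarrow> norm (T x) \<le> C * norm x"
  shows "onorm_on V T \<le> C" "onorm_on V T \<ge> 0"
proof -
  have le: "norm (T x) / norm x \<le> C" if "x \<in> V" for x
    using assms(3)[OF that] \<open>C \<ge> 0\<close> by (cases "x = 0") (simp_all add: field_simps)
  show "onorm_on V T \<le> C"
    unfolding onorm_on_def using assms(1) le by (intro cSUP_least) auto
  have "bdd_above ((\<lambda>x. norm (T x) / norm x) ` V)"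
    using le by (intro bdd_aboveI2)
  from cSUP_upper[OF assms(1) this] show "onorm_on V T \<ge> 0"
    unfolding onorm_on_def by simp
qed

text \<open>Both norm bounds make the graph single-valued in each direction, so it is the graph of a bijection \<open>T\<close>.\<close>

lemma lin_iso_imp_K_isomorphic:
  assumes "lin_iso C V W" "C \<ge> 0"
  shows "K_isomorphic (C * C) V W"
proof -
  obtain G where G: "subspace G" "fst ` G = V" "snd ` G = W"
    "\<And>x y. (x, y) \<in> G \<Longrightarrow> norm x \<le> C * norm y" "\<And>x y. (x, y) \<in> G \<Longrightarrow> norm y \<le> C * norm x"
    using assms(1) lin_isoE by blast
  have func: "y = y'" if "(x, y) \<in> G" "(x, y') \<in> G" for x y y'
    using G(5)[of 0 "y - y'"] subspace_diff[OF G(1) that] by simp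
  have inj: "x = x'" if "(x, y) \<in> G" "(x', y) \<in> G" for x x' y
    using G(4)[of "x - x'" 0] subspace_diff[OF G(1) that] by simp
  have dom: "x \<in> V" "y \<in> W" if "(x, y) \<in> G" for x y
    using imageI[OF that, of fst] imageI[OF that, of snd] G(2,3) by simp_all
  define T where "T x = (THE y. (x, y) \<in> G)" for x
  have T: "(x, T x) \<in> G" if "x \<in> V" for x
  proof -
    obtain y where "(x, y) \<in> G" using \<open>x \<in> V\<close> G(2) by force
    then show ?thesis unfolding T_def using func by (metis (mono_tags, lifting) theI)
  qed
  have Teq: "T x = y" if "(x, y) \<in> G" for x y
    by (rule func[OF T[OF dom(1)[OF that]] that])
  have injT: "inj_on T V" 
    by (rule inj_onI) (metis T inj)
  have img: "T ` V = W"
  proof (intro equalityI subsetI)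
    show "y \<in> W" if "y \<in> T ` V" for y using that T dom(2) by blast
    show "y \<in> T ` V" if "y \<in> W" for y
    proof -
      obtain x where "(x, y) \<in> G" using \<open>y \<in> W\<close> G(3) by force
      then show ?thesis using Teq dom(1) by blast
    qed
  qed
  define S where "S = inv_into V T"
  have S: "S y \<in> V" "(S y, y) \<in> G" if "y \<in> W" for y
    using that T[of "S y"] img inv_into_into[of y T V] f_inv_into_f[of y T V] unfolding S_def by auto
  have Seq: "S y = x" if "(x, y) \<in> G" for x y
    by (rule inj[OF S(2)[OF dom(2)[OF that]] that])
  have blT: "bounded_linear_on V T"
    unfolding bounded_linear_on_def
  proof (intro conjI ballI allI)
    show "T (x + y) = T x + T y" if "x \<in> V" "y \<in> V" for x y
      using subspace_add[OF G(1) T[OF that(1)] T[OF that(2)]] by (intro Teq) simp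
    show "T (c *\<^sub>R x) = c *\<^sub>R T x" if "x \<in> V" for c x
      using subspace_scale[OF G(1) T[OF that], of c] by (intro Teq) simp
    show "\<exists>B. \<forall>x\<in>V. norm (T x) \<le> B * norm x" using T G(5) by blast
  qed
  have blS: "bounded_linear_on W S"
    unfolding bounded_linear_on_def
  proof (intro conjI ballI allI)
    show "S (x + y) = S x + S y" if "x \<in> W" "y \<in> W" for x y
      using subspace_add[OF G(1) S(2)[OF that(1)] S(2)[OF that(2)]] by (intro Seq) simp
    show "S (c *\<^sub>R x) = c *\<^sub>R S x" if "x \<in> W" for c x
      using subspace_scale[OF G(1) S(2)[OF that], of c] by (intro Seq) simp
    show "\<exists>B. \<forall>x\<in>W. norm (S x) \<le> B * norm x" using S(2) G(4) by blast
  qed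
  have "isomorphism_on V W T"
    unfolding isomorphism_on_def bij_betw_def using injT img blT blS by (simp add: S_def)
  moreover have "onorm_on V T * onorm_on W S \<le> C * C"
  proof (rule mult_mono)
    have V0: "0 \<in> V" and W0: "0 \<in> W" using subspace_0[OF G(1)] G(2,3) by force+
    show "onorm_on V T \<le> C"
      by (rule onorm_on_le(1)[OF V0 \<open>C \<ge> 0\<close>]) (rule G(5)[OF T])
    show "onorm_on W S \<le> C" "0 \<le> onorm_on W S"
      by (rule onorm_on_le[OF W0 \<open>C \<ge> 0\<close>], rule G(4)[OF S(2)], assumption)+
  qed (rule \<open>C \<ge> 0\<close>)
  ultimately show ?thesis unfolding K_isomorphic_def S_def by blast
qed

lemma K_isomorphic_mono: "K_isomorphic K V W \<Longrightarrow> K \<le> K' \<Longrightarrow> K_isomorphic K' V W"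
  unfolding K_isomorphic_def by fastforce

lemma lin_iso_imp_isomorphic: "lin_iso C V W \<Longrightarrow> C \<ge> 0 \<Longrightarrow> isomorphic_subspaces V W"
  using lin_iso_imp_K_isomorphic unfolding K_isomorphic_def isomorphic_subspaces_def by blast

lemma isomorphic_imp_lin_iso:
  assumes "isomorphic_subspaces V W" "subspace V"
  obtains K :: nat where "K \<ge> 1" "lin_iso (real K) V W"
proof -
  obtain T where T: "bij_betw T V W" "bounded_linear_on V T" "bounded_linear_on W (inv_into V T)"
    using assms(1) unfolding isomorphic_subspaces_def isomorphism_on_def by blast
  obtain B where B: "\<And>x. x \<in> V \<Longrightarrow> norm (T x) \<le> B * norm x"
    using T(2) unfolding bounded_linear_on_def by blast
  obtain B' where B': "\<And>y. y \<in> W \<Longrightarrow> norm (inv_into V T y) \<le> B' * norm y"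
    using T(3) unfolding bounded_linear_on_def by blast
  obtain K where K: "max 1 (max B B') \<le> real K" using real_arch_simple by blast
  have "lin_iso (real K) V W"
  proof (rule lin_isoI)
    let ?G = "(\<lambda>x. (x, T x)) ` V"
    show "subspace ?G"
    proof (rule subspaceI)
      have add: "T (x + y) = T x + T y" if "x \<in> V" "y \<in> V" for x y
        using T(2) that unfolding bounded_linear_on_def by blast
      have scale: "T (c *\<^sub>R x) = c *\<^sub>R T x" if "x \<in> V" for c x
        using T(2) that unfolding bounded_linear_on_def by blast
      have "T 0 = 0" using scale[OF subspace_0[OF assms(2)], of 0] by simp
      then show "0 \<in> ?G"
        using subspace_0[OF assms(2)] by (intro image_eqI[of _ _ 0]) (simp_all add: zero_prod_def)
      show "p + q \<in> ?G" if pq: "p \<in> ?G" "q \<in> ?G" for p q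
      proof -
        obtain x y where "p = (x, T x)" "q = (y, T y)" "x \<in> V" "y \<in> V" using pq by blast
        then show ?thesis
          using subspace_add[OF assms(2)] by (intro image_eqI[of _ _ "x + y"]) (simp_all add: add)
      qed
      show "c *\<^sub>R p \<in> ?G" if p: "p \<in> ?G" for c p
      proof -
        obtain x where "p = (x, T x)" "x \<in> V" using p by blast
        then show ?thesis
          using subspace_scale[OF assms(2)] by (intro image_eqI[of _ _ "c *\<^sub>R x"]) (simp_all add: scale)
      qed
    qed
    show "fst ` ?G = V" "snd ` ?G = W"
      using T(1) by (auto simp: image_image bij_betw_def)
    show "norm x \<le> real K * norm y" if "(x, y) \<in> ?G" for x y
    proof -
      have y: "y \<in> W" "inv_into V T y = x" using that T(1) by (auto simp: bij_betw_def)
      have "norm x \<le> B' * norm y" using B'[OF y(1)] y(2) by simp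
      also have "\<dots> \<le> real K * norm y" using K by (intro mult_right_mono) auto
      finally show ?thesis .
    qed
    show "norm y \<le> real K * norm x" if "(x, y) \<in> ?G" for x y
    proof -
      have "norm y \<le> B * norm x" using B that by auto
      also have "\<dots> \<le> real K * norm x" using K by (intro mult_right_mono) auto
      finally show ?thesis .
    qed
  qed
  then show thesis using that K by auto
qed

lemma subspace_closed_span: "subspace (closed_span S)"
  unfolding closed_span_def by (intro subspace_closure subspace_span)

lemma closed_closed_span: "closed (closed_span S)"
  unfolding closed_span_def by simp

lemma span_le_closed_span: "span S \<subseteq> closed_span S"
  unfolding closed_span_def by (rule closure_subset)

lemma in_closed_span: "x \<in> S \<Longrightarrow> x \<in> closed_span S"
  using span_base span_le_closed_span by blast

lemma closed_span_minimal: "subspace V \<Longrightarrow> closed V \<Longrightarrow> S \<subseteq> V \<Longrightarrow> closed_span S \<subseteq> V"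
  unfolding closed_span_def by (intro closure_minimal span_minimal)

lemma span_range_eq: "span (range u) = {\<Sum>i<n. a i *\<^sub>R u i |a n::nat. True}" (is "_ = ?R")
proof
  have "subspace ?R"
  proof (rule subspaceI)
    show "0 \<in> ?R" by (intro CollectI exI[of _ "\<lambda>_. 0"] exI[of _ 0]) simp
    show "x + y \<in> ?R" if xy: "x \<in> ?R" "y \<in> ?R" for x y
    proof -
      obtain a n b m where x: "x = (\<Sum>i<n. a i *\<^sub>R u i)" and y: "y = (\<Sum>i<m. b i *\<^sub>R u i)"
        using xy by blast
      define N where "N = max n m"
      have x': "x = (\<Sum>i<N. (if i < n then a i else 0) *\<^sub>R u i)"
        unfolding x N_def by (rule sum.mono_neutral_cong_left) auto
      have y': "y = (\<Sum>i<N. (if i < m then b i else 0) *\<^sub>R u i)"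
        unfolding y N_def by (rule sum.mono_neutral_cong_left) auto
      have "x + y = (\<Sum>i<N. ((if i < n then a i else 0) + (if i < m then b i else 0)) *\<^sub>R u i)"
        unfolding x' y' by (simp only: scaleR_add_left sum.distrib)
      then show ?thesis by (intro CollectI exI conjI TrueI)
    qed
    show "c *\<^sub>R x \<in> ?R" if x: "x \<in> ?R" for c x
    proof -
      obtain a n where "x = (\<Sum>i<n. a i *\<^sub>R u i)" using x by blast
      then have "c *\<^sub>R x = (\<Sum>i<n. (c * a i) *\<^sub>R u i)" by (simp add: scaleR_sum_right)
      then show ?thesis by (intro CollectI exI conjI TrueI)
    qed
  qed
  moreover have "u k \<in> ?R" for k
  proof -
    have "u k = (\<Sum>i<Suc k. (if i = k then 1 else 0) *\<^sub>R u i)"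
      by (simp add: if_distrib[of "\<lambda>r. r *\<^sub>R _"] cong: if_cong)
    then show ?thesis by (intro CollectI exI conjI TrueI)
  qed
  ultimately show "span (range u) \<subseteq> ?R" by (intro span_minimal) auto
  show "?R \<subseteq> span (range u)"
  proof clarify
    fix a and n :: nat
    show "(\<Sum>i<n. a i *\<^sub>R u i) \<in> span (range u)"
      by (intro span_sum span_scale span_base) simp
  qed
qed

text \<open>This is the \<open>K\<close>-equivalence of sequences from the theory of basic sequences.\<close>

definition equi :: "real \<Rightarrow> (nat \<Rightarrow> 'a::real_normed_vector) \<Rightarrow> (nat \<Rightarrow> 'b::real_normed_vector) \<Rightarrow> bool" where
  "equi K u v \<longleftrightarrow> (\<forall>n a. norm (\<Sum>i<n. a i *\<^sub>R u i) \<le> K * norm (\<Sum>i<n. a i *\<^sub>R v i) \<and>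
      norm (\<Sum>i<n. a i *\<^sub>R v i) \<le> K * norm (\<Sum>i<n. a i *\<^sub>R u i))"

lemma equi_imp_lin_iso:
  fixes u :: "nat \<Rightarrow> 'a::banach" and v :: "nat \<Rightarrow> 'b::banach"
  assumes "equi K u v" "K \<ge> 0"
  shows "lin_iso K (closed_span (range u)) (closed_span (range v))"
proof -
  let ?G = "span (range (\<lambda>i. (u i, v i)))"
  have G: "\<exists>a n. x = (\<Sum>i<n. a i *\<^sub>R u i) \<and> y = (\<Sum>i<n::nat. a i *\<^sub>R v i)" if xy: "(x, y) \<in> ?G" for x y
  proof -
    obtain a n where eq: "(x, y) = (\<Sum>i<n::nat. a i *\<^sub>R (u i, v i))"
      using xy unfolding span_range_eq by blast
    have "x = (\<Sum>i<n. a i *\<^sub>R u i)"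
      using arg_cong[OF eq, of fst] by (simp add: fst_sum)
    moreover have "y = (\<Sum>i<n. a i *\<^sub>R v i)"
      using arg_cong[OF eq, of snd] by (simp add: snd_sum)
    ultimately show ?thesis by blast
  qed
  have "lin_iso K (span (range u)) (span (range v))"
  proof (rule lin_isoI)
    show "subspace ?G" by simp
    show "fst ` ?G = span (range u)"
      using linear_span_image[OF linear_fst, of "range (\<lambda>i. (u i, v i))"] by (simp add: image_image)
    show "snd ` ?G = span (range v)"
      using linear_span_image[OF linear_snd, of "range (\<lambda>i. (u i, v i))"] by (simp add: image_image)
    show "norm x \<le> K * norm y" if "(x, y) \<in> ?G" for x y
      using G[OF that] assms(1) unfolding equi_def by blast
    show "norm y \<le> K * norm x" if "(x, y) \<in> ?G" for x y
      using G[OF that] assms(1) unfolding equi_def by blast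
  qed
  then show ?thesis unfolding closed_span_def using \<open>K \<ge> 0\<close> by (rule lin_iso_closure)
qed

text \<open>Conversely to the previous lemma, the image of a spanning sequence under an isomorphism is an equivalent
sequence which spans the target.\<close>

lemma lin_iso_imp_equi:
  assumes "lin_iso K (closed_span (range y)) W" "K > 0" "closed W"
  obtains u where "equi K y u" "closed_span (range u) = W"
proof -
  obtain G where G: "subspace G" "fst ` G = closed_span (range y)" "snd ` G = W"
    "\<And>x y. (x, y) \<in> G \<Longrightarrow> norm x \<le> K * norm y" "\<And>x y. (x, y) \<in> G \<Longrightarrow> norm y \<le> K * norm x"
    using assms(1) lin_isoE by blast
  have "\<forall>i. \<exists>w. (y i, w) \<in> G"
  proof
    fix i
    have "y i \<in> fst ` G" unfolding G(2) by (rule in_closed_span) simp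
    then show "\<exists>w. (y i, w) \<in> G" by force
  qed
  then obtain u where u: "\<And>i. (y i, u i) \<in> G" by metis
  have sums: "(\<Sum>i<n. a i *\<^sub>R y i, \<Sum>i<n. a i *\<^sub>R u i) \<in> G" for a and n :: nat
  proof -
    have "(\<Sum>i<n. a i *\<^sub>R (y i, u i)) \<in> G"
      by (intro subspace_sum subspace_scale G(1) u)
    moreover have "(\<Sum>i<n. a i *\<^sub>R (y i, u i)) = (\<Sum>i<n. a i *\<^sub>R y i, \<Sum>i<n. a i *\<^sub>R u i)"
      by (simp add: prod_eq_iff fst_sum snd_sum)
    ultimately show ?thesis by simp
  qed
  have "equi K y u"
    unfolding equi_def using G(4,5) sums by blast
  moreover have "closed_span (range u) = W"
  proof
    have "subspace W"
      using linear_subspace_image[OF linear_snd G(1)] G(3) by simp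
    moreover have "range u \<subseteq> W" using u G(3) by force
    ultimately show "closed_span (range u) \<subseteq> W"
      by (intro closed_span_minimal) (auto simp: assms(3))
    show "W \<subseteq> closed_span (range u)"
    proof
      fix w assume "w \<in> W"
      then obtain x where x: "(x, w) \<in> G" using G(3) by force
      then have "x \<in> closure (span (range y))" using G(2) unfolding closed_span_def by force
      show "w \<in> closed_span (range u)"
        unfolding closed_span_def closure_approachable
      proof (intro allI impI)
        fix \<epsilon> :: real assume "\<epsilon> > 0"
        then have "\<epsilon> / K > 0" using \<open>K > 0\<close> by simp
        then obtain x' where x': "x' \<in> span (range y)" "dist x' x < \<epsilon> / K"
          using \<open>x \<in> closure _\<close> unfolding closure_approachable by blast
        then obtain a n where "x' = (\<Sum>i<n::nat. a i *\<^sub>R y i)" unfolding span_range_eq by blast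
        then have "(x', \<Sum>i<n. a i *\<^sub>R u i) \<in> G" using sums by simp
        from subspace_diff[OF G(1) this x] have "norm ((\<Sum>i<n. a i *\<^sub>R u i) - w) \<le> K * norm (x' - x)"
          using G(5) by simp
        also have "\<dots> < \<epsilon>" using x'(2) \<open>K > 0\<close> by (simp add: dist_norm field_simps)
        finally have "dist (\<Sum>i<n. a i *\<^sub>R u i) w < \<epsilon>" by (simp add: dist_norm)
        moreover have "(\<Sum>i<n. a i *\<^sub>R u i) \<in> span (range u)" unfolding span_range_eq by blast
        ultimately show "\<exists>y\<in>span (range u). dist y w < \<epsilon>" by blast
      qed
    qed
  qed
  ultimately show thesis using that by blast
qed

lemma rational_combination_approx:
  assumes "x \<in> closed_span (range w)" "\<epsilon> > 0"
  obtains q :: "rat list" where "norm ((\<Sum>j<length q. of_rat (q ! j) *\<^sub>R w j) - x) < \<epsilon>"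
proof -
  obtain x' where x': "x' \<in> span (range w)" "dist x' x < \<epsilon> / 2"
    using assms half_gt_zero unfolding closed_span_def closure_approachable by blast
  then obtain a n where a: "x' = (\<Sum>i<n::nat. a i *\<^sub>R w i)" unfolding span_range_eq by blast
  define \<delta> where "\<delta> i = \<epsilon> / (2 * (1 + real n) * (1 + norm (w i)))" for i
  have \<delta>: "\<delta> i > 0" for i
    unfolding \<delta>_def using \<open>\<epsilon> > 0\<close> by (intro divide_pos_pos mult_pos_pos add_pos_nonneg) auto
  have "\<exists>r::rat. \<bar>of_rat r - a i\<bar> < \<delta> i" for i
  proof -
    obtain r where "a i < of_rat r" "of_rat r < a i + \<delta> i"
      using of_rat_dense[of "a i" "a i + \<delta> i"] \<delta>[of i] by auto
    then show ?thesis by (intro exI[of _ r]) simp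
  qed
  then obtain r where r: "\<And>i. \<bar>of_rat (r i) - a i\<bar> < \<delta> i" by metis
  define q where "q = map r [0..<n]"
  have "(\<Sum>j<length q. of_rat (q ! j) *\<^sub>R w j) - x' = (\<Sum>i<n. (of_rat (r i) - a i) *\<^sub>R w i)"
    unfolding a q_def by (simp add: scaleR_diff_left sum_subtractf)
  also have "norm \<dots> \<le> (\<Sum>i<n. \<epsilon> / (2 * (1 + real n)))"
  proof (rule sum_norm_le)
    fix i
    have "\<bar>of_rat (r i) - a i\<bar> * norm (w i) \<le> \<delta> i * (1 + norm (w i))"
      using r[of i] by (intro mult_mono) auto
    also have "\<dots> = \<epsilon> / (2 * (1 + real n))"
      unfolding \<delta>_def using norm_ge_zero[of "w i"] by (simp add: divide_simps add_nonneg_eq_0_iff)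
    finally show "norm ((of_rat (r i) - a i) *\<^sub>R w i) \<le> \<epsilon> / (2 * (1 + real n))" by simp
  qed
  also have "\<dots> \<le> \<epsilon> / 2" using \<open>\<epsilon> > 0\<close> by (simp add: divide_simps)
  finally have "norm ((\<Sum>j<length q. of_rat (q ! j) *\<^sub>R w j) - x) < \<epsilon>"
    using x'(2) norm_triangle_lt[of "(\<Sum>j<length q. of_rat (q ! j) *\<^sub>R w j) - x'" "x' - x" \<epsilon>]
    by (simp add: dist_norm)
  then show thesis by (rule that)
qed

text \<open>The coefficients are bounded by the norm of the combination of the \<open>y i\<close>, so errors with a geometric
bound in \<open>i\<close> add up to at most half of the lower bound \<open>norm / K\<close> for an equivalent sequence \<open>u\<close>.\<close>

lemma small_perturbation:
  assumes "B > 0" "K > 0"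
    and coeff: "\<And>n a i. i < n \<Longrightarrow> \<bar>a i\<bar> \<le> B * norm (\<Sum>j<n. a j *\<^sub>R y j)"
    and close: "\<And>i. norm (v i - u i) \<le> 1 / (2 * K * B * 2 ^ Suc i)"
  shows "norm ((\<Sum>i<n. a i *\<^sub>R v i) - (\<Sum>i<n. a i *\<^sub>R u i)) \<le> norm (\<Sum>i<n. a i *\<^sub>R y i) / (2 * K)"
proof -
  let ?N = "norm (\<Sum>i<n. a i *\<^sub>R y i)"
  have "(\<Sum>i<n. a i *\<^sub>R v i) - (\<Sum>i<n. a i *\<^sub>R u i) = (\<Sum>i<n. a i *\<^sub>R (v i - u i))"
    by (simp add: scaleR_diff_right sum_subtractf)
  also have "norm \<dots> \<le> (\<Sum>i<n. ?N / (2 * K) * (1 / 2 ^ Suc i))"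
  proof (rule sum_norm_le)
    fix i assume "i \<in> {..<n}"
    then have "norm (a i *\<^sub>R (v i - u i)) \<le> (B * ?N) * (1 / (2 * K * B * 2 ^ Suc i))"
      unfolding norm_scaleR using coeff close \<open>B > 0\<close> by (intro mult_mono) auto
    also have "\<dots> = ?N / (2 * K) * (1 / 2 ^ Suc i)" using \<open>B > 0\<close> by simp
    finally show "norm (a i *\<^sub>R (v i - u i)) \<le> ?N / (2 * K) * (1 / 2 ^ Suc i)" .
  qed
  also have "\<dots> = ?N / (2 * K) * (\<Sum>i<n. 1 / 2 ^ Suc i)" by (simp only: sum_distrib_left)
  also have "\<dots> \<le> ?N / (2 * K) * 1"
  proof (rule mult_left_mono)
    have "(\<Sum>i<n. 1 / 2 ^ Suc i :: real) = 1 - 1 / 2 ^ n"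
      by (induction n) (simp_all add: field_simps)
    then show "(\<Sum>i<n. 1 / 2 ^ Suc i :: real) \<le> 1" by simp
  qed (use \<open>K > 0\<close> in simp)
  finally show ?thesis by simp
qed

lemma equi_perturb:
  assumes "B > 0" "K \<ge> 1" "equi K y u"
    and coeff: "\<And>n a i. i < n \<Longrightarrow> \<bar>a i\<bar> \<le> B * norm (\<Sum>j<n. a j *\<^sub>R y j)"
    and close: "\<And>i. norm (v i - u i) \<le> 1 / (2 * K * B * 2 ^ Suc i)"
  shows "equi (2 * K) y v"
  unfolding equi_def
proof (intro allI conjI)
  fix n :: nat and a :: "nat \<Rightarrow> real"
  let ?Y = "norm (\<Sum>i<n. a i *\<^sub>R y i)" and ?U = "norm (\<Sum>i<n. a i *\<^sub>R u i)" and ?V = "norm (\<Sum>i<n. a i *\<^sub>R v i)"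
  have K: "K > 0" using \<open>K \<ge> 1\<close> by simp
  have d: "norm ((\<Sum>i<n. a i *\<^sub>R v i) - (\<Sum>i<n. a i *\<^sub>R u i)) \<le> ?Y / (2 * K)"
    by (rule small_perturbation[OF \<open>B > 0\<close> K coeff close])
  have e: "?Y \<le> K * ?U" "?U \<le> K * ?Y" using assms(3) unfolding equi_def by auto
  have "?U \<le> ?V + ?Y / (2 * K)" using d norm_triangle_ineq2[of "\<Sum>i<n. a i *\<^sub>R u i" "\<Sum>i<n. a i *\<^sub>R v i"]
    by (simp add: norm_minus_commute)
  then have "K * ?U \<le> K * ?V + ?Y / 2" using K by (simp add: field_simps)
  then show "?Y \<le> 2 * K * ?V" using e(1) by linarith
  have "?V \<le> ?U + ?Y / (2 * K)" using d norm_triangle_ineq2[of "\<Sum>i<n. a i *\<^sub>R v i" "\<Sum>i<n. a i *\<^sub>R u i"]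
    by simp
  also have "?Y / (2 * K) \<le> K * ?Y"
  proof -
    have "1 / (2 * K) \<le> K" using \<open>K \<ge> 1\<close> mult_mono[of 1 K 1 K] by (simp add: field_simps)
    from mult_right_mono[OF this norm_ge_zero] show ?thesis by simp
  qed
  finally show "?V \<le> 2 * K * ?Y" using e(2) by linarith
qed

text \<open>The error of an approximation is again a vector of \<open>Z\<close> and can be approximated in turn; the errors decrease
geometrically.\<close>

lemma closure_of_approximating_subspace:
  assumes "subspace M" "subspace Z" "M \<subseteq> Z" "c \<ge> 0" "c < 1"
    and approx: "\<And>w. w \<in> Z \<Longrightarrow> \<exists>m\<in>M. norm (w - m) \<le> c * norm w"
  shows "Z \<subseteq> closure M"
proof
  fix w assume "w \<in> Z"
  have it: "\<exists>m\<in>M. norm (w - m) \<le> c ^ n * norm w" for n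
  proof (induction n)
    case 0
    then show ?case using subspace_0[OF assms(1)] by force
  next
    case (Suc n)
    then obtain m where m: "m \<in> M" "norm (w - m) \<le> c ^ n * norm w" by blast
    have "w - m \<in> Z" using \<open>w \<in> Z\<close> m(1) assms(2,3) by (meson subsetD subspace_diff)
    then obtain m' where m': "m' \<in> M" "norm (w - m - m') \<le> c * norm (w - m)" using approx by blast
    have "norm (w - (m + m')) \<le> c * (c ^ n * norm w)"
      using m'(2) mult_left_mono[OF m(2) \<open>c \<ge> 0\<close>] by (simp add: diff_diff_eq)
    then show ?case using subspace_add[OF assms(1) m(1) m'(1)] by (auto simp: mult_ac)
  qed
  show "w \<in> closure M"
    unfolding closure_approachable
  proof (intro allI impI)
    fix \<epsilon> :: real assume "\<epsilon> > 0"
    have "(\<lambda>n. c ^ n * norm w) \<longlonglongrightarrow> 0 * norm w"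
      using assms(4,5) by (intro tendsto_mult tendsto_const LIMSEQ_power_zero) simp
    then have "\<forall>\<^sub>F n in sequentially. c ^ n * norm w < \<epsilon>"
      by (rule order_tendstoD(2)) (use \<open>\<epsilon> > 0\<close> in simp)
    then obtain n where n: "c ^ n * norm w < \<epsilon>"
      using eventually_happens'[OF sequentially_bot] by blast
    obtain m where "m \<in> M" "norm (w - m) \<le> c ^ n * norm w" using it by blast
    then show "\<exists>y\<in>M. dist y w < \<epsilon>"
      using n by (intro bexI[of _ m]) (simp_all add: dist_norm norm_minus_commute)
  qed
qed

text \<open>A perturbed spanning sequence still spans: each \<open>w\<close> is within \<open>3/4\<close> of its norm from the span of \<open>v\<close>,
which suffices by \<open>closure_of_approximating_subspace\<close>.\<close>

lemma closed_span_perturb: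
  assumes "B > 0" "K > 0" "equi K y u"
    and coeff: "\<And>n a i. i < n \<Longrightarrow> \<bar>a i\<bar> \<le> B * norm (\<Sum>j<n. a j *\<^sub>R y j)"
    and close: "\<And>i. norm (v i - u i) \<le> 1 / (2 * K * B * 2 ^ Suc i)"
    and sub: "range v \<subseteq> closed_span (range u)"
  shows "closed_span (range v) = closed_span (range u)"
proof
  show le: "closed_span (range v) \<subseteq> closed_span (range u)"
    by (intro closed_span_minimal subspace_closed_span closed_closed_span sub)
  have "\<exists>m\<in>span (range v). norm (w - m) \<le> 3/4 * norm w" if w: "w \<in> closed_span (range u)" for w
  proof (cases "w = 0")
    case True
    then show ?thesis by (intro bexI[of _ 0]) (auto simp: span_zero)
  next
    case False
    then have "norm w / 8 > 0" by simp
    then obtain w' where w': "w' \<in> span (range u)" "dist w' w < norm w / 8"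
      using w unfolding closed_span_def closure_approachable by blast
    obtain a n where a: "w' = (\<Sum>i<n::nat. a i *\<^sub>R u i)" using w'(1) unfolding span_range_eq by blast
    define m where "m = (\<Sum>i<n. a i *\<^sub>R v i)"
    have "norm (m - w') \<le> norm (\<Sum>i<n. a i *\<^sub>R y i) / (2 * K)"
      unfolding m_def a by (rule small_perturbation[OF \<open>B > 0\<close> \<open>K > 0\<close> coeff close])
    also have "\<dots> \<le> (K * norm w') / (2 * K)"
      using assms(3) \<open>K > 0\<close> unfolding equi_def a by (intro divide_right_mono) auto
    also have "\<dots> = norm w' / 2" using \<open>K > 0\<close> by simp
    finally have "norm (m - w') \<le> norm w' / 2" .
    moreover have "norm (w' - w) < norm w / 8" using w'(2) by (simp add: dist_norm)
    moreover have "norm w' \<le> norm w + norm (w' - w)"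
      using norm_triangle_ineq[of w "w' - w"] by simp
    moreover have "norm (m - w) \<le> norm (m - w') + norm (w' - w)"
      using norm_triangle_ineq[of "m - w'" "w' - w"] by simp
    ultimately have "norm (m - w) \<le> 3/4 * norm w"
      using norm_ge_zero[of w] by linarith
    moreover have "m \<in> span (range v)" unfolding m_def by (intro span_sum span_scale span_base) simp
    ultimately show ?thesis by (intro bexI[of _ m]) (simp_all add: norm_minus_commute)
  qed
  moreover have "span (range v) \<subseteq> closed_span (range u)"
    using span_le_closed_span le by (rule order_trans)
  ultimately show "closed_span (range u) \<subseteq> closed_span (range v)"
    unfolding closed_span_def[of "range v"]
    by (intro closure_of_approximating_subspace[of _ _ "3/4"] subspace_closed_span) auto
qed

text \<open>An isomorphism is extended by the identity of \<open>span F\<close>. The assumed bounds say that \<open>F\<close> is complemented to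
both spaces with constant \<open>C\<close>, and the constant obtained depends only on \<open>K\<close> and \<open>C\<close>.\<close>

lemma lin_iso_add_common:
  fixes A B :: "'a::banach set"
  assumes iso: "lin_iso K (closed_span A) (closed_span B)" and "K \<ge> 0" "C \<ge> 0"
    and FA: "\<And>f x. f \<in> span F \<Longrightarrow> x \<in> closed_span A \<Longrightarrow> norm f \<le> C * norm (f + x)"
    and FB: "\<And>f x. f \<in> span F \<Longrightarrow> x \<in> closed_span B \<Longrightarrow> norm f \<le> C * norm (f + x)"
  shows "lin_iso (C + K * (1 + C)) (closed_span (F \<union> A)) (closed_span (F \<union> B))"
proof -
  obtain G where G: "subspace G" "fst ` G = closed_span A" "snd ` G = closed_span B"
    "\<And>x y. (x, y) \<in> G \<Longrightarrow> norm x \<le> K * norm y" "\<And>x y. (x, y) \<in> G \<Longrightarrow> norm y \<le> K * norm x"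
    using iso lin_isoE by blast
  define H where "H = {p + q |p q. p \<in> (\<lambda>f. (f, f)) ` span F \<and> q \<in> G}"
  have diag: "subspace ((\<lambda>f. (f, f)) ` span F)"
    by (rule linear_subspace_image) (auto intro!: linearI)
  have sums: "closure {f + x |f x. f \<in> span F \<and> x \<in> closed_span S} = closed_span (F \<union> S)" (is "closure ?L = _")
    for S :: "'a set"
  proof
    have "?L \<subseteq> closed_span (F \<union> S)"
    proof clarify
      fix f x assume "f \<in> span F" "x \<in> closed_span S"
      moreover have "span F \<subseteq> closed_span (F \<union> S)" "closed_span S \<subseteq> closed_span (F \<union> S)"
        unfolding closed_span_def using span_mono[of F "F \<union> S"] span_mono[of S "F \<union> S"] closure_subset
          closure_mono by blast+
      ultimately show "f + x \<in> closed_span (F \<union> S)"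
        by (intro subspace_add subspace_closed_span) auto
    qed
    then show "closure ?L \<subseteq> closed_span (F \<union> S)" by (intro closure_minimal closed_closed_span)
    have "span (F \<union> S) \<subseteq> ?L"
      unfolding span_Un using span_le_closed_span by blast
    then show "closed_span (F \<union> S) \<subseteq> closure ?L" unfolding closed_span_def by (rule closure_mono)
  qed
  have bnd: "norm (f + x) \<le> (C + K * (1 + C)) * norm (f + y)"
    if f: "norm f \<le> C * norm (f + y)" and xy: "norm x \<le> K * norm y" for f x y :: 'a
  proof -
    have "norm y \<le> norm (f + y) + norm f" using norm_triangle_ineq4[of "f + y" f] by simp
    then have "norm y \<le> (1 + C) * norm (f + y)" using f by (simp add: algebra_simps)
    then have "norm x \<le> K * ((1 + C) * norm (f + y))"
      using xy mult_left_mono[OF _ \<open>K \<ge> 0\<close>] by (meson order_trans)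
    then show ?thesis using f norm_triangle_ineq[of f x] by (simp add: algebra_simps)
  qed
  have "lin_iso (C + K * (1 + C)) {f + x |f x. f \<in> span F \<and> x \<in> closed_span A}
    {f + x |f x. f \<in> span F \<and> x \<in> closed_span B}"
  proof (rule lin_isoI)
    show "subspace H" unfolding H_def by (rule subspace_sums[OF diag G(1)])
    show "fst ` H = {f + x |f x. f \<in> span F \<and> x \<in> closed_span A}"
    proof (intro equalityI subsetI)
      fix z assume "z \<in> {f + x |f x. f \<in> span F \<and> x \<in> closed_span A}"
      then obtain f x where z: "z = f + x" "f \<in> span F" "x \<in> fst ` G" unfolding G(2) by blast
      then obtain y where "(x, y) \<in> G" by force
      then have "(f, f) + (x, y) \<in> H" unfolding H_def using z by blast
      then show "z \<in> fst ` H" using z by force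
    next
      fix z assume "z \<in> fst ` H"
      then show "z \<in> {f + x |f x. f \<in> span F \<and> x \<in> closed_span A}"
        unfolding H_def G(2)[symmetric] by force
    qed
    show "snd ` H = {f + x |f x. f \<in> span F \<and> x \<in> closed_span B}"
    proof (intro equalityI subsetI)
      fix z assume "z \<in> {f + x |f x. f \<in> span F \<and> x \<in> closed_span B}"
      then obtain f y where z: "z = f + y" "f \<in> span F" "y \<in> snd ` G" unfolding G(3) by blast
      then obtain x where "(x, y) \<in> G" by force
      then have "(f, f) + (x, y) \<in> H" unfolding H_def using z by blast
      then show "z \<in> snd ` H" using z by force
    next
      fix z assume "z \<in> snd ` H"
      then show "z \<in> {f + x |f x. f \<in> span F \<and> x \<in> closed_span B}"
        unfolding H_def G(3)[symmetric] by force
    qed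
    fix p q assume "(p, q) \<in> H"
    then obtain f x y where pq: "p = f + x" "q = f + y" "f \<in> span F" "(x, y) \<in> G"
      unfolding H_def by auto
    have "x \<in> closed_span A" "y \<in> closed_span B" using pq(4) G(2,3) by force+
    then show "norm p \<le> (C + K * (1 + C)) * norm q" "norm q \<le> (C + K * (1 + C)) * norm p"
      unfolding pq(1,2) using FA FB pq(3) G(4,5) pq(4) by (auto intro!: bnd)
  qed
  from lin_iso_closure[OF this] show ?thesis
    unfolding sums using \<open>K \<ge> 0\<close> \<open>C \<ge> 0\<close> by simp
qed

section \<open>Baire category relative to a countable base\<close>

text \<open>Category is formulated relative to a base instead of a topology; for the cylinders of a tree
this is the usual notion for its space of branches.\<close>

definition nowhere_dense :: "'x set set \<Rightarrow> 'x set \<Rightarrow> bool" where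
  "nowhere_dense \<B> A \<longleftrightarrow> (\<forall>U\<in>\<B>. \<exists>V\<in>\<B>. V \<subseteq> U \<and> V \<inter> A = {})"

definition meager :: "'x set set \<Rightarrow> 'x set \<Rightarrow> bool" where
  "meager \<B> A \<longleftrightarrow> (\<exists>C :: nat \<Rightarrow> 'x set. (\<forall>n. nowhere_dense \<B> (C n)) \<and> A \<subseteq> (\<Union>n. C n))"

lemma nowhere_dense_empty: "nowhere_dense \<B> {}"
  unfolding nowhere_dense_def by blast

lemma nowhere_dense_Un:
  assumes "nowhere_dense \<B> A" "nowhere_dense \<B> A'"
  shows "nowhere_dense \<B> (A \<union> A')"
  unfolding nowhere_dense_def
proof
  fix U assume "U \<in> \<B>"
  then obtain V where V: "V \<in> \<B>" "V \<subseteq> U" "V \<inter> A = {}" using assms(1) unfolding nowhere_dense_def by blast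
  then obtain W where "W \<in> \<B>" "W \<subseteq> V" "W \<inter> A' = {}" using assms(2) unfolding nowhere_dense_def by blast
  then show "\<exists>W\<in>\<B>. W \<subseteq> U \<and> W \<inter> (A \<union> A') = {}" using V by (intro bexI[of _ W]) auto
qed

lemma nowhere_dense_imp_meager: "nowhere_dense \<B> A \<Longrightarrow> meager \<B> A"
  unfolding meager_def by (intro exI[of _ "\<lambda>_. A"]) auto

lemma meager_subset: "meager \<B> A \<Longrightarrow> A' \<subseteq> A \<Longrightarrow> meager \<B> A'"
  unfolding meager_def by (meson order_trans)

lemma meager_UN_nat:
  assumes "\<And>n::nat. meager \<B> (A n)"
  shows "meager \<B> (\<Union>n. A n)"
proof -
  obtain C where C: "\<And>n m. nowhere_dense \<B> (C n m)" "\<And>n. A n \<subseteq> (\<Union>m::nat. C n m)"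
    using assms unfolding meager_def by metis
  show ?thesis
    unfolding meager_def
  proof (intro exI conjI allI)
    show "nowhere_dense \<B> ((\<lambda>k. C (fst (prod_decode k)) (snd (prod_decode k))) k)" for k
      using C(1) by simp
    show "(\<Union>n. A n) \<subseteq> (\<Union>k. C (fst (prod_decode k)) (snd (prod_decode k)))"
    proof
      fix x assume "x \<in> (\<Union>n. A n)"
      then obtain n m where "x \<in> C n m" using C(2) by blast
      then show "x \<in> (\<Union>k. C (fst (prod_decode k)) (snd (prod_decode k)))"
        by (intro UN_I[of "prod_encode (n, m)"]) simp_all
    qed
  qed
qed

lemma meager_UN:
  assumes "countable I" "\<And>i. i \<in> I \<Longrightarrow> meager \<B> (A i)"
  shows "meager \<B> (\<Union>i\<in>I. A i)"
proof (cases "I = {}")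
  case True
  then show ?thesis using nowhere_dense_imp_meager[OF nowhere_dense_empty] by simp
next
  case False
  then have "meager \<B> (\<Union>n. A (from_nat_into I n))"
    by (intro meager_UN_nat assms(2) from_nat_into)
  moreover have "(\<Union>i\<in>I. A i) = (\<Union>n. A (from_nat_into I n))"
    using range_from_nat_into[OF False assms(1)] by (metis UN_simps(10))
  ultimately show ?thesis by simp
qed

locale countable_base =
  fixes \<B> :: "'x set set"
  assumes countable_base: "countable \<B>"
    and base_inter: "\<And>U V x. U \<in> \<B> \<Longrightarrow> V \<in> \<B> \<Longrightarrow> x \<in> U \<Longrightarrow> x \<in> V \<Longrightarrow> \<exists>W\<in>\<B>. x \<in> W \<and> W \<subseteq> U \<and> W \<subseteq> V"
begin

definition everywhere_nonmeager :: "'x set \<Rightarrow> 'x set \<Rightarrow> bool" where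
  "everywhere_nonmeager A W \<longleftrightarrow> W \<in> \<B> \<and> (\<forall>V\<in>\<B>. V \<subseteq> W \<longrightarrow> \<not> meager \<B> (A \<inter> V))"

text \<open>Otherwise the members of the base on which \<open>A\<close> is meager are dense below \<open>W\<close>, and \<open>A \<inter> W\<close> is covered by
countably many meager sets and a nowhere dense rest.\<close>

lemma banach_localization:
  assumes "\<not> meager \<B> (A \<inter> W)" "W \<in> \<B>"
  obtains W' where "everywhere_nonmeager A W'" "W' \<subseteq> W"
proof (rule ccontr)
  assume "\<not> thesis"
  then have "\<not> everywhere_nonmeager A W'" if "W' \<subseteq> W" for W'
    using \<open>\<And>W'. everywhere_nonmeager A W' \<Longrightarrow> W' \<subseteq> W \<Longrightarrow> thesis\<close> that by blast
  then have *: "\<exists>W''\<in>\<B>. W'' \<subseteq> W' \<and> meager \<B> (A \<inter> W'')" if "W' \<in> \<B>" "W' \<subseteq> W" for W'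
    using that unfolding everywhere_nonmeager_def by blast
  define I where "I = {W''\<in>\<B>. W'' \<subseteq> W \<and> meager \<B> (A \<inter> W'')}"
  have "meager \<B> (\<Union>V\<in>I. A \<inter> V)"
    by (rule meager_UN) (auto simp: I_def intro: countable_subset[OF _ countable_base])
  moreover have "nowhere_dense \<B> (W - \<Union>I)"
    unfolding nowhere_dense_def
  proof
    fix U assume U: "U \<in> \<B>"
    show "\<exists>V\<in>\<B>. V \<subseteq> U \<and> V \<inter> (W - \<Union>I) = {}"
    proof (cases "U \<inter> W = {}")
      case True
      then show ?thesis using U by blast
    next
      case False
      then obtain x where "x \<in> U" "x \<in> W" by blast
      then obtain W1 where W1: "W1 \<in> \<B>" "W1 \<subseteq> U" "W1 \<subseteq> W" using base_inter[OF U assms(2)] by blast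
      then obtain W'' where W'': "W'' \<in> \<B>" "W'' \<subseteq> W1" "meager \<B> (A \<inter> W'')" using * by blast
      then have "W'' \<in> I" unfolding I_def using W1 by blast
      then show ?thesis using W'' W1 by blast
    qed
  qed
  ultimately have "meager \<B> (\<Union>b::bool. if b then (\<Union>V\<in>I. A \<inter> V) else (W - \<Union>I))"
    by (intro meager_UN) (auto intro: nowhere_dense_imp_meager)
  then have "meager \<B> (A \<inter> W)"
    by (rule meager_subset) (auto split: if_splits)
  then show False using assms(1) by blast
qed

text \<open>This is the part of the Baire property of analytic sets that the theorem needs. For a finite
sequence \<open>\<sigma>\<close> let \<open>A \<sigma>\<close> be the set of points with a witness extending \<open>\<sigma>\<close>, and let \<open>G \<sigma>\<close> be the open set where
\<open>A \<sigma>\<close> is everywhere non-meager. As \<open>A \<sigma>\<close> is the union of the \<open>A (\<sigma> @ [k])\<close>, the sets \<open>G (\<sigma> @ [k])\<close> are together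
dense in \<open>G \<sigma>\<close>. So a generic point of \<open>G []\<close> stays in \<open>G\<close> along some infinite branch \<open>c\<close>. It is then in the
closure of each \<open>A (map c [0..<n])\<close>, and closedness of \<open>R\<close> makes \<open>c\<close> a witness for it.\<close>

theorem analytic_comeager_somewhere:
  fixes R :: "'x \<Rightarrow> (nat \<Rightarrow> 'c::countable) \<Rightarrow> bool"
  assumes closed: "\<And>x c. x \<in> \<Union>\<B> \<Longrightarrow>
      (\<And>V n. V \<in> \<B> \<Longrightarrow> x \<in> V \<Longrightarrow> \<exists>x'\<in>V. \<exists>c'. (\<forall>i<n. c' i = c i) \<and> R x' c') \<Longrightarrow> R x c"
    and nonmeager: "\<not> meager \<B> ({x. \<exists>c. R x c} \<inter> \<Union>\<B>)"
  obtains U where "U \<in> \<B>" "meager \<B> {x \<in> U. \<not> (\<exists>c. R x c)}"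
proof -
  define A where "A \<sigma> = {x. \<exists>c. map c [0..<length \<sigma>] = \<sigma> \<and> R x c}" for \<sigma>
  have A_split: "A \<sigma> = (\<Union>k. A (\<sigma> @ [k]))" for \<sigma>
    unfolding A_def by auto
  define G where "G \<sigma> = \<Union>{V. everywhere_nonmeager (A \<sigma>) V}" for \<sigma>
  have nowhere_dense_diff: "nowhere_dense \<B> (G \<sigma> - (\<Union>k. G (\<sigma> @ [k])))" for \<sigma>
    unfolding nowhere_dense_def
  proof
    fix U assume U: "U \<in> \<B>"
    show "\<exists>V\<in>\<B>. V \<subseteq> U \<and> V \<inter> (G \<sigma> - (\<Union>k. G (\<sigma> @ [k]))) = {}"
    proof (cases "U \<inter> G \<sigma> = {}")
      case True
      then show ?thesis using U by blast
    next
      case False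
      then obtain x V where x: "x \<in> U" "x \<in> V" and V: "everywhere_nonmeager (A \<sigma>) V"
        unfolding G_def by blast
      then obtain W where W: "W \<in> \<B>" "W \<subseteq> U" "W \<subseteq> V"
        using base_inter[OF U _ x] unfolding everywhere_nonmeager_def by blast
      then have "\<not> meager \<B> (A \<sigma> \<inter> W)" using V unfolding everywhere_nonmeager_def by blast
      then have "\<not> meager \<B> (\<Union>k. A (\<sigma> @ [k]) \<inter> W)" using A_split[of \<sigma>] by simp
      then obtain k where "\<not> meager \<B> (A (\<sigma> @ [k]) \<inter> W)"
        using meager_UN[of UNIV \<B> "\<lambda>k. A (\<sigma> @ [k]) \<inter> W"] by auto
      then obtain W' where W': "everywhere_nonmeager (A (\<sigma> @ [k])) W'" "W' \<subseteq> W"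
        using banach_localization W(1) by blast
      then have "W' \<in> \<B>" "W' \<subseteq> G (\<sigma> @ [k])" unfolding G_def everywhere_nonmeager_def by blast+
      then show ?thesis using W(2) W'(2) by (intro bexI[of _ W']) auto
    qed
  qed
  have A0: "A [] = {x. \<exists>c. R x c}" unfolding A_def by auto
  have "{x. \<exists>c. R x c} \<inter> \<Union>\<B> = (\<Union>U\<in>\<B>. A [] \<inter> U)"
    unfolding A0 by blast
  then have "\<not> meager \<B> (\<Union>U\<in>\<B>. A [] \<inter> U)"
    using nonmeager by metis
  then obtain U0 where "U0 \<in> \<B>" "\<not> meager \<B> (A [] \<inter> U0)"
    using meager_UN[OF countable_base] by blast
  then obtain U where U: "everywhere_nonmeager (A []) U" using banach_localization by blast
  have "U \<in> \<B>" using U unfolding everywhere_nonmeager_def by blast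
  moreover have "meager \<B> {x \<in> U. \<not> (\<exists>c. R x c)}"
  proof (rule meager_subset)
    show "meager \<B> (\<Union>\<sigma>. G \<sigma> - (\<Union>k. G (\<sigma> @ [k])))"
      by (rule meager_UN) (auto intro: nowhere_dense_imp_meager nowhere_dense_diff)
    show "{x \<in> U. \<not> (\<exists>c. R x c)} \<subseteq> (\<Union>\<sigma>. G \<sigma> - (\<Union>k. G (\<sigma> @ [k])))"
    proof (rule subsetI, rule ccontr)
      fix x assume xU: "x \<in> {x \<in> U. \<not> (\<exists>c. R x c)}"
        and xN: "x \<notin> (\<Union>\<sigma>. G \<sigma> - (\<Union>k. G (\<sigma> @ [k])))"
      have x: "x \<in> U" "\<not> (\<exists>c. R x c)" using xU by simp_all
      have step: "\<exists>k. x \<in> G (\<sigma> @ [k])" if "x \<in> G \<sigma>" for \<sigma>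
        using xN that by simp
      define next_k where "next_k \<sigma> = (SOME k. x \<in> G (\<sigma> @ [k]))" for \<sigma>
      define f where "f = rec_nat [] (\<lambda>_ \<sigma>. \<sigma> @ [next_k \<sigma>])"
      have f0: "f 0 = []" and fS: "f (Suc n) = f n @ [next_k (f n)]" for n
        by (simp_all add: f_def)
      define c where "c n = next_k (f n)" for n
      have fc: "f n = map c [0..<n]" for n
        by (induction n) (simp_all add: f0 fS c_def)
      have xG: "x \<in> G (f n)" for n
      proof (induction n)
        case 0
        then show ?case unfolding f0 G_def using U x(1) by blast
      next
        case (Suc n)
        then show ?case unfolding fS next_k_def using someI_ex[OF step] by blast
      qed
      have "R x c"
      proof (rule closed)
        show "x \<in> \<Union>\<B>" using x(1) \<open>U \<in> \<B>\<close> by blast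
        fix V n assume V: "V \<in> \<B>" "x \<in> V"
        obtain V' where V': "x \<in> V'" "everywhere_nonmeager (A (f n)) V'"
          using xG[of n] unfolding G_def by blast
        then obtain W where W: "W \<in> \<B>" "W \<subseteq> V" "W \<subseteq> V'"
          using base_inter[OF V(1) _ V(2)] unfolding everywhere_nonmeager_def by blast
        then have "\<not> meager \<B> (A (f n) \<inter> W)" using V'(2) unfolding everywhere_nonmeager_def by blast
        then have "A (f n) \<inter> W \<noteq> {}" using nowhere_dense_imp_meager[OF nowhere_dense_empty] by metis
        then obtain x' c' where x': "x' \<in> W" "map c' [0..<length (f n)] = f n" "R x' c'"
          unfolding A_def by blast
        have "\<forall>i<n. c' i = c i" using x'(2) unfolding fc by auto
        then show "\<exists>x'\<in>V. \<exists>c'. (\<forall>i<n. c' i = c i) \<and> R x' c'" using x' W(2) by blast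
      qed
      then show False using x(2) by blast
    qed
  qed
  ultimately show thesis by (rule that)
qed

end

section \<open>Block-sequences with terms in a countable net\<close>

text \<open>The centres of a finite net of the closure are moved into \<open>S\<close>, at the cost of half of \<open>\<epsilon>\<close>.\<close>

lemma totally_bounded_subset_of_compact:
  fixes S :: "'a::metric_space set"
  assumes "compact A" "S \<subseteq> A" "\<epsilon> > 0"
  obtains k where "finite k" "k \<subseteq> S" "\<And>x. x \<in> S \<Longrightarrow> \<exists>y\<in>k. dist x y < \<epsilon>"
proof -
  have "closure S \<subseteq> A" by (intro closure_minimal assms(2) compact_imp_closed assms(1))
  then have "compact (closure S)"
    using compact_Int_closed[OF assms(1) closed_closure[of S]] by (simp add: Int_absorb1)
  then have "seq_compact (closure S)" using compact_imp_seq_compact by blast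
  from seq_compact_imp_totally_bounded[OF this, rule_format, OF half_gt_zero[OF assms(3)]]
  obtain k where k: "finite k" "k \<subseteq> closure S" "closure S \<subseteq> (\<Union>x\<in>k. ball x (\<epsilon>/2))"
    by (elim exE conjE)
  have "\<exists>s\<in>S. dist s x < \<epsilon>/2" if "x \<in> k" for x
    using subsetD[OF k(2) that, unfolded closure_approachable, rule_format, OF half_gt_zero[OF assms(3)]] .
  then obtain s where s: "\<And>x. x \<in> k \<Longrightarrow> s x \<in> S \<and> dist (s x) x < \<epsilon>/2" by metis
  show thesis
  proof (rule that[of "s ` k"])
    show "finite (s ` k)" "s ` k \<subseteq> S" using k(1) s by auto
    fix x assume "x \<in> S"
    then have "x \<in> (\<Union>x\<in>k. ball x (\<epsilon>/2))" using k(3) closure_subset by blast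
    then obtain y where y: "y \<in> k" "dist y x < \<epsilon>/2" by (elim UN_E) simp
    have "dist x (s y) < \<epsilon>"
      using s[OF y(1)] y(2) dist_triangle[of x "s y" y] by (simp add: dist_commute)
    then show "\<exists>y\<in>s ` k. dist x y < \<epsilon>" using y(1) by blast
  qed
qed

lemma compact_bounded_combinations:
  fixes e :: "nat \<Rightarrow> 'a::real_normed_vector"
  shows "compact {\<Sum>i<n. c i *\<^sub>R e i |c. \<forall>i<n. \<bar>c i\<bar> \<le> M}"
proof (induction n)
  case 0
  have "{\<Sum>i<0. c i *\<^sub>R e i |c. \<forall>i<0. \<bar>c i\<bar> \<le> M} = {0}" by auto
  then show ?case by (simp only: compact_insert compact_empty)
next
  case (Suc n)
  let ?A = "{\<Sum>i<n. c i *\<^sub>R e i |c. \<forall>i<n. \<bar>c i\<bar> \<le> M}"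
  let ?f = "\<lambda>p. snd p + fst p *\<^sub>R e n"
  have "{\<Sum>i<Suc n. c i *\<^sub>R e i |c. \<forall>i<Suc n. \<bar>c i\<bar> \<le> M} = ?f ` ({-M..M} \<times> ?A)"
  proof (intro equalityI subsetI)
    fix x assume "x \<in> {\<Sum>i<Suc n. c i *\<^sub>R e i |c. \<forall>i<Suc n. \<bar>c i\<bar> \<le> M}"
    then obtain c where c: "x = (\<Sum>i<Suc n. c i *\<^sub>R e i)" "\<forall>i<Suc n. \<bar>c i\<bar> \<le> M" by blast
    then have "(\<Sum>i<n. c i *\<^sub>R e i) \<in> ?A" "c n \<in> {-M..M}" by (auto simp: abs_le_iff minus_le_iff)
    then show "x \<in> ?f ` ({-M..M} \<times> ?A)"
      unfolding c(1) by (intro image_eqI[of _ _ "(c n, \<Sum>i<n. c i *\<^sub>R e i)"]) auto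
  next
    fix x assume "x \<in> ?f ` ({-M..M} \<times> ?A)"
    then obtain r c where c: "x = (\<Sum>i<n. c i *\<^sub>R e i) + r *\<^sub>R e n" "\<bar>r\<bar> \<le> M" "\<forall>i<n. \<bar>c i\<bar> \<le> M"
      by (auto simp: abs_le_iff)
    have "x = (\<Sum>i<Suc n. (c(n := r)) i *\<^sub>R e i)" unfolding c(1) by simp
    moreover have "\<forall>i<Suc n. \<bar>(c(n := r)) i\<bar> \<le> M" using c(2,3) by simp
    ultimately show "x \<in> {\<Sum>i<Suc n. c i *\<^sub>R e i |c. \<forall>i<Suc n. \<bar>c i\<bar> \<le> M}" by blast
  qed
  moreover have "compact (?f ` ({-M..M} \<times> ?A))"
    by (intro compact_continuous_image compact_Times compact_Icc Suc.IH continuous_intros)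
  ultimately show ?case by simp
qed

context schauder begin

definition basis_const :: real where
  "basis_const = (SOME C. C \<ge> 1 \<and> (\<forall>N x. norm (proj N x) \<le> C * norm x))"

lemma basis_const_ge_1: "basis_const \<ge> 1" and norm_proj_le: "norm (proj N x) \<le> basis_const * norm x"
proof -
  have "\<exists>C. C \<ge> 1 \<and> (\<forall>N x. norm (proj N x) \<le> C * norm x)" using bounded_projections by metis
  from someI_ex[OF this] show "basis_const \<ge> 1" "norm (proj N x) \<le> basis_const * norm x" unfolding basis_const_def by auto
qed

abbreviation lo :: "'a \<Rightarrow> nat" where "lo x \<equiv> Min (supp e x)"
abbreviation hi :: "'a \<Rightarrow> nat" where "hi x \<equiv> Max (supp e x)"

definition unit_block :: "'a \<Rightarrow> bool" where
  "unit_block x \<longleftrightarrow> norm x = 1 \<and> finite (supp e x)"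

definition prec :: "'a \<Rightarrow> 'a \<Rightarrow> bool" where
  "prec x y \<longleftrightarrow> hi x < lo y"

lemma block_seq_iff: "block_seq e y \<longleftrightarrow> (\<forall>i. unit_block (y i)) \<and> (\<forall>i. prec (y i) (y (Suc i)))"
  unfolding block_seq_def unit_block_def prec_def by blast

lemma supp_nonempty:
  assumes "x \<noteq> 0" shows "supp e x \<noteq> {}"
proof
  assume "supp e x = {}"
  then have "coords e x n = 0" for n unfolding supp_def by blast
  then have "(\<lambda>n. 0) sums x" using coords_sums[of x] by simp
  then show False using assms by (simp add: sums_iff)
qed

lemma unit_block_supp:
  assumes "unit_block x"
  shows "finite (supp e x)" "supp e x \<noteq> {}"
proof -
  have "x \<noteq> 0" using assms unfolding unit_block_def by auto
  then show "supp e x \<noteq> {}" by (rule supp_nonempty)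
  show "finite (supp e x)" using assms unfolding unit_block_def by simp
qed

lemma lo_le_hi: "unit_block x \<Longrightarrow> lo x \<le> hi x"
  using unit_block_supp by (meson Max_ge Min_in)

lemma prec_trans: "prec x y \<Longrightarrow> prec y z \<Longrightarrow> unit_block y \<Longrightarrow> prec x z"
  using lo_le_hi[of y] unfolding prec_def by linarith

lemma proj_eq_0: "unit_block x \<Longrightarrow> N \<le> lo x \<Longrightarrow> proj N x = 0"
proof -
  assume x: "unit_block x" "N \<le> lo x"
  have "coords e x i = 0" if "i < N" for i
  proof (rule ccontr)
    assume "coords e x i \<noteq> 0"
    then have "lo x \<le> i" using unit_block_supp(1)[OF x(1)] by (intro Min_le) (auto simp: supp_def)
    then show False using x(2) that by simp
  qed
  then show ?thesis unfolding proj_def by simp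
qed

lemma proj_eq_self:
  assumes "\<And>i. coords e x i \<noteq> 0 \<Longrightarrow> i < N"
  shows "proj N x = x"
proof -
  have "proj M x = proj N x" if "M \<ge> N" for M
    unfolding proj_def
    by (rule sum.mono_neutral_right) (use that assms in fastforce)+
  then have "\<forall>\<^sub>F M in sequentially. proj M x = proj N x"
    using eventually_sequentially by blast
  then have "(\<lambda>M. proj M x) \<longlonglongrightarrow> proj N x" by (rule tendsto_eventually)
  then show ?thesis using proj_tendsto LIMSEQ_unique by blast
qed

lemma proj_eq_self_block: "unit_block x \<Longrightarrow> hi x < N \<Longrightarrow> proj N x = x"
proof (rule proj_eq_self)
  fix i assume x: "unit_block x" "hi x < N" and "coords e x i \<noteq> 0"
  then have "i \<le> hi x" using unit_block_supp(1)[OF x(1)] by (intro Max_ge) (auto simp: supp_def)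
  then show "i < N" using x(2) by simp
qed

lemma block_seq_less:
  assumes "block_seq e y" "i < j"
  shows "hi (y i) < lo (y j)"
  using assms(2)
proof (induction j)
  case (Suc j)
  have b: "unit_block (y j)" "hi (y j) < lo (y (Suc j))"
    using assms(1) unfolding block_seq_iff prec_def by auto
  show ?case
  proof (cases "i = j")
    case True
    then show ?thesis using b by simp
  next
    case False
    then show ?thesis using Suc b lo_le_hi[OF b(1)] by linarith
  qed
qed simp

lemma block_seq_lo_ge: "block_seq e y \<Longrightarrow> i \<le> lo (y i)"
proof (induction i)
  case (Suc i)
  then show ?case
    using block_seq_less[of y i "Suc i"] lo_le_hi[of "y i"] unfolding block_seq_iff by force
qed simp

lemma block_seq_unit: "block_seq e y \<Longrightarrow> unit_block (y i)"
  unfolding block_seq_iff by blast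

lemma proj_block_sum:
  assumes y: "block_seq e y" and "m \<le> n"
  shows "proj (lo (y m)) (\<Sum>i<n. a i *\<^sub>R y i) = (\<Sum>i<m. a i *\<^sub>R y i)"
proof -
  have "proj (lo (y m)) (\<Sum>i<n. a i *\<^sub>R y i) = (\<Sum>i<n. a i *\<^sub>R proj (lo (y m)) (y i))"
    by (simp add: linear_sum[OF linear_proj] linear_cmul[OF linear_proj])
  also have "\<dots> = (\<Sum>i<n. if i < m then a i *\<^sub>R y i else 0)"
  proof (intro sum.cong refl)
    fix i
    show "a i *\<^sub>R proj (lo (y m)) (y i) = (if i < m then a i *\<^sub>R y i else 0)"
    proof (cases "i < m")
      case True
      then show ?thesis
        using proj_eq_self_block[OF block_seq_unit[OF y] block_seq_less[OF y True]] by simp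
    next
      case False
      then have "lo (y m) \<le> lo (y i)"
        using block_seq_less[OF y, of m i] lo_le_hi[OF block_seq_unit[OF y], of m]
        by (cases "m = i") auto
      then show ?thesis using proj_eq_0[OF block_seq_unit[OF y]] False by simp
    qed
  qed
  also have "\<dots> = (\<Sum>i<m. a i *\<^sub>R y i)"
    using \<open>m \<le> n\<close> by (intro sum.mono_neutral_cong_right) auto
  finally show ?thesis .
qed

text \<open>Cutting between the supports of the terms is a basis projection, so two partial sums, and hence
their difference \<open>a i *\<^sub>R y i\<close>, are controlled by the whole sum.\<close>

lemma block_coefficient_bound:
  assumes y: "block_seq e y" and "i < n"
  shows "\<bar>a i\<bar> \<le> (2 * basis_const) * norm (\<Sum>j<n. a j *\<^sub>R y j)"
proof -
  have le: "norm (\<Sum>j<m. a j *\<^sub>R y j) \<le> basis_const * norm (\<Sum>j<n. a j *\<^sub>R y j)" if "m \<le> n" for m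
    using norm_proj_le[of "lo (y m)" "\<Sum>j<n. a j *\<^sub>R y j"] proj_block_sum[OF y that] by simp
  have "norm (y i) = 1" using block_seq_unit[OF y] unfolding unit_block_def by blast
  then have "\<bar>a i\<bar> = norm (a i *\<^sub>R y i)" by simp
  also have "a i *\<^sub>R y i = (\<Sum>j<Suc i. a j *\<^sub>R y j) - (\<Sum>j<i. a j *\<^sub>R y j)" by simp
  also have "norm \<dots> \<le> norm (\<Sum>j<Suc i. a j *\<^sub>R y j) + norm (\<Sum>j<i. a j *\<^sub>R y j)"
    by (rule norm_triangle_ineq4)
  also have "\<dots> \<le> (2 * basis_const) * norm (\<Sum>j<n. a j *\<^sub>R y j)"
    using le[of "Suc i"] le[of i] \<open>i < n\<close> by simp
  finally show ?thesis .
qed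

text \<open>The constant depends only on the number of changed terms: each of them contributes at
most its coefficient times \<open>2\<close>.\<close>

lemma equi_of_finite_change:
  assumes u: "block_seq e u" and v: "block_seq e v" and uv: "\<And>i. i \<ge> L \<Longrightarrow> u i = v i"
  shows "equi (4 * basis_const * real L + 1) u v"
proof -
  have bound: "norm (\<Sum>i<n. a i *\<^sub>R u i) \<le> (4 * basis_const * real L + 1) * norm (\<Sum>i<n. a i *\<^sub>R v i)"
    if u: "block_seq e u" and v: "block_seq e v" and uv: "\<And>i. i \<ge> L \<Longrightarrow> u i = v i"
    for u v :: "nat \<Rightarrow> 'a" and n :: nat and a :: "nat \<Rightarrow> real"
  proof -
    let ?N = "norm (\<Sum>i<n. a i *\<^sub>R v i)"
    have N0: "4 * basis_const * ?N \<ge> 0" using basis_const_ge_1 by simp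
    have "(\<Sum>i<n. a i *\<^sub>R u i) - (\<Sum>i<n. a i *\<^sub>R v i) = (\<Sum>i<n. a i *\<^sub>R (u i - v i))"
      by (simp add: scaleR_diff_right sum_subtractf)
    also have "norm \<dots> \<le> (\<Sum>i<n. if i < L then 4 * basis_const * ?N else 0)"
    proof (rule sum_norm_le)
      fix i assume i: "i \<in> {..<n}"
      show "norm (a i *\<^sub>R (u i - v i)) \<le> (if i < L then 4 * basis_const * ?N else 0)"
      proof (cases "i < L")
        case True
        have "norm (u i - v i) \<le> 2"
          using norm_triangle_ineq4[of "u i" "v i"] block_seq_unit[OF u, of i] block_seq_unit[OF v, of i]
          unfolding unit_block_def by simp
        moreover have "\<bar>a i\<bar> \<le> (2 * basis_const) * ?N" using block_coefficient_bound[OF v] i by simp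
        ultimately have "\<bar>a i\<bar> * norm (u i - v i) \<le> (2 * basis_const * ?N) * 2"
          using basis_const_ge_1 by (intro mult_mono) auto
        then show ?thesis using True by (simp add: mult_ac)
      next
        case False
        then show ?thesis using uv by simp
      qed
    qed
    also have "\<dots> \<le> (\<Sum>i<L. 4 * basis_const * ?N)"
    proof -
      have "(\<Sum>i<n. if i < L then 4 * basis_const * ?N else 0) = (\<Sum>i\<in>{..<n} \<inter> {..<L}. 4 * basis_const * ?N)"
        by (subst sum.inter_restrict) (simp_all only: finite_lessThan lessThan_iff)
      also have "\<dots> \<le> (\<Sum>i<L. 4 * basis_const * ?N)"
        using N0 by (intro sum_mono2) auto
      finally show ?thesis .
    qed
    finally show ?thesis
      using norm_triangle_ineq2[of "\<Sum>i<n. a i *\<^sub>R u i" "\<Sum>i<n. a i *\<^sub>R v i"]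
      by (simp add: algebra_simps)
  qed
  show ?thesis
    unfolding equi_def using bound[OF u v uv] bound[OF v u uv[symmetric]] by blast
qed

definition unit_e :: "nat \<Rightarrow> 'a" where
  "unit_e i = (1 / norm (e i)) *\<^sub>R e i"

lemma coords_unit_e: "coords e (unit_e i) = (\<lambda>j. if j = i then 1 / norm (e i) else 0)"
proof (rule coords_unique)
  have "(\<lambda>n. if n = i then (1 / norm (e n)) *\<^sub>R e n else 0) sums ((1 / norm (e i)) *\<^sub>R e i)"
    by (rule sums_single)
  moreover have "(\<lambda>n. if n = i then (1 / norm (e n)) *\<^sub>R e n else 0)
      = (\<lambda>n. (if n = i then 1 / norm (e i) else 0) *\<^sub>R e n)" by auto
  ultimately show "(\<lambda>n. (if n = i then 1 / norm (e i) else 0) *\<^sub>R e n) sums unit_e i"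
    unfolding unit_e_def by simp
qed

lemma supp_unit_e: "supp e (unit_e i) = {i}"
  unfolding supp_def coords_unit_e using e_nonzero[of i] by auto

lemma unit_block_unit_e: "unit_block (unit_e i)"
  unfolding unit_block_def supp_unit_e using e_nonzero[of i] by (simp add: unit_e_def)

definition spheres :: "nat \<Rightarrow> nat \<Rightarrow> 'a set" where
  "spheres a b = {x. unit_block x \<and> lo x = a \<and> hi x = b}"

lemma spheres_subset_compact:
  "\<exists>A. compact A \<and> spheres a b \<subseteq> A"
proof -
  define M where "M = (\<Sum>i<Suc b. 2 * basis_const / norm (e i))"
  have "spheres a b \<subseteq> {\<Sum>i<Suc b. c i *\<^sub>R e i |c. \<forall>i<Suc b. \<bar>c i\<bar> \<le> M}"
  proof
    fix x assume "x \<in> spheres a b"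
    then have x: "unit_block x" "hi x = b" unfolding spheres_def by auto
    then have "proj (Suc b) x = x" by (intro proj_eq_self_block) auto
    then have "x = (\<Sum>i<Suc b. coords e x i *\<^sub>R e i)" unfolding proj_def by simp
    moreover have "\<bar>coords e x i\<bar> \<le> M" if "i < Suc b" for i
    proof -
      have "\<bar>coords e x i\<bar> * norm (e i) = norm (proj (Suc i) x - proj i x)" by (simp add: proj_Suc)
      also have "\<dots> \<le> 2 * basis_const"
        using norm_triangle_ineq4[of "proj (Suc i) x" "proj i x"] norm_proj_le[of "Suc i" x]
          norm_proj_le[of i x] x(1) unfolding unit_block_def by simp
      finally have "\<bar>coords e x i\<bar> \<le> 2 * basis_const / norm (e i)" using e_nonzero[of i] by (simp add: field_simps)
      also have "\<dots> \<le> M"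
        unfolding M_def using that basis_const_ge_1 by (intro member_le_sum) auto
      finally show ?thesis .
    qed
    ultimately show "x \<in> {\<Sum>i<Suc b. c i *\<^sub>R e i |c. \<forall>i<Suc b. \<bar>c i\<bar> \<le> M}" by blast
  qed
  then show ?thesis by (intro exI conjI) (rule compact_bounded_combinations)
qed

text \<open>The tolerance is the one in \<open>equi_perturb\<close> for \<open>K = 1\<close> and the coefficient bound of block-sequences.\<close>

definition eps :: "nat \<Rightarrow> real" where
  "eps b = 1 / (2 * 1 * (2 * basis_const) * 2 ^ Suc b)"

lemma eps_pos: "eps b > 0"
  unfolding eps_def using basis_const_ge_1 by simp

lemma eps_antimono: "i \<le> b \<Longrightarrow> eps b \<le> eps i"
  unfolding eps_def using basis_const_ge_1 by (intro divide_left_mono mult_left_mono mult_pos_pos power_increasing) auto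

text \<open>For each pair of extreme indices of the support a finite net is chosen among the unit vectors with exactly
these extreme indices. Approximation then keeps block-sequences block-sequences, and only finitely many
net vectors have support below a given index.\<close>

definition net :: "nat \<Rightarrow> nat \<Rightarrow> 'a set" where
  "net a b = (SOME k. finite k \<and> k \<subseteq> spheres a b \<and> (\<forall>x\<in>spheres a b. \<exists>y\<in>k. dist x y < eps b))"

lemma net: "finite (net a b)" "net a b \<subseteq> spheres a b" "x \<in> spheres a b \<Longrightarrow> \<exists>y\<in>net a b. dist x y < eps b"
proof -
  have "\<exists>k. finite k \<and> k \<subseteq> spheres a b \<and> (\<forall>x\<in>spheres a b. \<exists>y\<in>k. dist x y < eps b)"
  proof -
    obtain A where A: "compact A" "spheres a b \<subseteq> A" using spheres_subset_compact by blast
    obtain k where "finite k" "k \<subseteq> spheres a b" "\<And>x. x \<in> spheres a b \<Longrightarrow> \<exists>y\<in>k. dist x y < eps b"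
      using totally_bounded_subset_of_compact[OF A eps_pos[of b]] by metis
    then show ?thesis by (intro exI[of _ k] conjI ballI)
  qed
  from someI_ex[OF this] show "finite (net a b)" "net a b \<subseteq> spheres a b"
    "x \<in> spheres a b \<Longrightarrow> \<exists>y\<in>net a b. dist x y < eps b"
    unfolding net_def by auto
qed

definition net_vectors :: "'a set" where "net_vectors = (\<Union>a b. net a b)"

lemma net_vectors_unit: "d \<in> net_vectors \<Longrightarrow> unit_block d"
  unfolding net_vectors_def using net(2) unfolding spheres_def by blast

lemma countable_net_vectors: "countable net_vectors"
  unfolding net_vectors_def by (auto intro: countable_finite net(1))

lemma finite_net_vectors_below: "finite {d \<in> net_vectors. hi d \<le> M}"
proof (rule finite_subset)
  show "{d \<in> net_vectors. hi d \<le> M} \<subseteq> (\<Union>a\<in>{..M}. \<Union>b\<in>{..M}. net a b)"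
  proof
    fix d assume "d \<in> {d \<in> net_vectors. hi d \<le> M}"
    then obtain a b where d: "d \<in> net a b" "hi d \<le> M" "unit_block d" using net_vectors_unit unfolding net_vectors_def by blast
    then have "lo d = a" "hi d = b" using net(2)[of a b] unfolding spheres_def by auto
    then have "a \<le> M" "b \<le> M" using d(2) lo_le_hi[OF d(3)] by auto
    then show "d \<in> (\<Union>a\<in>{..M}. \<Union>b\<in>{..M}. net a b)" using d(1) by blast
  qed
qed (simp add: net(1))

lemma net_vectors_approx:
  assumes "unit_block x"
  obtains d where "d \<in> net_vectors" "lo d = lo x" "hi d = hi x" "dist x d < eps (hi x)"
proof -
  have "x \<in> spheres (lo x) (hi x)" unfolding spheres_def using assms by simp
  then obtain d where d: "d \<in> net (lo x) (hi x)" "dist x d < eps (hi x)" using net(3) by blast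
  then have "lo d = lo x" "hi d = hi x" "d \<in> net_vectors" using net(2) unfolding spheres_def net_vectors_def by blast+
  then show thesis using d(2) that by blast
qed

lemma net_vectors_point: "\<exists>d. d \<in> net_vectors \<and> lo d = k \<and> hi d = k"
  using net_vectors_approx[OF unit_block_unit_e[of k]] unfolding supp_unit_e by (metis Max_singleton Min_singleton)

definition net_point :: "nat \<Rightarrow> 'a" where "net_point k = (SOME d. d \<in> net_vectors \<and> lo d = k \<and> hi d = k)"

lemma net_point: "net_point k \<in> net_vectors" "lo (net_point k) = k" "hi (net_point k) = k"
  using someI_ex[OF net_vectors_point[of k]] unfolding net_point_def by auto

definition fblock :: "'a list \<Rightarrow> bool" where
  "fblock xs \<longleftrightarrow> set xs \<subseteq> net_vectors \<and> successively prec xs"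

text \<open>The branches of the tree of finite block-sequences of net vectors.\<close>

definition net_seqs :: "(nat \<Rightarrow> 'a) set" where
  "net_seqs = {y. (\<forall>i. y i \<in> net_vectors) \<and> (\<forall>i. prec (y i) (y (Suc i)))}"

definition cyl :: "'a list \<Rightarrow> (nat \<Rightarrow> 'a) set" where
  "cyl s = {y \<in> net_seqs. \<forall>i<length s. y i = s ! i}"

lemma net_seqs_block_seq: "y \<in> net_seqs \<Longrightarrow> block_seq e y"
  unfolding net_seqs_def block_seq_iff using net_vectors_unit by blast

lemma fblock_append:
  "fblock (xs @ ys) \<longleftrightarrow> fblock xs \<and> fblock ys \<and> (xs = [] \<or> ys = [] \<or> prec (last xs) (hd ys))"
  unfolding fblock_def successively_append_iff by auto

lemma fblock_Nil: "fblock []"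
  unfolding fblock_def by simp

lemma fblock_net_point: "fblock [net_point k]"
  unfolding fblock_def using net_point by simp

text \<open>Nonempty supports make \<open>prec\<close> transitive on the net vectors.\<close>

lemma fblock_sorted: "fblock xs \<Longrightarrow> sorted_wrt prec xs"
  unfolding fblock_def using net_vectors_unit
  by (subst successively_iff_sorted_wrt_strong[symmetric]) (auto intro: prec_trans)

lemma fblock_prefix:
  assumes "y \<in> net_seqs" shows "fblock (map y [0..<n])"
proof (induction n)
  case 0
  then show ?case by (simp add: fblock_Nil)
next
  case (Suc n)
  have "fblock [y n]" using assms unfolding fblock_def net_seqs_def by simp
  moreover have "prec (last (map y [0..<n])) (y n)" if "n > 0"
  proof -
    have "prec (y (n - 1)) (y (Suc (n - 1)))" using assms unfolding net_seqs_def by blast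
    then show ?thesis using that by (simp add: last_map)
  qed
  ultimately show ?case using Suc by (auto simp: fblock_append)
qed

lemma in_cyl_prefix: "y \<in> net_seqs \<Longrightarrow> y \<in> cyl (map y [0..<n])"
  unfolding cyl_def by simp

lemma cyl_append_subset: "cyl (s @ t) \<subseteq> cyl s"
  unfolding cyl_def by (auto simp: nth_append)

lemma cyl_prefix_subset:
  assumes "y \<in> cyl s" "length s \<le> n" shows "cyl (map y [0..<n]) \<subseteq> cyl s"
  using assms unfolding cyl_def by auto

lemma cyl_subset_net_seqs: "cyl s \<subseteq> net_seqs"
  unfolding cyl_def by blast

lemma cyl_Nil: "cyl [] = net_seqs"
  unfolding cyl_def by simp

text \<open>The remaining terms are net vectors supported at single indices.\<close>

lemma cyl_nonempty:
  assumes "fblock s" shows "\<exists>y. y \<in> cyl s"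
proof -
  define b where "b = (if s = [] then 0 else Suc (hi (last s)))"
  define y where "y i = (if i < length s then s ! i else net_point (b + i))" for i
  have "prec (y i) (y (Suc i))" for i
  proof -
    consider "Suc i < length s" | "Suc i = length s" | "length s \<le> i" by linarith
    then show ?thesis
    proof cases
      case 1
      then have "prec (s ! i) (s ! Suc i)"
        using fblock_sorted[OF assms] by (simp add: sorted_wrt_nth_less)
      then show ?thesis using 1 by (simp add: y_def)
    next
      case 2
      then have nonempty: "s \<noteq> []" by auto
      then have last: "s ! i = last s" by (simp add: last_conv_nth 2[symmetric])
      have "hi (last s) < b + Suc i" using nonempty by (simp add: b_def)
      then show ?thesis using 2 last by (simp add: y_def prec_def net_point)
    next
      case 3
      then show ?thesis by (simp add: y_def prec_def net_point)
    qed
  qed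
  moreover have "y i \<in> net_vectors" for i
    using assms nth_mem[of i s] net_point(1) unfolding y_def fblock_def by auto
  ultimately have "y \<in> net_seqs" unfolding net_seqs_def by blast
  then show ?thesis unfolding cyl_def by (intro exI[of _ y]) (simp add: y_def)
qed

lemma fblock_extend_to_length:
  assumes "fblock s" "length s \<le> n"
  obtains t where "fblock (s @ t)" "length (s @ t) = n"
proof -
  obtain y where y: "y \<in> cyl s" using cyl_nonempty[OF assms(1)] by blast
  have tk: "take (length s) (map y [0..<n]) = s"
    using y assms(2) unfolding cyl_def by (intro nth_equalityI) auto
  have eq: "s @ drop (length s) (map y [0..<n]) = map y [0..<n]"
    using append_take_drop_id[of "length s" "map y [0..<n]", unfolded tk] .
  moreover have "fblock (map y [0..<n])" using y cyl_subset_net_seqs fblock_prefix by blast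
  ultimately show thesis by (intro that[of "drop (length s) (map y [0..<n])"]) simp_all
qed

text \<open>This is the point of using finite nets: the initial segments that a finite block with later support has to
take care of are finite in number.\<close>

lemma finite_fblock_below: "finite {s. fblock s \<and> (\<forall>x\<in>set s. hi x \<le> M)}"
proof (rule finite_subset)
  show "{s. fblock s \<and> (\<forall>x\<in>set s. hi x \<le> M)} \<subseteq> {s. set s \<subseteq> {d \<in> net_vectors. hi d \<le> M} \<and> distinct s}"
  proof
    fix s assume "s \<in> {s. fblock s \<and> (\<forall>x\<in>set s. hi x \<le> M)}"
    then have s: "fblock s" "\<forall>x\<in>set s. hi x \<le> M" by auto
    have "distinct s"
      unfolding distinct_conv_nth
    proof (intro allI impI)
      fix i j assume ij: "i < length s" "j < length s" "i \<noteq> j"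
      have differ: "s ! i \<noteq> s ! j" if "i < j" "j < length s" for i j
      proof -
        have "prec (s ! i) (s ! j)" using fblock_sorted[OF s(1)] that by (simp add: sorted_wrt_nth_less)
        moreover have "unit_block (s ! j)" using s(1) that net_vectors_unit unfolding fblock_def by (meson nth_mem subsetD)
        ultimately show ?thesis using lo_le_hi unfolding prec_def by force
      qed
      show "s ! i \<noteq> s ! j" using differ[of i j] differ[of j i] ij by (cases "i < j") auto
    qed
    then show "s \<in> {s. set s \<subseteq> {d \<in> net_vectors. hi d \<le> M} \<and> distinct s}"
      using s unfolding fblock_def by blast
  qed
  show "finite {s. set s \<subseteq> {d \<in> net_vectors. hi d \<le> M} \<and> distinct s}"
    by (rule finite_subset_distinct[OF finite_net_vectors_below])
qed

definition boxes :: "((nat \<Rightarrow> 'a) \<times> (nat \<Rightarrow> 'a)) set set" where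
  "boxes = {cyl s \<times> cyl t |s t. fblock s \<and> fblock t}"

lemma boxI: "fblock s \<Longrightarrow> fblock t \<Longrightarrow> cyl s \<times> cyl t \<in> boxes"
  unfolding boxes_def by blast

lemma Union_boxes: "\<Union>boxes = net_seqs \<times> net_seqs"
proof
  show "\<Union>boxes \<subseteq> net_seqs \<times> net_seqs" unfolding boxes_def using cyl_subset_net_seqs by blast
  have "net_seqs \<times> net_seqs \<in> boxes" using boxI[OF fblock_Nil fblock_Nil] unfolding cyl_Nil .
  then show "net_seqs \<times> net_seqs \<subseteq> \<Union>boxes" by blast
qed

sublocale boxes: countable_base boxes
proof
  have "countable (lists net_vectors)" by (intro countable_lists countable_net_vectors)
  then have "countable ((\<lambda>(s, t). cyl s \<times> cyl t) ` (lists net_vectors \<times> lists net_vectors))" by auto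
  moreover have "boxes \<subseteq> (\<lambda>(s, t). cyl s \<times> cyl t) ` (lists net_vectors \<times> lists net_vectors)"
    unfolding boxes_def fblock_def by auto
  ultimately show "countable boxes" by (rule countable_subset[rotated])
  fix U V :: "((nat \<Rightarrow> 'a) \<times> (nat \<Rightarrow> 'a)) set" and x
  assume "U \<in> boxes" "V \<in> boxes" and x: "x \<in> U" "x \<in> V"
  then obtain s t s' t' where U: "U = cyl s \<times> cyl t" and V: "V = cyl s' \<times> cyl t'"
    unfolding boxes_def by blast
  obtain y z where yz: "x = (y, z)" by (cases x)
  define n where "n = max (max (length s) (length t)) (max (length s') (length t'))"
  have mem: "y \<in> cyl s" "y \<in> cyl s'" "z \<in> cyl t" "z \<in> cyl t'" using x unfolding U V yz by auto
  then have "y \<in> net_seqs" "z \<in> net_seqs" using cyl_subset_net_seqs by auto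
  moreover have "cyl (map y [0..<n]) \<subseteq> cyl s" "cyl (map y [0..<n]) \<subseteq> cyl s'"
    "cyl (map z [0..<n]) \<subseteq> cyl t" "cyl (map z [0..<n]) \<subseteq> cyl t'"
    using mem by (intro cyl_prefix_subset; simp add: n_def)+
  ultimately show "\<exists>W\<in>boxes. x \<in> W \<and> W \<subseteq> U \<and> W \<subseteq> V"
    unfolding U V yz
    by (intro bexI[of _ "cyl (map y [0..<n]) \<times> cyl (map z [0..<n])"] conjI boxI fblock_prefix)
      (auto simp: in_cyl_prefix)
qed

lemma nowhere_dense_extend:
  assumes "nowhere_dense boxes C" "fblock s" "fblock t"
  obtains s' t' where "fblock (s @ s')" "fblock (t @ t')" "cyl (s @ s') \<times> cyl (t @ t') \<inter> C = {}"
proof -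
  obtain p q where pq: "fblock p" "fblock q" "cyl p \<times> cyl q \<subseteq> cyl s \<times> cyl t" "cyl p \<times> cyl q \<inter> C = {}"
    using assms(1) boxI[OF assms(2,3)] unfolding nowhere_dense_def boxes_def by blast
  obtain y z where yz: "y \<in> cyl p" "z \<in> cyl q" using cyl_nonempty pq(1,2) by blast
  then have yz': "y \<in> cyl s" "z \<in> cyl t" using pq(3) by auto
  define n where "n = max (max (length s) (length t)) (max (length p) (length q))"
  have tk: "take (length s) (map y [0..<n]) = s" "take (length t) (map z [0..<n]) = t"
    using yz' unfolding cyl_def n_def by (auto intro!: nth_equalityI)
  have eq: "s @ drop (length s) (map y [0..<n]) = map y [0..<n]"
    "t @ drop (length t) (map z [0..<n]) = map z [0..<n]"
    using append_take_drop_id[of "length s" "map y [0..<n]", unfolded tk]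
      append_take_drop_id[of "length t" "map z [0..<n]", unfolded tk] .
  have "fblock (map y [0..<n])" "fblock (map z [0..<n])"
    using yz cyl_subset_net_seqs fblock_prefix by blast+
  moreover have "cyl (map y [0..<n]) \<times> cyl (map z [0..<n]) \<inter> C = {}"
  proof -
    have "cyl (map y [0..<n]) \<subseteq> cyl p" "cyl (map z [0..<n]) \<subseteq> cyl q"
      using yz by (intro cyl_prefix_subset; simp add: n_def)+
    then show ?thesis using pq(4) by blast
  qed
  ultimately show thesis
    by (intro that[of "drop (length s) (map y [0..<n])" "drop (length t) (map z [0..<n])"])
      (simp_all only: eq)
qed

text \<open>The pairs in \<open>F\<close> are treated one after the other. Extending \<open>a\<close> and \<open>b\<close> for one pair keeps what was
achieved for the earlier ones, and it keeps the extensions compatible with all initial segments because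
these only interact with the first terms of \<open>a\<close> and \<open>b\<close>.\<close>

lemma nowhere_dense_extend_simultaneously:
  assumes "finite F" "nowhere_dense boxes C" "a \<noteq> []" "b \<noteq> []" "fblock a" "fblock b"
    and "\<And>q r. (q, r) \<in> F \<Longrightarrow> fblock (q @ a) \<and> fblock (r @ b)"
  shows "\<exists>a' b'. fblock (a @ a') \<and> fblock (b @ b') \<and>
    (\<forall>(q, r)\<in>F. cyl (q @ a @ a') \<times> cyl (r @ b @ b') \<inter> C = {})"
  using assms(1,7)
proof (induction F rule: finite_induct)
  case empty
  then show ?case using assms(5,6) by (intro exI[of _ "[]"]) simp
next
  case (insert x F)
  obtain q r where x: "x = (q, r)" by (cases x)
  obtain a' b' where IH: "fblock (a @ a')" "fblock (b @ b')"
    "\<forall>(q, r)\<in>F. cyl (q @ a @ a') \<times> cyl (r @ b @ b') \<inter> C = {}"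
    using insert by blast
  have "fblock (q @ a)" "fblock (r @ b)" using insert.prems x by blast+
  then have "fblock (q @ a @ a')" "fblock (r @ b @ b')"
    using IH(1,2) assms(3,4) by (auto simp: fblock_append[of q] fblock_append[of r])
  then obtain s' t' where st: "fblock ((q @ a @ a') @ s')" "fblock ((r @ b @ b') @ t')"
    "cyl ((q @ a @ a') @ s') \<times> cyl ((r @ b @ b') @ t') \<inter> C = {}"
    by (rule nowhere_dense_extend[OF assms(2)])
  have "fblock (a @ a' @ s')" "fblock (b @ b' @ t')"
    using st(1,2) by (simp_all add: fblock_append[of q] fblock_append[of r])
  moreover have "cyl (p @ a @ a' @ s') \<times> cyl (w @ b @ b' @ t') \<inter> C = {}" if "(p, w) \<in> insert x F" for p w
  proof (cases "(p, w) = x")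
    case True
    then show ?thesis using st(3) x by simp
  next
    case False
    then have "cyl (p @ a @ a') \<times> cyl (w @ b @ b') \<inter> C = {}" using that IH(3) by blast
    moreover have "cyl (p @ a @ a' @ s') \<subseteq> cyl (p @ a @ a')" "cyl (w @ b @ b' @ t') \<subseteq> cyl (w @ b @ b')"
      using cyl_append_subset[of "p @ a @ a'" s'] cyl_append_subset[of "w @ b @ b'" t'] by simp_all
    ultimately show ?thesis by blast
  qed
  ultimately show ?case by (intro exI[of _ "a' @ s'"] exI[of _ "b' @ t'"]) auto
qed

text \<open>Net vectors are fixed, so that passing through a finite block of net vectors is preserved.\<close>

definition to_net :: "'a \<Rightarrow> 'a" where
  "to_net x = (if x \<in> net_vectors then x else SOME d. d \<in> net_vectors \<and> lo d = lo x \<and> hi d = hi x \<and> dist x d < eps (hi x))"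

lemma to_net_id: "x \<in> net_vectors \<Longrightarrow> to_net x = x"
  unfolding to_net_def by simp

lemma to_net:
  assumes "unit_block x"
  shows "to_net x \<in> net_vectors" "lo (to_net x) = lo x" "hi (to_net x) = hi x" "dist x (to_net x) \<le> eps (hi x)"
proof -
  have "\<exists>d. d \<in> net_vectors \<and> lo d = lo x \<and> hi d = hi x \<and> dist x d < eps (hi x)"
    using net_vectors_approx[OF assms] by metis
  from someI_ex[OF this]
  have "to_net x \<in> net_vectors \<and> lo (to_net x) = lo x \<and> hi (to_net x) = hi x \<and> dist x (to_net x) \<le> eps (hi x)"
    unfolding to_net_def using eps_pos[of "hi x"] by (auto intro: less_imp_le)
  then show "to_net x \<in> net_vectors" "lo (to_net x) = lo x" "hi (to_net x) = hi x" "dist x (to_net x) \<le> eps (hi x)" by auto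
qed

lemma to_net_block_seq:
  assumes "block_seq e y"
  shows "to_net \<circ> y \<in> net_seqs" "equi 2 y (to_net \<circ> y)"
proof -
  show "to_net \<circ> y \<in> net_seqs"
    using assms to_net unfolding net_seqs_def block_seq_iff prec_def by simp
  have "equi (2 * 1) y (to_net \<circ> y)"
  proof (rule equi_perturb[of "2 * basis_const"])
    show "equi 1 y y" unfolding equi_def by simp
    fix i
    have "i \<le> hi (y i)"
      using block_seq_lo_ge[OF assms, of i] lo_le_hi[OF block_seq_unit[OF assms], of i] by simp
    then have "dist (y i) (to_net (y i)) \<le> eps i"
      using to_net(4)[OF block_seq_unit[OF assms]] eps_antimono by (meson order_trans)
    then show "norm ((to_net \<circ> y) i - y i) \<le> 1 / (2 * 1 * (2 * basis_const) * 2 ^ Suc i)"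
      unfolding eps_def by (simp add: dist_norm norm_minus_commute)
  qed (use basis_const_ge_1 block_coefficient_bound[OF assms] in auto)
  then show "equi 2 y (to_net \<circ> y)" by simp
qed

end

section \<open>Isomorphisms coded by sequences of rational coefficients\<close>

definition rat_comb :: "rat list \<Rightarrow> (nat \<Rightarrow> 'a::real_vector) \<Rightarrow> 'a" where
  "rat_comb q w = (\<Sum>j<length q. of_rat (q ! j) *\<^sub>R w j)"

lemma rat_comb_cong: "(\<And>j. j < length q \<Longrightarrow> w j = w' j) \<Longrightarrow> rat_comb q w = rat_comb q w'"
  unfolding rat_comb_def by (intro sum.cong) auto

lemma rat_comb_in_span: "rat_comb q w \<in> span (range w)"
  unfolding rat_comb_def by (intro span_sum span_scale span_base) simp

text \<open>Here \<open>p = (y, z)\<close>, and \<open>c\<close> describes an isomorphism from the span of \<open>y\<close> onto that of \<open>z\<close>. The first lists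
give the images of the \<open>y i\<close> as rational combinations of the \<open>z j\<close>; the second ones give, for each \<open>j\<close> and
\<open>m\<close>, a rational combination of these images that is close to \<open>z j\<close>, so that the isomorphism is onto. Every
single condition involves only finitely many terms of \<open>y\<close>, \<open>z\<close> and \<open>c\<close>.\<close>

definition iso_code ::
  "real \<Rightarrow> (nat \<Rightarrow> 'a::real_normed_vector) \<times> (nat \<Rightarrow> 'a) \<Rightarrow> (nat \<Rightarrow> rat list \<times> rat list) \<Rightarrow> bool" where
  "iso_code K p c \<longleftrightarrow>
     equi K (fst p) (\<lambda>i. rat_comb (fst (c i)) (snd p)) \<and>
     (\<forall>n. norm (rat_comb (snd (c n)) (\<lambda>i. rat_comb (fst (c i)) (snd p)) - snd p (fst (prod_decode n)))
        \<le> 1 / (1 + real (snd (prod_decode n))))"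

lemma iso_code_sound:
  fixes y z :: "nat \<Rightarrow> 'a::banach"
  assumes "iso_code K (y, z) c" "K \<ge> 0"
  shows "lin_iso K (closed_span (range y)) (closed_span (range z))"
proof -
  define v where "v i = rat_comb (fst (c i)) z" for i
  have eq: "equi K y v" and dense: "norm (rat_comb (snd (c n)) v - z (fst (prod_decode n)))
        \<le> 1 / (1 + real (snd (prod_decode n)))" for n
    using assms(1) unfolding iso_code_def v_def by auto
  have "closed_span (range v) = closed_span (range z)"
  proof
    have "v i \<in> closed_span (range z)" for i
      unfolding v_def using rat_comb_in_span span_le_closed_span by (rule subsetD[rotated])
    then show "closed_span (range v) \<subseteq> closed_span (range z)"
      by (intro closed_span_minimal subspace_closed_span closed_closed_span) auto
    have "z j \<in> closed_span (range v)" for j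
      unfolding closed_span_def closure_approachable
    proof (intro allI impI)
      fix \<epsilon> :: real assume "\<epsilon> > 0"
      then obtain m where m: "1 / (1 + real m) < \<epsilon>"
        using reals_Archimedean[of \<epsilon>] by (auto simp: inverse_eq_divide)
      have "norm (rat_comb (snd (c (prod_encode (j, m)))) v - z j) \<le> 1 / (1 + real m)"
        using dense[of "prod_encode (j, m)"] by simp
      then show "\<exists>x\<in>span (range v). dist x (z j) < \<epsilon>"
        using m rat_comb_in_span by (intro bexI[of _ "rat_comb (snd (c (prod_encode (j, m)))) v"])
          (simp_all add: dist_norm)
    qed
    then show "closed_span (range z) \<subseteq> closed_span (range v)"
      by (intro closed_span_minimal subspace_closed_span closed_closed_span) auto
  qed
  then show ?thesis using equi_imp_lin_iso[OF eq assms(2)] by simp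
qed

context schauder begin

text \<open>The images of the \<open>y i\<close> under an isomorphism are moved to nearby rational combinations of the \<open>z j\<close>.\<close>

lemma iso_code_complete:
  assumes y: "block_seq e y" and iso: "lin_iso K (closed_span (range y)) (closed_span (range z))" and K: "K \<ge> 1"
  shows "\<exists>c. iso_code (2 * K) (y, z) c"
proof -
  obtain u where u: "equi K y u" "closed_span (range u) = closed_span (range z)"
    by (rule lin_iso_imp_equi[OF iso]) (use K closed_closed_span in auto)
  define \<delta> where "\<delta> i = 1 / (2 * K * (2 * basis_const) * 2 ^ Suc i)" for i
  have \<delta>: "\<delta> i > 0" for i unfolding \<delta>_def using K basis_const_ge_1 by simp
  have "\<exists>q. norm (rat_comb q z - u i) \<le> \<delta> i" for i
  proof -
    have "u i \<in> closed_span (range z)" unfolding u(2)[symmetric] by (rule in_closed_span) simp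
    from rational_combination_approx[OF this \<delta>] obtain q where
      "norm ((\<Sum>j<length q. of_rat (q ! j) *\<^sub>R z j) - u i) < \<delta> i" .
    then show ?thesis unfolding rat_comb_def by (intro exI[of _ q]) simp
  qed
  then obtain Q where Q: "\<And>i. norm (rat_comb (Q i) z - u i) \<le> \<delta> i" by metis
  define v where "v i = rat_comb (Q i) z" for i
  have close: "norm (v i - u i) \<le> 1 / (2 * K * (2 * basis_const) * 2 ^ Suc i)" for i
    using Q[of i] unfolding v_def \<delta>_def .
  have bc2: "2 * basis_const > 0" and K0: "K > 0" using basis_const_ge_1 K by auto
  have "equi (2 * K) y v"
    by (rule equi_perturb[OF bc2 K u(1) block_coefficient_bound[OF y] close])
  have "range v \<subseteq> closed_span (range u)"
    unfolding u(2) v_def using rat_comb_in_span span_le_closed_span by blast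
  then have v_span: "closed_span (range v) = closed_span (range z)"
    using closed_span_perturb[OF bc2 K0 u(1) block_coefficient_bound[OF y] close] u(2) by simp
  have "\<exists>q. norm (rat_comb q v - z (fst (prod_decode n))) \<le> 1 / (1 + real (snd (prod_decode n)))" for n
  proof -
    have "z (fst (prod_decode n)) \<in> closed_span (range v)"
      unfolding v_span by (rule in_closed_span) simp
    moreover have "1 / (1 + real (snd (prod_decode n))) > 0" by simp
    ultimately obtain q where
      "norm ((\<Sum>j<length q. of_rat (q ! j) *\<^sub>R v j) - z (fst (prod_decode n))) < 1 / (1 + real (snd (prod_decode n)))"
      by (rule rational_combination_approx)
    then show ?thesis unfolding rat_comb_def by (intro exI[of _ q]) simp
  qed
  then obtain P where P: "\<And>n. norm (rat_comb (P n) v - z (fst (prod_decode n))) \<le> 1 / (1 + real (snd (prod_decode n)))"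
    by metis
  have "iso_code (2 * K) (y, z) (\<lambda>i. (Q i, P i))"
    unfolding iso_code_def fst_conv snd_conv using \<open>equi (2 * K) y v\<close> P unfolding v_def by blast
  then show ?thesis by blast
qed

text \<open>Each condition on the code depends on finitely many terms, and up to any level \<open>(p, c)\<close> agrees
with a pair that satisfies all of them.\<close>

lemma iso_code_closed:
  assumes p: "p \<in> \<Union>boxes"
    and approx: "\<And>V n. V \<in> boxes \<Longrightarrow> p \<in> V \<Longrightarrow> \<exists>p'\<in>V. \<exists>c'. (\<forall>i<n. c' i = c i) \<and> iso_code K p' c'"
  shows "iso_code K p c"
proof -
  obtain y z where yz: "p = (y, z)" by (cases p)
  have yzY: "y \<in> net_seqs" "z \<in> net_seqs" using p unfolding yz Union_boxes by auto
  have agree: "\<exists>y' z' c'. (\<forall>i<N. y' i = y i \<and> z' i = z i \<and> c' i = c i) \<and> iso_code K (y', z') c'" for N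
  proof -
    have "cyl (map y [0..<N]) \<times> cyl (map z [0..<N]) \<in> boxes"
      by (intro boxI fblock_prefix yzY)
    moreover have "p \<in> cyl (map y [0..<N]) \<times> cyl (map z [0..<N])"
      unfolding yz using in_cyl_prefix yzY by simp
    ultimately obtain p' c' where p': "p' \<in> cyl (map y [0..<N]) \<times> cyl (map z [0..<N])"
      "\<forall>i<N. c' i = c i" "iso_code K p' c'"
      using approx by blast
    obtain y' z' where "p' = (y', z')" by (cases p')
    then show ?thesis
      using p' by (intro exI[of _ y'] exI[of _ z'] exI[of _ c']) (auto simp: cyl_def)
  qed
  show ?thesis
    unfolding iso_code_def yz fst_conv snd_conv
  proof (intro conjI allI)
    show "equi K y (\<lambda>i. rat_comb (fst (c i)) z)"
      unfolding equi_def
    proof (intro allI)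
      fix n a
      \<comment> \<open>Below \<open>N\<close> lie all terms of \<open>y\<close>, \<open>z\<close> and \<open>c\<close> that occur in the inequalities for \<open>n\<close>.\<close>
      define N where "N = n + (\<Sum>i<n. length (fst (c i)))"
      obtain y' z' c' where ag: "\<And>i. i < N \<Longrightarrow> y' i = y i \<and> z' i = z i \<and> c' i = c i"
        and code: "iso_code K (y', z') c'" using agree[of N] by blast
      have 1: "(\<Sum>i<n. a i *\<^sub>R y' i) = (\<Sum>i<n. a i *\<^sub>R y i)"
        using ag by (intro sum.cong) (auto simp: N_def)
      have 2: "(\<Sum>i<n. a i *\<^sub>R rat_comb (fst (c' i)) z') = (\<Sum>i<n. a i *\<^sub>R rat_comb (fst (c i)) z)"
      proof (intro sum.cong refl)
        fix i assume i: "i \<in> {..<n}"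
        have "length (fst (c i)) \<le> (\<Sum>i<n. length (fst (c i)))"
          using i by (intro member_le_sum) auto
        then have "rat_comb (fst (c i)) z' = rat_comb (fst (c i)) z"
          using ag by (intro rat_comb_cong) (auto simp: N_def)
        moreover have "c' i = c i" using ag i by (simp add: N_def)
        ultimately show "a i *\<^sub>R rat_comb (fst (c' i)) z' = a i *\<^sub>R rat_comb (fst (c i)) z" by simp
      qed
      have "norm (\<Sum>i<n. a i *\<^sub>R y' i) \<le> K * norm (\<Sum>i<n. a i *\<^sub>R rat_comb (fst (c' i)) z') \<and>
        norm (\<Sum>i<n. a i *\<^sub>R rat_comb (fst (c' i)) z') \<le> K * norm (\<Sum>i<n. a i *\<^sub>R y' i)"
        using code unfolding iso_code_def equi_def by simp
      then show "norm (\<Sum>i<n. a i *\<^sub>R y i) \<le> K * norm (\<Sum>i<n. a i *\<^sub>R rat_comb (fst (c i)) z) \<and>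
        norm (\<Sum>i<n. a i *\<^sub>R rat_comb (fst (c i)) z) \<le> K * norm (\<Sum>i<n. a i *\<^sub>R y i)"
        unfolding 1 2 .
    qed
    fix n
    define m where "m = length (snd (c n))"
    define N where "N = Suc n + Suc (fst (prod_decode n)) + m + (\<Sum>i<m. length (fst (c i)))"
    obtain y' z' c' where ag: "\<And>i. i < N \<Longrightarrow> y' i = y i \<and> z' i = z i \<and> c' i = c i"
      and code: "iso_code K (y', z') c'" using agree[of N] by blast
    have cn: "c' n = c n" and zn: "z' (fst (prod_decode n)) = z (fst (prod_decode n))"
      using ag by (simp_all add: N_def)
    have "rat_comb (snd (c n)) (\<lambda>i. rat_comb (fst (c' i)) z') = rat_comb (snd (c n)) (\<lambda>i. rat_comb (fst (c i)) z)"
    proof (rule rat_comb_cong)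
      fix i assume "i < length (snd (c n))"
      then have i: "i < m" by (simp add: m_def)
      have "length (fst (c i)) \<le> (\<Sum>i<m. length (fst (c i)))"
        using i by (intro member_le_sum) auto
      then have "rat_comb (fst (c i)) z' = rat_comb (fst (c i)) z"
        using ag by (intro rat_comb_cong) (auto simp: N_def)
      moreover have "c' i = c i" using ag i by (simp add: N_def)
      ultimately show "rat_comb (fst (c' i)) z' = rat_comb (fst (c i)) z" by simp
    qed
    moreover have "norm (rat_comb (snd (c' n)) (\<lambda>i. rat_comb (fst (c' i)) z') - z' (fst (prod_decode n)))
        \<le> 1 / (1 + real (snd (prod_decode n)))"
      using code unfolding iso_code_def by simp
    ultimately show "norm (rat_comb (snd (c n)) (\<lambda>i. rat_comb (fst (c i)) z) - z (fst (prod_decode n)))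
        \<le> 1 / (1 + real (snd (prod_decode n)))"
      unfolding cn zn by simp
  qed
qed

end

section \<open>Measurability of closed spans\<close>

lemma open_agree_below:
  fixes \<alpha> :: "nat \<Rightarrow> bool"
  shows "open {\<beta>. \<forall>k<M. \<beta> k = \<alpha> k}"
proof -
  have "{\<beta>. \<forall>k<M. \<beta> k = \<alpha> k} = (\<Inter>k\<in>{..<M}. (\<lambda>\<beta>. \<beta> k) -` {\<alpha> k})" by auto
  also have "open \<dots>"
  proof (intro open_INT ballI)
    fix k
    show "open ((\<lambda>\<beta>. \<beta> k) -` {\<alpha> k})"
      by (rule open_vimage[OF open_discrete continuous_on_product_coordinates])
  qed simp
  finally show ?thesis .
qed

text \<open>The closed span meets an open set iff some finite combination of the sequence lies in it. That condition
depends on finitely many coordinates of \<open>\<alpha>\<close>, so the preimages of the generating sets are even open.\<close>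

lemma measurable_closed_span:
  fixes f :: "(nat \<Rightarrow> bool) \<Rightarrow> nat \<Rightarrow> 'a::real_normed_vector"
  assumes dep: "\<And>i \<alpha> \<beta>. (\<And>k. k < m i \<Longrightarrow> \<beta> k = \<alpha> k) \<Longrightarrow> f \<beta> i = f \<alpha> i"
  shows "(\<lambda>\<alpha>. closed_span (range (f \<alpha>))) \<in> borel \<rightarrow>\<^sub>M effros_borel"
  unfolding effros_borel_def
proof (rule measurable_measure_of)
  show "{{F \<in> closed_subspaces. F \<inter> U \<noteq> {}} |U. open U} \<subseteq> Pow (closed_subspaces :: 'a set set)" by blast
  have cs: "closed_span S \<in> closed_subspaces" for S :: "'a set"
    unfolding closed_subspaces_def using subspace_closed_span closed_closed_span by blast
  then show "(\<lambda>\<alpha>. closed_span (range (f \<alpha>))) \<in> space borel \<rightarrow> closed_subspaces" by blast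
  fix B assume "B \<in> {{F \<in> closed_subspaces. F \<inter> U \<noteq> {}} |U. open (U :: 'a set)}"
  then obtain U where U: "open U" and B: "B = {F \<in> closed_subspaces. F \<inter> U \<noteq> {}}" by blast
  have "open {\<alpha>. closed_span (range (f \<alpha>)) \<inter> U \<noteq> {}}"
  proof (subst open_subopen, intro ballI)
    fix \<alpha> assume "\<alpha> \<in> {\<alpha>. closed_span (range (f \<alpha>)) \<inter> U \<noteq> {}}"
    then have "U \<inter> closure (span (range (f \<alpha>))) \<noteq> {}" unfolding closed_span_def by blast
    then have "U \<inter> span (range (f \<alpha>)) \<noteq> {}" using open_Int_closure_eq_empty[OF U] by blast
    then obtain a n where x: "(\<Sum>i<n::nat. a i *\<^sub>R f \<alpha> i) \<in> U" unfolding span_range_eq by blast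
    define M where "M = (\<Sum>i<n. m i)"
    have "closed_span (range (f \<beta>)) \<inter> U \<noteq> {}" if \<beta>: "\<forall>k<M. \<beta> k = \<alpha> k" for \<beta>
    proof -
      have "f \<beta> i = f \<alpha> i" if "i < n" for i
      proof (rule dep)
        fix k assume "k < m i"
        moreover have "m i \<le> M" unfolding M_def using that by (intro member_le_sum) auto
        ultimately show "\<beta> k = \<alpha> k" using \<beta> by simp
      qed
      then have "(\<Sum>i<n. a i *\<^sub>R f \<beta> i) = (\<Sum>i<n. a i *\<^sub>R f \<alpha> i)" by (intro sum.cong) auto
      moreover have "(\<Sum>i<n. a i *\<^sub>R f \<beta> i) \<in> span (range (f \<beta>))"
        by (intro span_sum span_scale span_base) simp
      ultimately have "(\<Sum>i<n. a i *\<^sub>R f \<alpha> i) \<in> closed_span (range (f \<beta>))"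
        using span_le_closed_span[of "range (f \<beta>)"] by (simp add: subset_iff)
      then show ?thesis using x by blast
    qed
    then have "{\<beta>. \<forall>k<M. \<beta> k = \<alpha> k} \<subseteq> {\<alpha>. closed_span (range (f \<alpha>)) \<inter> U \<noteq> {}}" by blast
    then show "\<exists>T. open T \<and> \<alpha> \<in> T \<and> T \<subseteq> {\<alpha>. closed_span (range (f \<alpha>)) \<inter> U \<noteq> {}}"
      using open_agree_below[of M \<alpha>] by (intro exI[of _ "{\<beta>. \<forall>k<M. \<beta> k = \<alpha> k}"]) simp
  qed
  moreover have "(\<lambda>\<alpha>. closed_span (range (f \<alpha>))) -` B \<inter> space borel
      = {\<alpha>. closed_span (range (f \<alpha>)) \<inter> U \<noteq> {}}"
    unfolding B using cs by auto
  ultimately show "(\<lambda>\<alpha>. closed_span (range (f \<alpha>))) -` B \<inter> space borel \<in> sets borel" by simp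
qed

section \<open>Reducing eventual agreement to a meager isomorphism relation\<close>

definition list_limit :: "(nat \<Rightarrow> 'a list) \<Rightarrow> nat \<Rightarrow> 'a" where
  "list_limit p i = p (Suc i) ! i"

lemma increasing_lists:
  assumes "\<And>n. \<exists>t. t \<noteq> [] \<and> p (Suc n) = p n @ t"
  shows "n \<le> length (p n)" "i < length (p n) \<Longrightarrow> list_limit p i = p n ! i"
proof -
  show len: "n \<le> length (p n)" for n
  proof (induction n)
    case (Suc n)
    obtain t where "t \<noteq> []" "p (Suc n) = p n @ t" using assms[of n] by blast
    then show ?case using Suc by (cases t) auto
  qed simp
  have pre: "i < length (p n) \<Longrightarrow> p (n + k) ! i = p n ! i \<and> i < length (p (n + k))" for i n k
  proof (induction k)
    case (Suc k)
    obtain t where "p (Suc (n + k)) = p (n + k) @ t" using assms[of "n + k"] by blast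
    then show ?case using Suc by (simp add: nth_append)
  qed simp
  assume i: "i < length (p n)"
  have i': "i < length (p (Suc i))" using len[of "Suc i"] by simp
  show "list_limit p i = p n ! i"
    using pre[OF i, of "Suc i - n"] pre[OF i', of "n - Suc i"] unfolding list_limit_def
    by (cases "n \<le> Suc i") simp_all
qed

context schauder begin

lemma list_limit_in_cyl:
  assumes inc: "\<And>n. \<exists>t. t \<noteq> [] \<and> p (Suc n) = p n @ t" and fb: "\<And>n. fblock (p n)"
  shows "list_limit p \<in> cyl (p n)"
proof -
  note lim = increasing_lists[of p, OF inc]
  have "list_limit p i \<in> net_vectors" for i
  proof -
    have i: "i < length (p (Suc i))" using lim(1)[of "Suc i"] by simp
    show ?thesis
      using fb[of "Suc i"] nth_mem[OF i] unfolding list_limit_def fblock_def by blast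
  qed
  moreover have "prec (list_limit p i) (list_limit p (Suc i))" for i
  proof -
    have i: "Suc i < length (p (Suc (Suc i)))" using lim(1)[of "Suc (Suc i)"] by simp
    then have "prec (p (Suc (Suc i)) ! i) (p (Suc (Suc i)) ! Suc i)"
      using fblock_sorted[OF fb] by (intro sorted_wrt_nth_less) auto
    then show ?thesis
      using lim(2)[of i "Suc (Suc i)"] lim(2)[of "Suc i" "Suc (Suc i)"] i by simp
  qed
  ultimately have "list_limit p \<in> net_seqs" unfolding net_seqs_def by blast
  then show ?thesis unfolding cyl_def using lim(2) by blast
qed

definition iso_pairs :: "((nat \<Rightarrow> 'a) \<times> (nat \<Rightarrow> 'a)) set" where
  "iso_pairs = {(y, z) \<in> net_seqs \<times> net_seqs. isomorphic_subspaces (closed_span (range y)) (closed_span (range z))}"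

lemma fblock_snoc_net_point:
  assumes "fblock q" "\<forall>x\<in>set q. hi x \<le> M"
  shows "fblock (q @ [net_point (Suc M)])"
proof (cases "q = []")
  case False
  then show ?thesis
    unfolding fblock_append prec_def using assms fblock_net_point net_point(2) last_in_set[OF False]
    by (simp add: less_Suc_eq_le)
qed (simp add: fblock_net_point)

lemma finite_blocks_bounded:
  assumes "finite P"
  shows "\<exists>M. \<forall>q\<in>P. \<forall>x\<in>set q. hi x \<le> M"
proof -
  have "finite (\<Union>q\<in>P. hi ` set q)" using assms by simp
  then obtain M where "\<forall>k\<in>(\<Union>q\<in>P. hi ` set q). k \<le> M"
    using finite_nat_set_iff_bounded_le by blast
  then show ?thesis by blast
qed

text \<open>Equal lengths keep later terms at the same positions, so that eventually equal choices give eventually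
equal sequences.\<close>

definition separating :: "((nat \<Rightarrow> 'a) \<times> (nat \<Rightarrow> 'a)) set \<Rightarrow> 'a list set \<Rightarrow> 'a list \<Rightarrow> 'a list \<Rightarrow> bool" where
  "separating C P s0 s1 \<longleftrightarrow> s0 \<noteq> [] \<and> s1 \<noteq> [] \<and> length s0 = length s1 \<and>
     (\<forall>q\<in>P. fblock (q @ s0) \<and> fblock (q @ s1)) \<and>
     (\<forall>q\<in>P. \<forall>r\<in>P. cyl (q @ s0) \<times> cyl (r @ s1) \<inter> C = {})"

lemma ex_separating:
  assumes "finite P" "\<And>q. q \<in> P \<Longrightarrow> fblock q" "nowhere_dense boxes C"
  shows "\<exists>s0 s1. separating C P s0 s1"
proof -
  obtain M where M: "\<And>q x. q \<in> P \<Longrightarrow> x \<in> set q \<Longrightarrow> hi x \<le> M"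
    using finite_blocks_bounded[OF assms(1)] by blast
  let ?a = "[net_point (Suc M)]"
  have a: "fblock (q @ ?a)" if "q \<in> P" for q
    using fblock_snoc_net_point assms(2) M that by blast
  have "\<exists>a' b'. fblock (?a @ a') \<and> fblock (?a @ b') \<and>
    (\<forall>(q, r)\<in>P \<times> P. cyl (q @ ?a @ a') \<times> cyl (r @ ?a @ b') \<inter> C = {})"
    by (rule nowhere_dense_extend_simultaneously[OF _ assms(3)]) (use assms(1) a fblock_net_point in auto)
  then obtain a' b' where ab: "fblock (?a @ a')" "fblock (?a @ b')"
    "\<And>q r. q \<in> P \<Longrightarrow> r \<in> P \<Longrightarrow> cyl (q @ ?a @ a') \<times> cyl (r @ ?a @ b') \<inter> C = {}"
    by blast
  define n where "n = max (length (?a @ a')) (length (?a @ b'))"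
  obtain a2 where a2: "fblock ((?a @ a') @ a2)" "length ((?a @ a') @ a2) = n"
    by (rule fblock_extend_to_length[OF ab(1), of n]) (simp add: n_def)
  obtain b2 where b2: "fblock ((?a @ b') @ b2)" "length ((?a @ b') @ b2) = n"
    by (rule fblock_extend_to_length[OF ab(2), of n]) (simp add: n_def)
  have ext: "fblock (q @ ?a @ w)" if "q \<in> P" "fblock (?a @ w)" for q w
    using a[OF that(1)] that(2) by (auto simp: fblock_append[of q])
  have "separating C P ((?a @ a') @ a2) ((?a @ b') @ b2)"
    unfolding separating_def
  proof (intro conjI ballI)
    show "length ((?a @ a') @ a2) = length ((?a @ b') @ b2)" using a2(2) b2(2) by simp
    fix q assume q: "q \<in> P"
    show "fblock (q @ (?a @ a') @ a2)" using ext[OF q, of "a' @ a2"] a2(1) by simp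
    show "fblock (q @ (?a @ b') @ b2)" using ext[OF q, of "b' @ b2"] b2(1) by simp
    fix r assume r: "r \<in> P"
    have "cyl (q @ (?a @ a') @ a2) \<subseteq> cyl (q @ ?a @ a')" "cyl (r @ (?a @ b') @ b2) \<subseteq> cyl (r @ ?a @ b')"
      using cyl_append_subset[of "q @ ?a @ a'" a2] cyl_append_subset[of "r @ ?a @ b'" b2] by simp_all
    then show "cyl (q @ (?a @ a') @ a2) \<times> cyl (r @ (?a @ b') @ b2) \<inter> C = {}"
      using ab(3)[OF q r] by blast
  qed auto
  then show ?thesis by blast
qed

lemma meager_increasing:
  assumes "meager boxes A"
  obtains C where "\<And>n. nowhere_dense boxes (C n)" "\<And>i j. i \<le> j \<Longrightarrow> C i \<subseteq> C j" "A \<subseteq> (\<Union>n::nat. C n)"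
proof -
  obtain C where C: "\<And>n. nowhere_dense boxes (C n)" "A \<subseteq> (\<Union>n::nat. C n)"
    using assms unfolding meager_def by blast
  define C' where "C' n = (\<Union>i\<in>{..n}. C i)" for n :: nat
  have "nowhere_dense boxes (C' n)" for n
  proof (induction n)
    case 0
    then show ?case using C(1) by (simp add: C'_def)
  next
    case (Suc n)
    have "C' (Suc n) = C (Suc n) \<union> C' n" by (simp add: C'_def atMost_Suc)
    then show ?case using Suc C(1) by (simp add: nowhere_dense_Un)
  qed
  moreover have "C' i \<subseteq> C' j" if "i \<le> j" for i j
    unfolding C'_def using that by (intro UN_mono) auto
  moreover have "A \<subseteq> (\<Union>n. C' n)" using C(2) unfolding C'_def by blast
  ultimately show thesis by (rule that)
qed

text \<open>The set \<open>P n\<close> contains all initial segments obtained from the first \<open>n\<close> choices, and the blocks \<open>s n False\<close> and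
\<open>s n True\<close> separate it from the \<open>n\<close>-th nowhere dense set. These sets increase, so a pair in \<open>iso_pairs\<close> can only
be avoided by finitely many of them. Avoiding happens for a pair in one order when the first sequence
chooses \<open>False\<close> and the second one \<open>True\<close>; the opposite choice is covered by symmetry of isomorphism.\<close>

theorem ergodic_if_meager:
  assumes "meager boxes iso_pairs"
  shows "ergodic TYPE('a)"
proof -
  obtain C where C: "\<And>n. nowhere_dense boxes (C n)" "\<And>i j. i \<le> j \<Longrightarrow> C i \<subseteq> C j" "iso_pairs \<subseteq> (\<Union>n::nat. C n)"
    using meager_increasing[OF assms] by blast
  define branches where "branches P s0 s1 = (\<lambda>q. q @ s0) ` P \<union> (\<lambda>q. q @ s1) ` P" for P and s0 s1 :: "'a list"
  have "\<exists>\<sigma>. \<forall>n. (finite (fst (\<sigma> n)) \<and> (\<forall>q\<in>fst (\<sigma> n). fblock q) \<and> [] \<in> (if n = 0 then fst (\<sigma> n) else {[]}) \<and>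
      separating (C n) (fst (\<sigma> n)) (fst (snd (\<sigma> n))) (snd (snd (\<sigma> n)))) \<and>
      fst (\<sigma> (Suc n)) = branches (fst (\<sigma> n)) (fst (snd (\<sigma> n))) (snd (snd (\<sigma> n)))"
  proof (rule dependent_nat_choice)
    obtain s0 s1 where "separating (C 0) {[]} s0 s1"
      using ex_separating[of "{[]}" "C 0"] C(1) fblock_Nil by auto
    then show "\<exists>x. finite (fst x) \<and> (\<forall>q\<in>fst x. fblock q) \<and> [] \<in> (if 0 = (0::nat) then fst x else {[]}) \<and>
        separating (C 0) (fst x) (fst (snd x)) (snd (snd x))"
      by (intro exI[of _ "({[]}, s0, s1)"]) (simp add: fblock_Nil)
  next
    fix x n assume x: "finite (fst x) \<and> (\<forall>q\<in>fst x. fblock q) \<and> [] \<in> (if n = (0::nat) then fst x else {[]}) \<and>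
        separating (C n) (fst x) (fst (snd x)) (snd (snd x))"
    define P where "P = branches (fst x) (fst (snd x)) (snd (snd x))"
    have P: "finite P" "\<And>q. q \<in> P \<Longrightarrow> fblock q"
      using x unfolding P_def branches_def separating_def by auto
    then obtain s0 s1 where "separating (C (Suc n)) P s0 s1" using ex_separating C(1) by blast
    then show "\<exists>y. (finite (fst y) \<and> (\<forall>q\<in>fst y. fblock q) \<and> [] \<in> (if Suc n = 0 then fst y else {[]}) \<and>
        separating (C (Suc n)) (fst y) (fst (snd y)) (snd (snd y))) \<and>
        fst y = branches (fst x) (fst (snd x)) (snd (snd x))"
      using P by (intro exI[of _ "(P, s0, s1)"]) (simp add: P_def)
  qed
  then obtain \<sigma> where \<sigma>: "\<And>n. (\<forall>q\<in>fst (\<sigma> n). fblock q) \<and> [] \<in> (if n = 0 then fst (\<sigma> n) else {[]}) \<and>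
      separating (C n) (fst (\<sigma> n)) (fst (snd (\<sigma> n))) (snd (snd (\<sigma> n)))"
      "\<And>n. fst (\<sigma> (Suc n)) = branches (fst (\<sigma> n)) (fst (snd (\<sigma> n))) (snd (snd (\<sigma> n)))"
    by metis
  define P where "P n = fst (\<sigma> n)" for n
  define s where "s n b = (if b then snd (snd (\<sigma> n)) else fst (snd (\<sigma> n)))" for n b
  have sep: "separating (C n) (P n) (s n False) (s n True)" for n
    using \<sigma>(1)[of n] unfolding P_def s_def by simp
  have P0: "[] \<in> P 0" using \<sigma>(1)[of 0] unfolding P_def by simp
  have PS: "q @ s n b \<in> P (Suc n)" if "q \<in> P n" for q n b
    using that \<sigma>(2)[of n] unfolding P_def s_def branches_def by (cases b) auto
  have Pf: "fblock q" if "q \<in> P n" for q n using \<sigma>(1)[of n] that unfolding P_def by blast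
  have s_ne: "s n b \<noteq> []" and s_len: "length (s n b) = length (s n False)" for n b
    using sep[of n] unfolding separating_def by (cases b; simp)+
  define pre where "pre \<alpha> n = concat (map (\<lambda>k. s k (\<alpha> k)) [0..<n])" for \<alpha> n
  have preS: "pre \<alpha> (Suc n) = pre \<alpha> n @ s n (\<alpha> n)" for \<alpha> n by (simp add: pre_def)
  have preP: "pre \<alpha> n \<in> P n" for \<alpha> n
  proof (induction n)
    case 0
    then show ?case using P0 by (simp add: pre_def)
  next
    case (Suc n)
    then show ?case unfolding preS by (rule PS)
  qed
  have pre_inc: "\<exists>t. t \<noteq> [] \<and> pre \<alpha> (Suc n) = pre \<alpha> n @ t" for \<alpha> n
    unfolding preS using s_ne by blast
  have pre_dep: "pre \<beta> n = pre \<alpha> n" if "\<And>k. k < n \<Longrightarrow> \<beta> k = \<alpha> k" for \<alpha> \<beta> n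
  proof -
    have "map (\<lambda>k. s k (\<beta> k)) [0..<n] = map (\<lambda>k. s k (\<alpha> k)) [0..<n]"
      by (rule map_cong) (simp_all add: that)
    then show ?thesis unfolding pre_def by (rule arg_cong)
  qed
  have pre_len: "length (pre \<alpha> n) = length (pre \<beta> n)" for \<alpha> \<beta> n
  proof (induction n)
    case (Suc n)
    then show ?case using s_len[of n "\<alpha> n"] s_len[of n "\<beta> n"] by (simp add: preS)
  qed (simp add: pre_def)
  define y where "y \<alpha> = list_limit (pre \<alpha>)" for \<alpha>
  have y_cyl: "y \<alpha> \<in> cyl (pre \<alpha> n)" for \<alpha> n
    unfolding y_def by (intro list_limit_in_cyl pre_inc Pf[OF preP])
  have y_Y: "y \<alpha> \<in> net_seqs" for \<alpha> using y_cyl cyl_subset_net_seqs by blast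
  define f where "f \<alpha> = closed_span (range (y \<alpha>))" for \<alpha>
  have "f \<in> borel \<rightarrow>\<^sub>M effros_borel"
    unfolding f_def
  proof (rule measurable_closed_span[of Suc])
    fix i and \<alpha> \<beta> :: "nat \<Rightarrow> bool" assume "\<And>k. k < Suc i \<Longrightarrow> \<beta> k = \<alpha> k"
    then show "y \<beta> i = y \<alpha> i" unfolding y_def list_limit_def using pre_dep[of "Suc i" \<beta> \<alpha>] by simp
  qed
  moreover have "E0 \<alpha> \<beta> \<longleftrightarrow> isomorphic_subspaces (f \<alpha>) (f \<beta>)" for \<alpha> \<beta>
  proof
    assume "E0 \<alpha> \<beta>"
    then obtain n where n: "\<And>m. m \<ge> n \<Longrightarrow> \<alpha> m = \<beta> m" unfolding E0_def by blast
    define L where "L = length (pre \<alpha> n)"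
    have "y \<alpha> i = y \<beta> i" if "i \<ge> L" for i
    proof -
      define m where "m = max n (Suc i)"
      have split: "pre \<gamma> m = pre \<gamma> n @ concat (map (\<lambda>k. s k (\<gamma> k)) [n..<m])" for \<gamma>
      proof -
        have "[0..<m] = [0..<n] @ [n..<m]" using upt_add_eq_append[of 0 n "m - n"] by (simp add: m_def)
        then show ?thesis unfolding pre_def by simp
      qed
      have tails: "concat (map (\<lambda>k. s k (\<alpha> k)) [n..<m]) = concat (map (\<lambda>k. s k (\<beta> k)) [n..<m])"
      proof -
        have "map (\<lambda>k. s k (\<alpha> k)) [n..<m] = map (\<lambda>k. s k (\<beta> k)) [n..<m]"
          by (rule map_cong) (simp_all add: n)
        then show ?thesis by (rule arg_cong)
      qed
      have "i < length (pre \<gamma> m)" for \<gamma>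
        using increasing_lists(1)[of "pre \<gamma>" m, OF pre_inc] by (simp add: m_def)
      then have "y \<gamma> i = pre \<gamma> m ! i" for \<gamma>
        unfolding y_def by (intro increasing_lists(2) pre_inc)
      then show ?thesis
        using that pre_len[of \<alpha> n \<beta>] tails unfolding split L_def by (simp add: nth_append)
    qed
    from equi_imp_lin_iso[OF equi_of_finite_change[OF net_seqs_block_seq net_seqs_block_seq this]]
    have "lin_iso (4 * basis_const * real L + 1) (f \<alpha>) (f \<beta>)"
      unfolding f_def using y_Y basis_const_ge_1 by simp
    then show "isomorphic_subspaces (f \<alpha>) (f \<beta>)"
      by (rule lin_iso_imp_isomorphic) (use basis_const_ge_1 in simp)
  next
    assume iso: "isomorphic_subspaces (f \<alpha>) (f \<beta>)"
    then obtain K :: nat where "lin_iso (real K) (f \<alpha>) (f \<beta>)"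
      by (rule isomorphic_imp_lin_iso) (simp_all add: f_def subspace_closed_span)
    then have iso': "isomorphic_subspaces (f \<beta>) (f \<alpha>)"
      by (rule lin_iso_imp_isomorphic[OF lin_iso_sym]) simp
    have fin: "finite {k. \<not> \<gamma> k \<and> \<delta> k}" if "isomorphic_subspaces (f \<gamma>) (f \<delta>)" for \<gamma> \<delta>
    proof -
      have "(y \<gamma>, y \<delta>) \<in> iso_pairs" using that y_Y unfolding iso_pairs_def f_def by simp
      then obtain j where j: "(y \<gamma>, y \<delta>) \<in> C j" using C(3) by blast
      have "k < j" if k: "\<not> \<gamma> k" "\<delta> k" for k
      proof (rule ccontr)
        assume "\<not> k < j"
        then have "(y \<gamma>, y \<delta>) \<in> C k" using C(2)[of j k] j by auto
        moreover have "y \<gamma> \<in> cyl (pre \<gamma> k @ s k False)" "y \<delta> \<in> cyl (pre \<delta> k @ s k True)"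
          using y_cyl[of \<gamma> "Suc k"] y_cyl[of \<delta> "Suc k"] k by (simp_all add: preS)
        moreover have "cyl (pre \<gamma> k @ s k False) \<times> cyl (pre \<delta> k @ s k True) \<inter> C k = {}"
          using sep[of k] preP unfolding separating_def by blast
        ultimately show False by blast
      qed
      then have "{k. \<not> \<gamma> k \<and> \<delta> k} \<subseteq> {..<j}" by blast
      then show ?thesis by (rule finite_subset) simp
    qed
    have "finite ({k. \<not> \<alpha> k \<and> \<beta> k} \<union> {k. \<not> \<beta> k \<and> \<alpha> k})"
      using fin[OF iso] fin[OF iso'] by simp
    then obtain n where n: "\<forall>k\<in>{k. \<not> \<alpha> k \<and> \<beta> k} \<union> {k. \<not> \<beta> k \<and> \<alpha> k}. k < n"
      using finite_nat_set_iff_bounded by blast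
    have "\<alpha> m = \<beta> m" if "m \<ge> n" for m
    proof -
      have "\<not> m < n" using that by simp
      then have "m \<notin> {k. \<not> \<alpha> k \<and> \<beta> k} \<union> {k. \<not> \<beta> k \<and> \<alpha> k}"
        using n by blast
      then show ?thesis by blast
    qed
    then show "E0 \<alpha> \<beta>" unfolding E0_def by blast
  qed
  ultimately show ?thesis unfolding ergodic_def by blast
qed

section \<open>Uniform isomorphism from a non-meager isomorphism relation\<close>

lemma fblock_lo_hd: "fblock x \<Longrightarrow> y \<in> set x \<Longrightarrow> lo (hd x) \<le> lo y"
proof -
  assume x: "fblock x" "y \<in> set x"
  obtain h t where ht: "x = h # t" using x(2) by (cases x) simp_all
  show ?thesis
  proof (cases "y = h")
    case False
    then have "prec h y" using fblock_sorted[OF x(1)] x(2) ht by auto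
    moreover have "unit_block h" using x(1) net_vectors_unit unfolding fblock_def ht by simp
    ultimately show ?thesis using lo_le_hi[of h] ht unfolding prec_def by simp
  qed (simp add: ht)
qed

text \<open>A branch continuing any initial segment below \<open>x\<close> by \<open>x\<close> is, together with a branch
through \<open>t\<close>, outside of \<open>C\<close>.\<close>

definition shield :: "((nat \<Rightarrow> 'a) \<times> (nat \<Rightarrow> 'a)) set \<Rightarrow> 'a list \<Rightarrow> 'a list \<Rightarrow> bool" where
  "shield C x t \<longleftrightarrow> fblock x \<and> x \<noteq> [] \<and> fblock t \<and>
     (\<forall>q. fblock q \<and> (\<forall>u\<in>set q. hi u < lo (hd x)) \<longrightarrow> cyl (q @ x) \<times> cyl t \<inter> C = {})"

text \<open>The first term of \<open>x\<close> is supported exactly at \<open>Suc M\<close>, so the initial segments below \<open>x\<close> are those with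
supports in \<open>{..M}\<close>, which are finite in number.\<close>

lemma ex_shield:
  assumes "nowhere_dense boxes C" "fblock t"
  obtains x t' where "shield C x (t @ t')" "t' \<noteq> []" "lo (hd x) = Suc M"
proof -
  obtain M' where M': "\<And>x. x \<in> set t \<Longrightarrow> hi x \<le> M'"
    using finite_blocks_bounded[of "{t}"] by auto
  let ?a = "[net_point (Suc M)]" and ?b = "[net_point (Suc M')]"
  define Q where "Q = {q. fblock q \<and> (\<forall>u\<in>set q. hi u \<le> M)}"
  have "\<exists>a' b'. fblock (?a @ a') \<and> fblock (?b @ b') \<and>
    (\<forall>(q, r)\<in>Q \<times> {t}. cyl (q @ ?a @ a') \<times> cyl (r @ ?b @ b') \<inter> C = {})"
  proof (rule nowhere_dense_extend_simultaneously[OF _ assms(1)])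
    show "finite (Q \<times> {t})" unfolding Q_def using finite_fblock_below by simp
    fix q r assume "(q, r) \<in> Q \<times> {t}"
    then show "fblock (q @ ?a) \<and> fblock (r @ ?b)"
      using fblock_snoc_net_point assms(2) M' unfolding Q_def by blast
  qed (use fblock_net_point in auto)
  then obtain a' b' where ab: "fblock (?a @ a')" "fblock (?b @ b')"
    "\<And>q. q \<in> Q \<Longrightarrow> cyl (q @ ?a @ a') \<times> cyl (t @ ?b @ b') \<inter> C = {}" by blast
  have "fblock (t @ ?b)" using fblock_snoc_net_point[OF assms(2)] M' by blast
  then have "fblock (t @ ?b @ b')" using ab(2) by (auto simp: fblock_append[of t])
  then have "shield C (?a @ a') (t @ ?b @ b')"
    unfolding shield_def using ab(1,3) by (auto simp: Q_def net_point(2) less_Suc_eq_le)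
  then show thesis by (rule that) (simp_all add: net_point(2))
qed

text \<open>The difference of the \<open>L\<close>-th and the \<open>k\<close>-th basis projection fixes \<open>f\<close> and kills \<open>x\<close>.\<close>

lemma closed_span_independent_of_units:
  assumes kL: "k \<le> L" and f: "f \<in> span (unit_e ` {k..<L})" and x: "x \<in> closed_span S"
    and S: "\<And>v. v \<in> S \<Longrightarrow> unit_block v \<and> (hi v < k \<or> L \<le> lo v)"
  shows "norm f \<le> 2 * basis_const * norm (f + x)"
proof -
  define R where "R v = proj L v - proj k v" for v
  have lin: "linear R" unfolding R_def by (intro linear_compose_sub linear_proj)
  have bnd: "norm (R v) \<le> 2 * basis_const * norm v" for v
    using norm_triangle_ineq4[of "proj L v" "proj k v"] norm_proj_le[of L v] norm_proj_le[of k v]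
    unfolding R_def by linarith
  have bl: "bounded_linear R"
    using linear_add[OF lin] linear_cmul[OF lin] bnd
    by (intro bounded_linear_intro[of R "2 * basis_const"]) (simp_all add: mult.commute)
  have "R x = 0"
  proof -
    have "closed_span S \<subseteq> {v. R v = 0}"
    proof (rule closed_span_minimal)
      show "subspace {v. R v = 0}" by (rule linear_subspace_kernel[OF lin])
      show "closed {v. R v = 0}"
        by (intro closed_Collect_eq continuous_intros linear_continuous_on bl)
      show "S \<subseteq> {v. R v = 0}"
      proof
        fix v assume "v \<in> S"
        then have v: "unit_block v" "hi v < k \<or> L \<le> lo v" using S by auto
        show "v \<in> {v. R v = 0}"
        proof (cases "hi v < k")
          case True
          then have "proj k v = v" "proj L v = v"
            using kL by (auto intro!: proj_eq_self_block[OF v(1)])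
          then show ?thesis unfolding R_def by simp
        next
          case False
          then have "proj k v = 0" "proj L v = 0"
            using kL v(2) by (auto intro!: proj_eq_0[OF v(1)])
          then show ?thesis unfolding R_def by simp
        qed
      qed
    qed
    then show ?thesis using x by blast
  qed
  have "R f = f"
  proof -
    have "span (unit_e ` {k..<L}) \<subseteq> {v. R v - v = 0}"
    proof (rule span_minimal)
      show "subspace {v. R v - v = 0}"
        by (rule linear_subspace_kernel) (intro linear_compose_sub lin linear_ident)
      show "unit_e ` {k..<L} \<subseteq> {v. R v - v = 0}"
      proof
        fix v assume "v \<in> unit_e ` {k..<L}"
        then obtain i where i: "v = unit_e i" "k \<le> i" "i < L" by auto
        have "proj L v = v" "proj k v = 0"
          unfolding i(1) using i(2,3) by (auto intro!: proj_eq_self_block proj_eq_0 unit_block_unit_e simp: supp_unit_e)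
        then show "v \<in> {v. R v - v = 0}" unfolding R_def by simp
      qed
    qed
    then show ?thesis using f by auto
  qed
  then have "f = R (f + x)" using \<open>R x = 0\<close> linear_add[OF lin] by simp
  then show ?thesis using bnd[of "f + x"] by simp
qed


lemma lo_hd_ge:
  assumes "\<And>n. fblock (x n)" "\<And>n. x n \<noteq> []" "\<And>n u. u \<in> set (x n) \<Longrightarrow> hi u < lo (hd (x (Suc n)))"
  shows "n \<le> lo (hd (x n))"
proof (induction n)
  case (Suc n)
  have h: "hd (x n) \<in> set (x n)" using assms(2) by simp
  then have "unit_block (hd (x n))" using assms(1)[of n] net_vectors_unit unfolding fblock_def by blast
  then show ?case using Suc assms(3)[OF h] lo_le_hi by fastforce
qed simp

text \<open>A block \<open>x n\<close> with \<open>n\<close> larger than the first index of \<open>y L\<close> can only occur in \<open>y\<close> after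
position \<open>L\<close>.\<close>

lemma passes_through_tail:
  assumes y: "block_seq e y" and x: "\<And>n. x n \<noteq> []" "\<And>n. n \<le> lo (hd (x n))"
    and inf: "infinite {n. passes_through y (x n)}"
    and z: "\<And>i. i \<ge> L \<Longrightarrow> z (k + (i - L)) = y i"
  shows "infinite {n. passes_through z (x n)}"
proof -
  have "{n. passes_through y (x n)} - {..lo (y L)} \<subseteq> {n. passes_through z (x n)}"
  proof
    fix n assume n: "n \<in> {n. passes_through y (x n)} - {..lo (y L)}"
    then obtain m where m: "\<And>i. i < length (x n) \<Longrightarrow> y (m + i) = x n ! i"
      unfolding passes_through_def by blast
    have "y m = hd (x n)" using m[of 0] x(1)[of n] by (simp add: hd_conv_nth)
    then have "lo (y L) < lo (y m)" using n x(2)[of n] by simp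
    then have "L \<le> m"
      using block_seq_less[OF y, of m L] lo_le_hi[OF block_seq_unit[OF y], of m] by fastforce
    then have "z ((k + (m - L)) + i) = x n ! i" if "i < length (x n)" for i
      using z[of "m + i"] m[OF that] by (simp add: add.assoc)
    then show "n \<in> {n. passes_through z (x n)}" unfolding passes_through_def by blast
  qed
  moreover have "infinite ({n. passes_through y (x n)} - {..lo (y L)})" using inf by simp
  ultimately show ?thesis using infinite_super by blast
qed

text \<open>Before passing through \<open>x n\<close>, the branch is an initial segment below \<open>x n\<close>, so \<open>x n\<close> keeps the pair out
of \<open>C n\<close>. This happens for arbitrarily large \<open>n\<close>, and the sets \<open>C n\<close> increase.\<close>

lemma iso_code_if_passing:
  assumes x: "\<And>n. shield (C n) (x n) (t n)" and inc: "\<And>i j. i \<le> j \<Longrightarrow> C i \<subseteq> C j"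
    and z: "\<And>n. z \<in> cyl (t n)" and y: "y \<in> net_seqs" "infinite {n. passes_through y (x n)}"
  shows "(y, z) \<notin> (\<Union>n::nat. C n)"
proof
  assume "(y, z) \<in> (\<Union>n. C n)"
  then obtain j where j: "(y, z) \<in> C j" by blast
  obtain n where n: "n \<ge> j" "passes_through y (x n)"
    using y(2) unfolding infinite_nat_iff_unbounded_le by blast
  then obtain m where m: "\<And>i. i < length (x n) \<Longrightarrow> y (m + i) = x n ! i"
    unfolding passes_through_def by blast
  define q where "q = map y [0..<m]"
  have xn: "x n \<noteq> []" "fblock (x n)" using x[of n] unfolding shield_def by auto
  have q: "fblock q" unfolding q_def by (rule fblock_prefix[OF y(1)])
  have "y m = hd (x n)" using m[of 0] xn(1) by (simp add: hd_conv_nth)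
  then have "\<forall>u\<in>set q. hi u < lo (hd (x n))"
    using block_seq_less[OF net_seqs_block_seq[OF y(1)], of _ m] unfolding q_def by auto
  then have "cyl (q @ x n) \<times> cyl (t n) \<inter> C n = {}"
    using x[of n] q unfolding shield_def by blast
  moreover have "y \<in> cyl (q @ x n)"
    unfolding cyl_def
  proof (intro CollectI conjI y(1) allI impI)
    fix i assume i: "i < length (q @ x n)"
    show "y i = (q @ x n) ! i"
      using m[of "i - m"] i by (cases "i < m") (simp_all add: q_def nth_append)
  qed
  moreover have "(y, z) \<in> C n" using inc[OF n(1)] j by blast
  ultimately show False using z[of n] by blast
qed

text \<open>The first \<open>L\<close> terms of \<open>y\<close> are removed and \<open>p\<close> is put in front of the rest.\<close>

definition replaced :: "'a list \<Rightarrow> nat \<Rightarrow> (nat \<Rightarrow> 'a) \<Rightarrow> nat \<Rightarrow> 'a" where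
  "replaced p L y i = (if i < length p then p ! i else y (L + (i - length p)))"

lemma replaced_block_seq:
  assumes y: "block_seq e y" and p: "\<And>i. i < length p \<Longrightarrow> unit_block (p ! i) \<and> hi (p ! i) < L"
    "\<And>i. Suc i < length p \<Longrightarrow> prec (p ! i) (p ! Suc i)"
  shows "block_seq e (replaced p L y)"
  unfolding block_seq_iff
proof (intro conjI allI)
  show "unit_block (replaced p L y i)" for i
    unfolding replaced_def using p(1) block_seq_unit[OF y] by simp
  show "prec (replaced p L y i) (replaced p L y (Suc i))" for i
  proof -
    consider "Suc i < length p" | "Suc i = length p" | "length p \<le> i" by linarith
    then show ?thesis
    proof cases
      case 1
      then show ?thesis unfolding replaced_def using p(2) by simp
    next
      case 2
      then have "hi (p ! i) < lo (y L)" using p(1)[of i] block_seq_lo_ge[OF y, of L] by simp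
      then show ?thesis using 2 unfolding replaced_def prec_def by simp
    next
      case 3
      then show ?thesis
        using block_seq_less[OF y, of "L + (i - length p)" "L + (Suc i - length p)"]
        unfolding replaced_def prec_def by simp
    qed
  qed
qed

text \<open>Replacing removes \<open>L\<close> terms and inserts only \<open>length p\<close> of them, so a finite change alone does not lead back
to \<open>y\<close> unless these numbers agree. First \<open>p\<close> is
exchanged for as many normalized basis vectors, \<open>k\<close> in number; then the missing basis vectors
with indices in \<open>{k..<L}\<close> are added on both sides; finally these \<open>L\<close> basis vectors are exchanged for the
first \<open>L\<close> terms of the sequence. No constant involved depends on \<open>y\<close> or \<open>z\<close>.\<close>

theorem lin_iso_of_replaced:
  assumes y: "block_seq e y" and z: "block_seq e z" and p: "fblock p"
    and L: "length p \<le> L" "\<And>u. u \<in> set p \<Longrightarrow> hi u < L"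
    and iso: "lin_iso K (closed_span (range (replaced p L y))) (closed_span (range (replaced p L z)))"
    and K: "K \<ge> 0"
  defines "c \<equiv> 4 * basis_const * real L + 1"
  shows "lin_iso (c * ((2 * basis_const + (c * K * c) * (1 + 2 * basis_const)) * c))
           (closed_span (range y)) (closed_span (range z))"
proof -
  define k where "k = length p"
  define E where "E n = map unit_e [0..<n]" for n
  have c0: "c \<ge> 0" unfolding c_def using basis_const_ge_1 by simp
  have pn: "block_seq e (replaced p L w)" if "block_seq e w" for w
  proof (rule replaced_block_seq[OF that])
    show "unit_block (p ! i) \<and> hi (p ! i) < L" if "i < length p" for i
      using p L(2) nth_mem[OF that] net_vectors_unit unfolding fblock_def by blast
    show "prec (p ! i) (p ! Suc i)" if "Suc i < length p" for i
      using fblock_sorted[OF p] that by (simp add: sorted_wrt_nth_less)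
  qed
  have En: "block_seq e (replaced (E n) L w)" if "block_seq e w" "n \<le> L" for w n
    by (rule replaced_block_seq[OF that(1)])
      (use that(2) in \<open>simp_all add: E_def unit_block_unit_e supp_unit_e prec_def\<close>)
  have c_le: "4 * basis_const * real k + 1 \<le> c"
    unfolding c_def k_def using L(1) basis_const_ge_1 by (simp add: mult_left_mono)
  have 1: "lin_iso c (closed_span (range y')) (closed_span (range z'))"
    if "block_seq e y'" "block_seq e z'" "\<And>i. i \<ge> L \<Longrightarrow> y' i = z' i" for y' z'
    unfolding c_def using equi_imp_lin_iso[OF equi_of_finite_change[OF that]] basis_const_ge_1 by simp
  have 2: "lin_iso c (closed_span (range (replaced p L w))) (closed_span (range (replaced (E k) L w)))"
    if "block_seq e w" for w
    by (rule 1[OF pn En]) (use that L(1) in \<open>simp_all add: k_def replaced_def E_def\<close>)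
  have "lin_iso (c * K * c) (closed_span (range (replaced (E k) L y))) (closed_span (range (replaced (E k) L z)))"
    by (rule lin_iso_trans[OF lin_iso_trans[OF lin_iso_sym[OF 2[OF y]] iso] 2[OF z]])
      (use c0 K in auto)
  moreover have "norm f \<le> 2 * basis_const * norm (f + x)"
    if "f \<in> span (unit_e ` {k..<L})" "x \<in> closed_span (range (replaced (E k) L w))" "block_seq e w" for f x w
  proof (rule closed_span_independent_of_units[OF _ that(1,2)])
    show "k \<le> L" using L(1) by (simp add: k_def)
    fix v assume "v \<in> range (replaced (E k) L w)"
    then obtain i where i: "v = replaced (E k) L w i" by blast
    show "unit_block v \<and> (hi v < k \<or> L \<le> lo v)"
    proof (cases "i < k")
      case True
      then show ?thesis unfolding i by (simp add: replaced_def E_def unit_block_unit_e supp_unit_e)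
    next
      case False
      then have "v = w (L + (i - k))" unfolding i by (simp add: replaced_def E_def)
      then show ?thesis
        using block_seq_unit[OF that(3)] block_seq_lo_ge[OF that(3), of "L + (i - k)"] by simp
    qed
  qed
  ultimately have "lin_iso (2 * basis_const + (c * K * c) * (1 + 2 * basis_const))
      (closed_span (unit_e ` {k..<L} \<union> range (replaced (E k) L y)))
      (closed_span (unit_e ` {k..<L} \<union> range (replaced (E k) L z)))"
    using y z c0 K basis_const_ge_1 by (intro lin_iso_add_common) auto
  moreover have "unit_e ` {k..<L} \<union> range (replaced (E k) L w) = range (replaced (E L) L w)" for w
  proof -
    have "range (replaced (E n) L w) = unit_e ` {..<n} \<union> w ` {L..}" for n
    proof (intro equalityI subsetI)
      fix v assume "v \<in> range (replaced (E n) L w)"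
      then obtain i where "v = replaced (E n) L w i" by blast
      then show "v \<in> unit_e ` {..<n} \<union> w ` {L..}"
        by (cases "i < n") (auto simp: replaced_def E_def)
    next
      fix v assume "v \<in> unit_e ` {..<n} \<union> w ` {L..}"
      then consider i where "i < n" "v = unit_e i" | i where "i \<ge> L" "v = w i" by auto
      then show "v \<in> range (replaced (E n) L w)"
      proof cases
        case 1
        then have "v = replaced (E n) L w i" by (simp add: replaced_def E_def)
        then show ?thesis by blast
      next
        case 2
        then obtain j where "i = L + j" using le_Suc_ex by blast
        then have "v = replaced (E n) L w (n + j)" using 2 by (simp add: replaced_def E_def)
        then show ?thesis by blast
      qed
    qed
    moreover have "unit_e ` {k..<L} \<union> unit_e ` {..<k} = unit_e ` {..<L}"
      using L(1) unfolding image_Un[symmetric] by (intro arg_cong[of _ _ "image unit_e"]) (auto simp: k_def)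
    ultimately show ?thesis by (metis Un_assoc)
  qed
  ultimately have mid: "lin_iso (2 * basis_const + (c * K * c) * (1 + 2 * basis_const))
      (closed_span (range (replaced (E L) L y))) (closed_span (range (replaced (E L) L z)))"
    by simp
  have 3: "lin_iso c (closed_span (range w)) (closed_span (range (replaced (E L) L w)))"
    if "block_seq e w" for w
    by (rule 1[OF that En]) (use that in \<open>simp_all add: replaced_def E_def\<close>)
  have mid0: "0 \<le> 2 * basis_const + (c * K * c) * (1 + 2 * basis_const)"
    using c0 K basis_const_ge_1 by (intro add_nonneg_nonneg mult_nonneg_nonneg) auto
  show ?thesis
    by (rule lin_iso_trans[OF 3[OF y] lin_iso_trans[OF mid lin_iso_sym[OF 3[OF z]]]])
      (use c0 mid0 in auto)
qed

text \<open>Two arbitrary block-sequences through infinitely many blocks are moved to the net, compared with \<open>z\<close> after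
their beginnings are replaced by \<open>p\<close>, and restored by \<open>lin_iso_of_replaced\<close>.\<close>

theorem uniform_if_nonmeager:
  assumes "\<not> meager boxes iso_pairs"
  shows "\<exists>K\<ge>1. \<exists>xs :: nat \<Rightarrow> 'a list.
       (\<forall>n. finite_block_seq e (xs n)) \<and>
       (\<forall>n. successive e (xs n) (xs (Suc n))) \<and>
       (\<forall>y z. block_seq e y \<and> infinite {n. passes_through y (xs n)} \<and>
              block_seq e z \<and> infinite {n. passes_through z (xs n)} \<longrightarrow>
              K_isomorphic K (closed_span (range y)) (closed_span (range z)))"
proof -
  \<comment> \<open>The perturbation in \<open>iso_code_complete\<close> doubles the constant.\<close>
  define \<kappa> where "\<kappa> k = 2 * (real k + 1)" for k :: nat
  have \<kappa>0: "\<kappa> k \<ge> 0" for k by (simp add: \<kappa>_def)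
  have "iso_pairs \<subseteq> (\<Union>k. {p. \<exists>c. iso_code (\<kappa> k) p c} \<inter> \<Union>boxes)"
  proof
    fix p assume p: "p \<in> iso_pairs"
    obtain y z where yz: "p = (y, z)" by (cases p)
    have yzY: "y \<in> net_seqs" "z \<in> net_seqs" and iso: "isomorphic_subspaces (closed_span (range y)) (closed_span (range z))"
      using p unfolding yz iso_pairs_def by auto
    obtain K :: nat where K: "K \<ge> 1" "lin_iso (real K) (closed_span (range y)) (closed_span (range z))"
      by (rule isomorphic_imp_lin_iso[OF iso subspace_closed_span])
    then obtain c where "iso_code (2 * real K) p c"
      using iso_code_complete[OF net_seqs_block_seq[OF yzY(1)] K(2)] unfolding yz by auto
    then have "iso_code (\<kappa> (K - 1)) p c" using K(1) by (simp add: \<kappa>_def of_nat_diff)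
    then show "p \<in> (\<Union>k. {p. \<exists>c. iso_code (\<kappa> k) p c} \<inter> \<Union>boxes)"
      using yzY unfolding Union_boxes yz by blast
  qed
  then have "\<not> meager boxes (\<Union>k. {p. \<exists>c. iso_code (\<kappa> k) p c} \<inter> \<Union>boxes)"
    using assms meager_subset by blast
  then obtain k where "\<not> meager boxes ({p. \<exists>c. iso_code (\<kappa> k) p c} \<inter> \<Union>boxes)"
    using meager_UN_nat[of boxes "\<lambda>k. {p. \<exists>c. iso_code (\<kappa> k) p c} \<inter> \<Union>boxes"] by blast
  from boxes.analytic_comeager_somewhere[OF iso_code_closed this]
  obtain U where U: "U \<in> boxes" "meager boxes {p \<in> U. \<not> (\<exists>c. iso_code (\<kappa> k) p c)}" by blast
  obtain p t where pt_U: "U = cyl p \<times> cyl t" "fblock p" "fblock t"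
    using U(1) unfolding boxes_def by blast
  obtain C where C: "\<And>n. nowhere_dense boxes (C n)" "\<And>i j. i \<le> j \<Longrightarrow> C i \<subseteq> C j"
    "{p \<in> U. \<not> (\<exists>c. iso_code (\<kappa> k) p c)} \<subseteq> (\<Union>n::nat. C n)"
    using meager_increasing[OF U(2)] by blast
  have "\<exists>\<sigma>. \<forall>n. (shield (C n) (fst (\<sigma> n)) (snd (\<sigma> n)) \<and> (n = 0 \<longrightarrow> (\<exists>t'. snd (\<sigma> n) = t @ t'))) \<and>
      ((\<exists>t'. t' \<noteq> [] \<and> snd (\<sigma> (Suc n)) = snd (\<sigma> n) @ t') \<and>
       (\<forall>u\<in>set (fst (\<sigma> n)). hi u < lo (hd (fst (\<sigma> (Suc n))))))"
  proof (rule dependent_nat_choice)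
    obtain x t' where "shield (C 0) x (t @ t')"
      using ex_shield[OF C(1) pt_U(3)] by metis
    then show "\<exists>x. shield (C 0) (fst x) (snd x) \<and> (0 = (0::nat) \<longrightarrow> (\<exists>t'. snd x = t @ t'))"
      by (intro exI[of _ "(x, t @ t')"]) simp
  next
    fix s n assume s: "shield (C n) (fst s) (snd s) \<and> (n = (0::nat) \<longrightarrow> (\<exists>t'. snd s = t @ t'))"
    then have fb: "fblock (snd s)" unfolding shield_def by blast
    obtain M where M: "\<forall>q\<in>{fst s}. \<forall>u\<in>set q. hi u \<le> M"
      using finite_blocks_bounded[of "{fst s}"] by auto
    obtain x t' where "shield (C (Suc n)) x (snd s @ t')" "t' \<noteq> []" "lo (hd x) = Suc M"
      using ex_shield[OF C(1) fb] by metis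
    then show "\<exists>y. (shield (C (Suc n)) (fst y) (snd y) \<and> (Suc n = 0 \<longrightarrow> (\<exists>t'. snd y = t @ t'))) \<and>
       ((\<exists>t'. t' \<noteq> [] \<and> snd y = snd s @ t') \<and> (\<forall>u\<in>set (fst s). hi u < lo (hd (fst y))))"
      using M by (intro exI[of _ "(x, snd s @ t')"]) (auto simp: less_Suc_eq_le)
  qed
  then obtain \<sigma> where \<sigma>: "\<And>n. shield (C n) (fst (\<sigma> n)) (snd (\<sigma> n))"
    "\<exists>t'. snd (\<sigma> 0) = t @ t'" "\<And>n. \<exists>t'. t' \<noteq> [] \<and> snd (\<sigma> (Suc n)) = snd (\<sigma> n) @ t'"
    "\<And>n u. u \<in> set (fst (\<sigma> n)) \<Longrightarrow> hi u < lo (hd (fst (\<sigma> (Suc n))))"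
    by metis
  define xs where "xs n = fst (\<sigma> n)" for n
  define ts where "ts n = snd (\<sigma> n)" for n
  have xs: "fblock (xs n)" "xs n \<noteq> []" "fblock (ts n)" for n
    using \<sigma>(1)[of n] unfolding shield_def xs_def ts_def by auto
  have xs_lo: "n \<le> lo (hd (xs n))" for n
    by (rule lo_hd_ge[OF xs(1,2)]) (use \<sigma>(4) in \<open>simp add: xs_def\<close>)
  define z where "z = list_limit ts"
  have z_cyl: "z \<in> cyl (ts n)" for n
    unfolding z_def by (rule list_limit_in_cyl) (use \<sigma>(3) xs(3) in \<open>simp_all add: ts_def\<close>)
  have z_t: "z \<in> cyl t"
    using z_cyl[of 0] \<sigma>(2) cyl_append_subset unfolding ts_def by force
  have near_z: "lin_iso (\<kappa> k) (closed_span (range y)) (closed_span (range z))"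
    if y: "y \<in> cyl p" "infinite {n. passes_through y (xs n)}" for y
  proof -
    have "(y, z) \<notin> (\<Union>n. C n)"
    proof (rule iso_code_if_passing[OF _ C(2) z_cyl _ y(2)])
      show "shield (C n) (xs n) (ts n)" for n using \<sigma>(1) unfolding xs_def ts_def .
      show "y \<in> net_seqs" using y(1) cyl_subset_net_seqs by blast
    qed
    then have "(y, z) \<notin> {p \<in> U. \<not> (\<exists>c. iso_code (\<kappa> k) p c)}" using C(3) by blast
    moreover have "(y, z) \<in> U" using y(1) z_t unfolding pt_U(1) by simp
    ultimately obtain c where "iso_code (\<kappa> k) (y, z) c" by blast
    then show ?thesis using \<kappa>0 by (rule iso_code_sound)
  qed
  obtain M where M: "\<forall>q\<in>{p}. \<forall>u\<in>set q. hi u \<le> M"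
    using finite_blocks_bounded[of "{p}"] by auto
  define L where "L = max (length p) (Suc M)"
  have L: "length p \<le> L" "\<And>u. u \<in> set p \<Longrightarrow> hi u < L"
    using M unfolding L_def by (auto simp: less_Suc_eq_le less_max_iff_disj)
  have repl_z: "lin_iso (\<kappa> k) (closed_span (range (replaced p L y))) (closed_span (range z))"
    if y: "y \<in> net_seqs" "infinite {n. passes_through y (xs n)}" for y
  proof (rule near_z)
    have pn: "p ! i \<in> net_vectors" "unit_block (p ! i) \<and> hi (p ! i) < L" if "i < length p" for i
      using pt_U(2) L(2) nth_mem[OF that] net_vectors_unit unfolding fblock_def by blast+
    have "block_seq e (replaced p L y)"
    proof (rule replaced_block_seq[OF net_seqs_block_seq[OF y(1)] pn(2)])
      show "prec (p ! i) (p ! Suc i)" if "Suc i < length p" for i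
        using fblock_sorted[OF pt_U(2)] that by (simp add: sorted_wrt_nth_less)
    qed
    moreover have "replaced p L y i \<in> net_vectors" for i
      using pn(1) y(1) unfolding replaced_def net_seqs_def by simp
    ultimately have "replaced p L y \<in> net_seqs" unfolding net_seqs_def block_seq_iff by blast
    then show "replaced p L y \<in> cyl p" unfolding cyl_def replaced_def by simp
    show "infinite {n. passes_through (replaced p L y) (xs n)}"
    proof (rule passes_through_tail[OF net_seqs_block_seq[OF y(1)] xs(2) xs_lo y(2), of L _ "length p"])
      fix i assume "L \<le> i"
      then obtain j where "i = L + j" using le_Suc_ex by blast
      then show "replaced p L y (length p + (i - L)) = y i" by (simp add: replaced_def)
    qed
  qed
  define c where "c = 4 * basis_const * real L + 1"
  define K1 where "K1 = c * ((2 * basis_const + (c * (\<kappa> k * \<kappa> k) * c) * (1 + 2 * basis_const)) * c)"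
  have K1: "K1 \<ge> 0"
  proof -
    have "c \<ge> 0" unfolding c_def using basis_const_ge_1 by simp
    then show ?thesis
      unfolding K1_def using basis_const_ge_1 \<kappa>0 by (intro mult_nonneg_nonneg add_nonneg_nonneg) auto
  qed
  have Y_iso: "lin_iso K1 (closed_span (range y)) (closed_span (range w))"
    if y: "y \<in> net_seqs" "infinite {n. passes_through y (xs n)}"
      and w: "w \<in> net_seqs" "infinite {n. passes_through w (xs n)}" for y w
    unfolding K1_def c_def
    by (rule lin_iso_of_replaced[OF net_seqs_block_seq[OF y(1)] net_seqs_block_seq[OF w(1)] pt_U(2) L
          lin_iso_trans[OF repl_z[OF y] lin_iso_sym[OF repl_z[OF w]]]])
      (use \<kappa>0 in auto)
  have rnd_pass: "to_net \<circ> y \<in> net_seqs" "infinite {n. passes_through (to_net \<circ> y) (xs n)}"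
    "lin_iso 2 (closed_span (range y)) (closed_span (range (to_net \<circ> y)))"
    if y: "block_seq e y" "infinite {n. passes_through y (xs n)}" for y
  proof -
    show "to_net \<circ> y \<in> net_seqs" by (rule to_net_block_seq(1)[OF y(1)])
    show "lin_iso 2 (closed_span (range y)) (closed_span (range (to_net \<circ> y)))"
      by (rule equi_imp_lin_iso[OF to_net_block_seq(2)[OF y(1)]]) simp
    have "passes_through (to_net \<circ> y) (xs n)" if pass: "passes_through y (xs n)" for n
    proof -
      obtain m where m: "\<And>i. i < length (xs n) \<Longrightarrow> y (m + i) = xs n ! i"
        using pass unfolding passes_through_def by blast
      have "(to_net \<circ> y) (m + i) = xs n ! i" if i: "i < length (xs n)" for i
        using m[OF i] to_net_id[of "xs n ! i"] nth_mem[OF i] xs(1)[of n] unfolding fblock_def by auto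
      then show ?thesis unfolding passes_through_def by blast
    qed
    then have "{n. passes_through y (xs n)} \<subseteq> {n. passes_through (to_net \<circ> y) (xs n)}" by blast
    then show "infinite {n. passes_through (to_net \<circ> y) (xs n)}" using y(2) infinite_super by blast
  qed
  define K2 where "K2 = 2 * K1 * 2"
  have all_iso: "K_isomorphic (max 1 (K2 * K2)) (closed_span (range y)) (closed_span (range w))"
    if y: "block_seq e y" "infinite {n. passes_through y (xs n)}"
      and w: "block_seq e w" "infinite {n. passes_through w (xs n)}" for y w
  proof -
    have "lin_iso K2 (closed_span (range y)) (closed_span (range w))"
      unfolding K2_def
      by (rule lin_iso_trans[OF lin_iso_trans[OF rnd_pass(3)[OF y] Y_iso[OF rnd_pass(1,2)[OF y] rnd_pass(1,2)[OF w]]]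
            lin_iso_sym[OF rnd_pass(3)[OF w]]]) (use K1 in auto)
    then have "K_isomorphic (K2 * K2) (closed_span (range y)) (closed_span (range w))"
      by (rule lin_iso_imp_K_isomorphic) (use K1 in \<open>simp add: K2_def\<close>)
    then show ?thesis by (rule K_isomorphic_mono) simp
  qed
  have "finite_block_seq e (xs n)" for n
    unfolding finite_block_seq_def
  proof (intro conjI ballI allI impI)
    show "xs n \<noteq> []" by (rule xs(2))
    fix v assume "v \<in> set (xs n)"
    then have "unit_block v" using xs(1)[of n] net_vectors_unit unfolding fblock_def by blast
    then show "norm v = 1" "finite (supp e v)" unfolding unit_block_def by auto
  next
    fix i assume "Suc i < length (xs n)"
    then have "prec (xs n ! i) (xs n ! Suc i)"
      using fblock_sorted[OF xs(1)[of n]] by (simp add: sorted_wrt_nth_less)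
    then show "hi (xs n ! i) < lo (xs n ! Suc i)" unfolding prec_def .
  qed
  moreover have "successive e (xs n) (xs (Suc n))" for n
    unfolding successive_def
  proof (intro ballI)
    fix u v assume u: "u \<in> set (xs n)" and v: "v \<in> set (xs (Suc n))"
    have "hi u < lo (hd (xs (Suc n)))" using \<sigma>(4) u unfolding xs_def by blast
    also have "\<dots> \<le> lo v" by (rule fblock_lo_hd[OF xs(1) v])
    finally show "hi u < lo v" .
  qed
  ultimately show ?thesis
    using all_iso by (intro exI[of _ "max 1 (K2 * K2)"] exI[of _ xs] conjI allI impI) auto
qed

end

theorem theorem9:
  fixes e :: "nat \<Rightarrow> 'a::banach"
  assumes "schauder_basis e"
  shows "ergodic TYPE('a) \<or>
    (\<exists>K\<ge>1. \<exists>xs :: nat \<Rightarrow> 'a list.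
       (\<forall>n. finite_block_seq e (xs n)) \<and>
       (\<forall>n. successive e (xs n) (xs (Suc n))) \<and>
       (\<forall>y z. block_seq e y \<and> infinite {n. passes_through y (xs n)} \<and>
              block_seq e z \<and> infinite {n. passes_through z (xs n)} \<longrightarrow>
              K_isomorphic K (closed_span (range y)) (closed_span (range z))))"
proof -
  interpret schauder e by (rule schauder.intro[OF assms])
  show ?thesis using ergodic_if_meager uniform_if_nonmeager by blast
qed

end
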